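(* Let $Q$ be in the Frobenius normal form described in the context, let $(X_i)$ be the associated absorbed Markov chain with initial distribution $\pi$ and absorption time $T$, and assume: (A1) for all $i\in\{1,\dots,k\}$ with $\rho_i<\rho_{\max}$, the diagonal block $Q_{ii}$ is scalar; (A2) there is $\theta\in\mathcal{P}_{\max}$ with $\alpha_\theta\neq0$ and $\pi_{\theta_1}v_{\theta_1}\neq0$. Let $\ell\in\{1,\dots,k\}$ with $\rho_\ell=\rho_{\max}$ and $\mathcal{P}^{(\ell)}_{\max}\neq\emptyset$. Then for all $s\in I_\ell$, with $t(s):=s-\sum_{i=1}^{\ell-1}d_i$, \[ \lim_{n\to\infty}\mathbb{E}_\pi\Big[\tfrac{1}{n+1}\#\{m\in\{0,\dots,n\}:X_m=s\}\,\Big|\,T>n\Big]=u^{(\ell)}_{t(s)}v^{(\ell)}_{t(s)}\,\frac{1}{h^+_{\max}}\,\frac{\sum_{\theta\in\mathcal{P}^{(\ell)}_{\max}}\alpha_\theta\pi_{\theta_1}v_{\theta_1}\prod_{u\in H^-(\theta)}\frac{1}{\rho_{\max}-\rho_{\theta_u}}}{\sum_{\theta\in\mathcal{P}_{\max}}\alpha_\theta\pi_{\theta_1}v_{\theta_1}\prod_{u\in H^-(\theta)}\frac{1}{\rho_{\max}-\rho_{\theta_u}}}, \] where $u^{(\ell)\top}=(u^{(\ell)}_1,\dots,u^{(\ell)}_{d_\ell})$ and $v^{(\ell)}=(v^{(\ell)}_1,\dots,v^{(\ell)}_{d_\ell})^\top$ are the positive left and right eigenvectors of $Q_{\ell\ell}$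 for $\rho_\ell$ normalised by $\sum_{i=1}^{d_\ell}v^{(\ell)}_i=1$ and $u^{(\ell)\top}v^{(\ell)}=1$.
   Context: Let $d\ge2$, $P=\begin{pmatrix}1&0\\R&Q\end{pmatrix}$ a stochastic $(d+1)\times(d+1)$ matrix with $R\in\mathbb{R}^{d\times1}$, $Q\in\mathbb{R}^{d\times d}$, $R,Q\ne0$, all eigenvalues of $Q$ of modulus $<1$. $(X_i)_{i\in\mathbb{N}_0}$ is the Markov chain with transition matrix $P$ (state $0$ absorbing), initial distribution $\pi$ on $\{1,\dots,d\}$, $T=\min\{i:X_i=0\}$. $Q$ is in Frobenius normal form: block lower triangular with blocks $Q_{ij}\in\mathbb{R}^{d_i\times d_j}$, $i,j\in\{1,\dots,k\}$, $Q_{ij}=0$ for $j>i$, each $Q_{ii}$ eventually positive with Perron--Frobenius eigenvalue $\rho_i$; $I_j=\{1+\sum_{i<j}d_i,\dots,\sum_{i\le j}d_i\}$; $\pi=(\pi_1,\dots,\pi_k)$ with $\pi_i\in\mathbb{R}^{1\times d_i}$. $v_i$ is a fixed normed positive right eigenvector of $Q_{ii}$ for $\rho_i$ ($v_i=1$ if $d_i=1$), $V_i^-$ the sum of the generalised eigenspaces of $Q_{ii}$ for its other eigenvalues. Admissible path: strictly decreasing $\theta=(\theta_1,\dots,\theta_\kappa)$ in $\{1,\dots,k\}$ with $Q_{\theta_u\theta_{u+1}}\ne0$ for $u<\kappa$; $\mathcal{P}$ the set of them, $\mathcal{P}^{(\ell)}$ those containing $\ell$. $\rho(\theta)=\max_u\rho_{\theta_u}$,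 $H^+(\theta)=\{u:\rho_{\theta_u}=\rho(\theta)\}$, $H^-(\theta)=\{u:\rho_{\theta_u}<\rho(\theta)\}$, $h^+(\theta)=\#H^+(\theta)$. $\rho_{\max}=\max_i\rho_i$, $h^+_{\max}=\max\{h^+(\theta):\theta\in\mathcal{P},\rho(\theta)=\rho_{\max}\}$, $\mathcal{P}_{\max}=\{\theta\in\mathcal{P}:h^+(\theta)=h^+_{\max},\rho(\theta)=\rho_{\max}\}$, $\mathcal{P}^{(\ell)}_{\max}=\mathcal{P}^{(\ell)}\cap\mathcal{P}_{\max}$. $\alpha_\theta=\alpha_{\theta_\kappa}\cdots\alpha_{\theta_1}$, where $\mathbf1=\alpha_{\theta_\kappa}v_{\theta_\kappa}+w_{\theta_\kappa}$ with $w_{\theta_\kappa}\in V^-_{\theta_\kappa}$ ($\mathbf1$ all-ones) and, for $u=\kappa-1,\dots,1$, $Q_{\theta_u\theta_{u+1}}v_{\theta_{u+1}}=\alpha_{\theta_u}v_{\theta_u}+w_{\theta_u}$ with $w_{\theta_u}\in V^-_{\theta_u}$. *)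

theory Defs
  imports Complex_Main "Jordan_Normal_Form.Spectral_Radius"
begin

(* Blocks are numbered 1..k (as in the paper); block sizes ds i.
   Matrices / vectors of Jordan_Normal_Form are 0-indexed: the paper's state s in {1..d}
   of the transient part corresponds to row/column s-1 of Q. *)

definition off :: "(nat \<Rightarrow> nat) \<Rightarrow> nat \<Rightarrow> nat" where
  "off ds j = (\<Sum>i\<in>{1..<j}. ds i)"

definition blk :: "real mat \<Rightarrow> (nat \<Rightarrow> nat) \<Rightarrow> nat \<Rightarrow> nat \<Rightarrow> real mat" where
  "blk Q ds i j = mat (ds i) (ds j) (\<lambda>(a,b). Q $$ (off ds i + a, off ds j + b))"

definition cmat :: "real mat \<Rightarrow> complex mat" where
  "cmat A = map_mat complex_of_real A"

definition cvec :: "real vec \<Rightarrow> complex vec" where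
  "cvec x = map_vec complex_of_real x"

definition eventually_positive :: "real mat \<Rightarrow> bool" where
  "eventually_positive A \<longleftrightarrow>
     (\<exists>m0. \<forall>m\<ge>m0. \<forall>a<dim_row A. \<forall>b<dim_col A. (A ^\<^sub>m m) $$ (a,b) > 0)"

definition PF_eig :: "real mat \<Rightarrow> (nat \<Rightarrow> nat) \<Rightarrow> nat \<Rightarrow> real" where
  "PF_eig Q ds i = spectral_radius (cmat (blk Q ds i i))"

definition gen_eigenspace :: "complex mat \<Rightarrow> complex \<Rightarrow> complex vec set" where
  "gen_eigenspace A \<mu> = {x \<in> carrier_vec (dim_row A).
     \<exists>m. ((A - \<mu> \<cdot>\<^sub>m 1\<^sub>m (dim_row A)) ^\<^sub>m m) *\<^sub>v x = 0\<^sub>v (dim_row A)}"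

definition other_gen_eigenspaces :: "complex mat \<Rightarrow> complex \<Rightarrow> complex vec set" where
  "other_gen_eigenspaces A \<rho> = {x \<in> carrier_vec (dim_row A).
     \<exists>f. (\<forall>\<mu>. f \<mu> \<in> gen_eigenspace A \<mu>) \<and>
         (\<forall>j<dim_row A. x $ j = (\<Sum>\<mu>\<in>{\<mu>. eigenvalue A \<mu> \<and> \<mu> \<noteq> \<rho>}. f \<mu> $ j))}"

definition Vminus :: "real mat \<Rightarrow> (nat \<Rightarrow> nat) \<Rightarrow> nat \<Rightarrow> complex vec set" where
  "Vminus Q ds i = other_gen_eigenspaces (cmat (blk Q ds i i)) (complex_of_real (PF_eig Q ds i))"

definition coef :: "real mat \<Rightarrow> (nat \<Rightarrow> nat) \<Rightarrow> (nat \<Rightarrow> real vec) \<Rightarrow> nat \<Rightarrow> real vec \<Rightarrow> real" where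
  "coef Q ds v i x = (THE a::real. \<exists>w\<in>Vminus Q ds i.
      cvec x = complex_of_real a \<cdot>\<^sub>v cvec (v i) + w)"

(* admissible paths theta = [theta_1, ..., theta_kappa] (list positions are 0-based) *)
definition admissible :: "real mat \<Rightarrow> (nat \<Rightarrow> nat) \<Rightarrow> nat \<Rightarrow> nat list \<Rightarrow> bool" where
  "admissible Q ds k \<theta> \<longleftrightarrow> \<theta> \<noteq> [] \<and> sorted_wrt (>) \<theta> \<and> set \<theta> \<subseteq> {1..k} \<and>
     (\<forall>u. Suc u < length \<theta> \<longrightarrow>
        blk Q ds (\<theta>!u) (\<theta>!Suc u) \<noteq> 0\<^sub>m (ds (\<theta>!u)) (ds (\<theta>!Suc u)))"

definition adm_paths :: "real mat \<Rightarrow> (nat \<Rightarrow> nat) \<Rightarrow> nat \<Rightarrow> nat list set" where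
  "adm_paths Q ds k = {\<theta>. admissible Q ds k \<theta>}"

definition rho_path :: "real mat \<Rightarrow> (nat \<Rightarrow> nat) \<Rightarrow> nat list \<Rightarrow> real" where
  "rho_path Q ds \<theta> = Max ((\<lambda>i. PF_eig Q ds i) ` set \<theta>)"

definition Hplus :: "real mat \<Rightarrow> (nat \<Rightarrow> nat) \<Rightarrow> nat list \<Rightarrow> nat set" where
  "Hplus Q ds \<theta> = {u. u < length \<theta> \<and> PF_eig Q ds (\<theta>!u) = rho_path Q ds \<theta>}"

definition Hminus :: "real mat \<Rightarrow> (nat \<Rightarrow> nat) \<Rightarrow> nat list \<Rightarrow> nat set" where
  "Hminus Q ds \<theta> = {u. u < length \<theta> \<and> PF_eig Q ds (\<theta>!u) < rho_path Q ds \<theta>}"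

definition rho_max :: "real mat \<Rightarrow> (nat \<Rightarrow> nat) \<Rightarrow> nat \<Rightarrow> real" where
  "rho_max Q ds k = Max ((\<lambda>i. PF_eig Q ds i) ` {1..k})"

definition hplus_max :: "real mat \<Rightarrow> (nat \<Rightarrow> nat) \<Rightarrow> nat \<Rightarrow> nat" where
  "hplus_max Q ds k = Max {card (Hplus Q ds \<theta>) | \<theta>.
      \<theta> \<in> adm_paths Q ds k \<and> rho_path Q ds \<theta> = rho_max Q ds k}"

definition Pmax :: "real mat \<Rightarrow> (nat \<Rightarrow> nat) \<Rightarrow> nat \<Rightarrow> nat list set" where
  "Pmax Q ds k = {\<theta> \<in> adm_paths Q ds k. card (Hplus Q ds \<theta>) = hplus_max Q ds k \<and>
                                      rho_path Q ds \<theta> = rho_max Q ds k}"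

definition alpha_path :: "real mat \<Rightarrow> (nat \<Rightarrow> nat) \<Rightarrow> (nat \<Rightarrow> real vec) \<Rightarrow> nat list \<Rightarrow> real" where
  "alpha_path Q ds v \<theta> =
     coef Q ds v (last \<theta>) (vec (ds (last \<theta>)) (\<lambda>_. 1)) *
     (\<Prod>u<length \<theta> - 1. coef Q ds v (\<theta>!u) (blk Q ds (\<theta>!u) (\<theta>!Suc u) *\<^sub>v v (\<theta>!Suc u)))"

definition piv :: "(nat \<Rightarrow> nat) \<Rightarrow> real vec \<Rightarrow> (nat \<Rightarrow> real vec) \<Rightarrow> nat \<Rightarrow> real" where
  "piv ds \<pi> v i = (\<Sum>a<ds i. \<pi> $ (off ds i + a) * v i $ a)"

definition path_weight :: "real mat \<Rightarrow> (nat \<Rightarrow> nat) \<Rightarrow> nat \<Rightarrow> real vec \<Rightarrow> (nat \<Rightarrow> real vec)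
    \<Rightarrow> nat list \<Rightarrow> real" where
  "path_weight Q ds k \<pi> v \<theta> = alpha_path Q ds v \<theta> * piv ds \<pi> v (hd \<theta>) *
     (\<Prod>u\<in>Hminus Q ds \<theta>. 1 / (rho_max Q ds k - PF_eig Q ds (\<theta>!u)))"

(* The Markov chain on {0,...,d} with transition matrix P = [[1,0],[R,Q]] *)
definition trans :: "real mat \<Rightarrow> real vec \<Rightarrow> nat \<Rightarrow> nat \<Rightarrow> real" where
  "trans Q R s s' = (if s = 0 then (if s' = 0 then 1 else 0)
                     else if s' = 0 then R $ (s - 1) else Q $$ (s - 1, s' - 1))"

definition init_dist :: "real vec \<Rightarrow> nat \<Rightarrow> real" where
  "init_dist \<pi> s = (if s = 0 then 0 else \<pi> $ (s - 1))"

definition path_prob :: "real mat \<Rightarrow> real vec \<Rightarrow> real vec \<Rightarrow> nat list \<Rightarrow> real" where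
  "path_prob Q R \<pi> xs = init_dist \<pi> (hd xs) *
      (\<Prod>i<length xs - 1. trans Q R (xs!i) (xs!Suc i))"

definition traj :: "nat \<Rightarrow> nat \<Rightarrow> nat list set" where
  "traj d n = {xs. length xs = Suc n \<and> set xs \<subseteq> {0..d}}"

(* E_pi[ (1/(n+1)) #{m <= n. X_m = s} | T > n ],  where T > n iff X_0,...,X_n are all nonzero *)
definition cond_occupation :: "real mat \<Rightarrow> real vec \<Rightarrow> real vec \<Rightarrow> nat \<Rightarrow> nat \<Rightarrow> nat \<Rightarrow> real" where
  "cond_occupation Q R \<pi> d n s =
     (\<Sum>xs\<in>traj d n. if 0 \<notin> set xs
        then path_prob Q R \<pi> xs * (real (card {m. m \<le> n \<and> xs!m = s}) / real (Suc n)) else 0) /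
     (\<Sum>xs\<in>traj d n. if 0 \<notin> set xs then path_prob Q R \<pi> xs else 0)"

end

theory Submission
  imports Defs
begin

text \<open>
  Scale \<open>Q\<close> by its largest Perron root. Splitting the trajectories of the chain according to the
  sequence of blocks they visit writes the survival probability as a finite sum, over admissible
  paths, of iterated convolutions of the powers of the diagonal blocks. By Perron--Frobenius the powers of a
  block with the maximal root converge to the rank one matrix \<open>v u\<^sup>T\<close>, whereas a scalar block with a smaller
  root gives a summable geometric sequence. Hence a path with \<open>h\<close> maximal blocks contributes a
  sequence asymptotic to a constant times \<open>n ^ (h - 1) / fact (h - 1)\<close>, and only the paths with the most maximal blocks
  matter. The occupation time of a state \<open>s\<close> in block \<open>l\<close> is the same sum with the visit to \<open>s\<close> as an
  extra renewal point: the paths through \<open>l\<close> now run through block \<open>l\<close> twice, which multiplies their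
  contribution by \<open>u s * v s * n / h\<close>.
\<close>

section \<open>Sequences whose generating function has a pole at one\<close>

text \<open>The convolutions produce pairings with the left Perron vector \<open>u\<close> of a
  block, whereas alpha is defined by splitting along a sum of generalised eigenspaces. The bridge:
  \<open>u\<close> annihilates every generalised eigenspace of another eigenvalue, so the
  coefficient of \<open>x\<close> is the pairing of \<open>u\<close> with \<open>x\<close>; that
  such a splitting exists needs the full eigenspace decomposition and the simplicity of the root.
  The Perron facts do not come from spectral theory: the given positive eigenvector and eventual
  positivity yield the limit of the powers, and \<open>u\<close>, simplicity and uniqueness of both
  eigenvectors are read off from it. A block has pole order 0 or 1, so only convolutions with
  summable and with convergent sequences are required. The factor \<open>1 / h\<close> comes from
  the quotient of binomial coefficients of consecutive orders. Scaling leaves a power of \<rho>m in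
  each path constant; for every path with the maximal number \<open>h\<close> of maximal blocks its
  exponent is \<open>-(h - 1)\<close>, so it cancels. All weights are nonnegative, hence one path as
  in (A2) keeps the denominator away from zero.\<close>

definition multichoose :: "nat \<Rightarrow> nat \<Rightarrow> real" where
  "multichoose r n = real ((r + n) choose r)"

text \<open>The generating function of \<open>x\<close> behaves like \<open>c / (1 - z) ^ p\<close> near \<open>z = 1\<close>; for \<open>p \<ge> 1\<close> this is
  stated for the coefficients themselves, since \<open>multichoose (p - 1) n\<close> is the \<open>n\<close>-th coefficient of
  \<open>1 / (1 - z) ^ p\<close>.\<close>
definition pole_growth :: "nat \<Rightarrow> real \<Rightarrow> (nat \<Rightarrow> real) \<Rightarrow> bool" where
  "pole_growth p c x \<longleftrightarrow> (case p of
       0 \<Rightarrow> summable (\<lambda>n. \<bar>x n\<bar>) \<and> suminf x = c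
     | Suc r \<Rightarrow> (\<lambda>n. x n / multichoose r n) \<longlonglongrightarrow> c)"

lemma pole_growth_0: "pole_growth 0 c x \<longleftrightarrow> summable (\<lambda>n. \<bar>x n\<bar>) \<and> suminf x = c"
  and pole_growth_Suc: "pole_growth (Suc r) c x \<longleftrightarrow> (\<lambda>n. x n / multichoose r n) \<longlonglongrightarrow> c"
  by (simp_all add: pole_growth_def)

lemma multichoose_pos: "multichoose r n > 0"
  by (simp add: multichoose_def)

lemma multichoose_Suc_right:
  "multichoose r n / multichoose r (Suc n) = real (Suc n) / real (Suc (r + n))"
proof -
  have "Suc (r + n) * ((r + n) choose n) = (Suc (r + n) choose Suc n) * Suc n"
    by (rule Suc_times_binomial_eq)
  moreover have "(r + n) choose n = (r + n) choose r"
    by (subst binomial_symmetric) auto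
  moreover have "Suc (r + n) choose Suc n = (r + Suc n) choose r"
    by (subst binomial_symmetric) auto
  ultimately have "Suc (r + n) * ((r + n) choose r) = ((r + Suc n) choose r) * Suc n"
    by simp
  then have "real (Suc (r + n)) * multichoose r n = multichoose r (Suc n) * real (Suc n)"
    unfolding multichoose_def of_nat_mult[symmetric] by simp
  then show ?thesis
    using multichoose_pos[of r n] multichoose_pos[of r "Suc n"]
    by (simp add: field_simps del: of_nat_Suc)
qed

text \<open>With \<open>r = h - 1\<close> the ratio is \<open>h / (h + n)\<close>. Occupation grows
  one order faster than survival, so this is the source of the factor \<open>1 / h\<close> in the
  limit.\<close>

lemma multichoose_Suc_left:
  "multichoose r n / multichoose (Suc r) n = real (Suc r) / real (Suc (r + n))"
proof -
  have "Suc (r + n) * ((r + n) choose r) = (Suc (r + n) choose Suc r) * Suc r"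
    by (rule Suc_times_binomial_eq)
  then have "real (Suc (r + n)) * multichoose r n = multichoose (Suc r) n * real (Suc r)"
    unfolding multichoose_def of_nat_mult[symmetric] by simp
  then show ?thesis
    using multichoose_pos[of r n] multichoose_pos[of "Suc r" n]
    by (simp add: field_simps del: of_nat_Suc)
qed

lemma multichoose_mono: "m \<le> n \<Longrightarrow> multichoose r m \<le> multichoose r n"
  by (rule lift_Suc_mono_le) (cases r, simp_all add: multichoose_def)

lemma multichoose_ratio_tendsto_1:
  "(\<lambda>n. multichoose r n / multichoose r (Suc n)) \<longlonglongrightarrow> 1"
proof -
  have "(\<lambda>n. 1 - real r / real (Suc (r + n))) \<longlonglongrightarrow> 1 - 0"
  proof (intro tendsto_intros)
    have "(\<lambda>n. real r / real n) \<longlonglongrightarrow> 0"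
      by (rule lim_const_over_n)
    from LIMSEQ_ignore_initial_segment[OF this, of "Suc r"]
    show "(\<lambda>n. real r / real (Suc (r + n))) \<longlonglongrightarrow> 0"
      by (simp add: algebra_simps)
  qed
  also have "(\<lambda>n. 1 - real r / real (Suc (r + n))) = (\<lambda>n. multichoose r n / multichoose r (Suc n))"
    by (simp add: multichoose_Suc_right fun_eq_iff field_simps)
  finally show ?thesis by simp
qed

lemma multichoose_ratio_tendsto_0:
  "(\<lambda>n. multichoose r n / multichoose (Suc r) n) \<longlonglongrightarrow> 0"
proof -
  have "(\<lambda>n. real (Suc r) / real n) \<longlonglongrightarrow> 0"
    by (rule lim_const_over_n)
  from LIMSEQ_ignore_initial_segment[OF this, of "Suc r"]
  show ?thesis
    by (simp add: multichoose_Suc_left algebra_simps)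
qed

lemma pole_growth_zero: "pole_growth p 0 (\<lambda>_. 0)"
  by (cases p) (auto simp: pole_growth_0 pole_growth_Suc)

lemma pole_growth_add:
  assumes "pole_growth p c x" "pole_growth p c' x'"
  shows "pole_growth p (c + c') (\<lambda>n. x n + x' n)"
proof (cases p)
  case 0
  then have s: "summable (\<lambda>n. \<bar>x n\<bar>)" "summable (\<lambda>n. \<bar>x' n\<bar>)" "suminf x = c" "suminf x' = c'"
    using assms by (auto simp: pole_growth_0)
  have "summable (\<lambda>n. \<bar>x n + x' n\<bar>)"
    by (rule summable_comparison_test'[OF summable_add[OF s(1,2)], where N = 0]) auto
  moreover have "suminf (\<lambda>n. x n + x' n) = c + c'"
    using suminf_add[OF summable_rabs_cancel[OF s(1)] summable_rabs_cancel[OF s(2)]] s by simp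
  ultimately show ?thesis using 0 by (simp add: pole_growth_0)
next
  case (Suc r)
  then show ?thesis
    using assms by (auto simp: pole_growth_Suc add_divide_distrib intro: tendsto_add)
qed

lemma pole_growth_cmult:
  assumes "pole_growth p c x"
  shows "pole_growth p (b * c) (\<lambda>n. b * x n)"
proof (cases p)
  case 0
  then have s: "summable (\<lambda>n. \<bar>x n\<bar>)" "suminf x = c"
    using assms by (auto simp: pole_growth_0)
  have "summable (\<lambda>n. \<bar>b * x n\<bar>)"
    using summable_mult[OF s(1), of "\<bar>b\<bar>"] by (simp add: abs_mult)
  moreover have "suminf (\<lambda>n. b * x n) = b * c"
    using suminf_mult[OF summable_rabs_cancel[OF s(1)], of b] s by simp
  ultimately show ?thesis using 0 by (simp add: pole_growth_0)
next
  case (Suc r)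
  then show ?thesis
    using tendsto_mult_left[of _ c _ b] assms by (fastforce simp: pole_growth_Suc)
qed

lemma pole_growth_sum:
  assumes "\<And>j. j \<in> J \<Longrightarrow> pole_growth p (c j) (x j)"
  shows "pole_growth p (\<Sum>j\<in>J. c j) (\<lambda>n. \<Sum>j\<in>J. x j n)"
proof (cases "finite J")
  case True
  then show ?thesis using assms
    by (induction J) (auto intro!: pole_growth_zero pole_growth_add)
qed (auto simp: pole_growth_zero)

lemma pole_growth_Suc_order:
  assumes "pole_growth p c x"
  shows "pole_growth (Suc p) 0 x"
proof (cases p)
  case 0
  then have "summable x"
    using assms by (auto simp: pole_growth_0 intro: summable_rabs_cancel)
  then show ?thesis
    using 0 by (simp add: pole_growth_Suc multichoose_def summable_LIMSEQ_zero)
next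
  case (Suc r)
  then have "(\<lambda>n. x n / multichoose r n * (multichoose r n / multichoose (Suc r) n)) \<longlonglongrightarrow> c * 0"
    using assms by (intro tendsto_mult multichoose_ratio_tendsto_0) (simp add: pole_growth_Suc)
  moreover have "x n / multichoose r n * (multichoose r n / multichoose (Suc r) n)
      = x n / multichoose (Suc r) n" for n
    using multichoose_pos[of r n] by simp
  ultimately show ?thesis unfolding Suc pole_growth_Suc by (simp only: mult_zero_right)
qed

text \<open>At any higher order the constant is zero, so paths with fewer maximal blocks can be
  added at the leading order without changing the result.\<close>

lemma pole_growth_higher_order:
  assumes "pole_growth p c x" "p < q"
  shows "pole_growth q 0 x"
proof -
  from \<open>p < q\<close> have "Suc p \<le> q" by simp
  then show ?thesis
    by (induction rule: dec_induct) (auto intro: pole_growth_Suc_order assms(1))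
qed

section \<open>Convolution as multiplication of generating functions\<close>

text \<open>Consecutive values of \<open>multichoose r\<close> have ratio tending to 1, so
  polynomial growth does not notice a fixed shift.\<close>

lemma pole_growth_delay_denominator:
  assumes "(\<lambda>n. x n / multichoose r n) \<longlonglongrightarrow> c"
  shows "(\<lambda>n. x n / multichoose r (n + k)) \<longlonglongrightarrow> c"
proof (induction k)
  case (Suc k)
  have "(\<lambda>n. multichoose r (n + k) / multichoose r (Suc (n + k))) \<longlonglongrightarrow> 1"
    using LIMSEQ_ignore_initial_segment[OF multichoose_ratio_tendsto_1[of r], of k] by simp
  from tendsto_mult[OF Suc.IH this] show ?case
    using multichoose_pos[of r] by (simp add: less_imp_neq[symmetric])
qed (use assms in simp)

text \<open>Tannery's theorem: finitely many terms converge one by one, and a tail of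
  \<open>M\<close> bounds the rest uniformly in \<open>n\<close>.\<close>

lemma dominated_suminf:
  fixes a :: "nat \<Rightarrow> nat \<Rightarrow> real"
  assumes lim: "\<And>k. (\<lambda>n. a k n) \<longlonglongrightarrow> b k"
    and bound: "\<And>k n. \<bar>a k n\<bar> \<le> M k" and "summable M"
  shows "(\<lambda>n. \<Sum>k. a k n) \<longlonglongrightarrow> (\<Sum>k. b k)"
proof (rule LIMSEQ_I)
  fix \<epsilon> :: real assume "\<epsilon> > 0"
  have b_le: "\<bar>b k\<bar> \<le> M k" for k
    by (rule LIMSEQ_le_const2[OF tendsto_rabs[OF lim]]) (use bound in auto)
  \<comment> \<open>Differences of terms are bounded by \<open>2 * M k\<close>, so a quarter of
    \<epsilon> for the tail of \<open>M\<close> leaves half of \<epsilon> to the first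
    \<open>N\<close> terms.\<close>
  obtain N where N: "\<bar>\<Sum>k. M (k + N)\<bar> < \<epsilon> / 4"
    using suminf_exist_split[of "\<epsilon> / 4" M] \<open>\<epsilon> > 0\<close> \<open>summable M\<close> by auto
  have "(\<lambda>n. \<Sum>k<N. \<bar>a k n - b k\<bar>) \<longlonglongrightarrow> (\<Sum>k<N. \<bar>b k - b k\<bar>)"
    by (intro tendsto_intros lim)
  then have "(\<lambda>n. \<Sum>k<N. \<bar>a k n - b k\<bar>) \<longlonglongrightarrow> 0" by simp
  then have "\<forall>\<^sub>F n in sequentially. (\<Sum>k<N. \<bar>a k n - b k\<bar>) < \<epsilon> / 2"
    using \<open>\<epsilon> > 0\<close> by (intro order_tendstoD(2)) auto
  then obtain n0 where n0: "\<And>n. n \<ge> n0 \<Longrightarrow> (\<Sum>k<N. \<bar>a k n - b k\<bar>) < \<epsilon> / 2"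
    by (auto simp: eventually_sequentially)
  have "\<bar>(\<Sum>k. a k n) - (\<Sum>k. b k)\<bar> < \<epsilon>" if "n \<ge> n0" for n
  proof -
    have sa: "summable (\<lambda>k. a k n)" and sb: "summable b"
      using bound b_le by (auto intro!: summable_comparison_test'[OF \<open>summable M\<close>, where N = 0])
    have d_le: "\<bar>a k n - b k\<bar> \<le> 2 * M k" for k
      using bound[of k n] b_le[of k] by linarith
    have sd: "summable (\<lambda>k. \<bar>a k n - b k\<bar>)"
      by (rule summable_comparison_test'[OF summable_mult[OF \<open>summable M\<close>, of 2], where N = 0])
         (use d_le in auto)
    have "\<bar>(\<Sum>k. a k n) - (\<Sum>k. b k)\<bar> = \<bar>\<Sum>k. a k n - b k\<bar>"
      by (simp add: suminf_diff[OF sa sb])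
    also have "\<dots> \<le> (\<Sum>k. \<bar>a k n - b k\<bar>)"
      by (rule summable_rabs[OF sd])
    also have "\<dots> = (\<Sum>k. \<bar>a (k + N) n - b (k + N)\<bar>) + (\<Sum>k<N. \<bar>a k n - b k\<bar>)"
      by (rule suminf_split_initial_segment[OF sd])
    also have "(\<Sum>k. \<bar>a (k + N) n - b (k + N)\<bar>) \<le> (\<Sum>k. 2 * M (k + N))"
      using sd \<open>summable M\<close> d_le
      by (intro suminf_le summable_mult)
         (auto simp: summable_iff_shift summable_iff_shift[of "\<lambda>k. \<bar>a k n - b k\<bar>"])
    also have "\<dots> = 2 * (\<Sum>k. M (k + N))"
      using \<open>summable M\<close> by (intro suminf_mult) (simp add: summable_iff_shift)
    finally show ?thesis using N n0[OF that] by linarith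
  qed
  then show "\<exists>no. \<forall>n\<ge>no. norm ((\<Sum>k. a k n) - (\<Sum>k. b k)) < \<epsilon>" by auto
qed

text \<open>A summable factor only multiplies the constant by its total. For \<open>p = 0\<close>
  this is the Cauchy product. For \<open>p = Suc r\<close> each fixed \<open>m\<close> contributes
  \<open>z m * c\<close> in the limit, and domination holds because \<open>multichoose r\<close> is
  nondecreasing.\<close>

lemma pole_growth_convolution_0:
  assumes z: "pole_growth 0 b z" and x: "pole_growth p c x"
  shows "pole_growth p (b * c) (\<lambda>n. \<Sum>m\<le>n. z m * x (n - m))"
proof (cases p)
  case 0
  have sz: "summable (\<lambda>n. \<bar>z n\<bar>)" "suminf z = b" and sx: "summable (\<lambda>n. \<bar>x n\<bar>)" "suminf x = c"
    using z x 0 by (auto simp: pole_growth_0)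
  have "summable (\<lambda>n. \<Sum>m\<le>n. \<bar>z m\<bar> * \<bar>x (n - m)\<bar>)"
    by (rule summable_Cauchy_product) (use sz sx in auto)
  then have "summable (\<lambda>n. \<bar>\<Sum>m\<le>n. z m * x (n - m)\<bar>)"
    by (rule summable_comparison_test'[where N = 0])
       (auto simp flip: abs_mult intro: sum_abs)
  moreover have "(\<Sum>n. \<Sum>m\<le>n. z m * x (n - m)) = b * c"
    using Cauchy_product[of z x] sz sx by simp
  ultimately show ?thesis using 0 by (simp add: pole_growth_0)
next
  case (Suc r)
  have sz: "summable (\<lambda>n. \<bar>z n\<bar>)" "suminf z = b"
    using z by (auto simp: pole_growth_0)
  have x': "(\<lambda>n. x n / multichoose r n) \<longlonglongrightarrow> c"
    using x Suc by (simp add: pole_growth_Suc)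
  obtain C where C: "\<And>n. \<bar>x n / multichoose r n\<bar> \<le> C"
    using convergent_imp_Bseq[OF convergentI[OF x']] by (auto simp: Bseq_def)
  \<comment> \<open>Continuing the summand by zero beyond \<open>n\<close> turns the convolution
    into a series with fixed index set, as \<open>dominated_suminf\<close> requires.\<close>
  define a where "a k n = (if k \<le> n then z k * (x (n - k) / multichoose r n) else 0)" for k n
  have bound: "\<bar>a k n\<bar> \<le> \<bar>z k\<bar> * C" for k n
  proof (cases "k \<le> n")
    case True
    have "\<bar>x (n - k) / multichoose r n\<bar> \<le> \<bar>x (n - k) / multichoose r (n - k)\<bar>"
      using multichoose_pos[of r n] multichoose_pos[of r "n - k"] multichoose_mono[of "n - k" n r]
      by (simp add: abs_divide frac_le)
    also note C[of "n - k"]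
    finally show ?thesis
      using True mult_left_mono[of _ C "\<bar>z k\<bar>"] by (simp only: a_def abs_mult if_True abs_ge_zero)
  qed (use order_trans[OF abs_ge_zero C] in \<open>simp add: a_def\<close>)
  \<comment> \<open>The limit is taken along \<open>n + k\<close>, where the truncation is
    inactive.\<close>
  have lim: "(\<lambda>n. a k n) \<longlonglongrightarrow> z k * c" for k
  proof (rule LIMSEQ_offset[where k = k])
    show "(\<lambda>n. a k (n + k)) \<longlonglongrightarrow> z k * c"
      using tendsto_mult_left[OF pole_growth_delay_denominator[OF x', of k], of "z k"] by (simp add: a_def)
  qed
  have "(\<lambda>n. \<Sum>k. a k n) \<longlonglongrightarrow> (\<Sum>k. z k * c)"
    by (rule dominated_suminf[OF lim bound summable_mult2[OF sz(1)]])
  also have "(\<lambda>n. \<Sum>k. a k n) = (\<lambda>n. (\<Sum>m\<le>n. z m * x (n - m)) / multichoose r n)"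
  proof
    fix n
    have "(\<Sum>k. a k n) = (\<Sum>k\<le>n. a k n)"
      by (rule suminf_finite) (auto simp: a_def)
    also have "\<dots> = (\<Sum>m\<le>n. z m * x (n - m)) / multichoose r n"
      by (simp add: a_def sum_divide_distrib)
    finally show "(\<Sum>k. a k n) = (\<Sum>m\<le>n. z m * x (n - m)) / multichoose r n" .
  qed
  also have "(\<Sum>k. z k * c) = b * c"
    using suminf_mult2[OF summable_rabs_cancel[OF sz(1)], of c] sz(2) by simp
  finally show ?thesis using Suc by (simp add: pole_growth_Suc)
qed

lemma convolution_commute:
  fixes x y :: "nat \<Rightarrow> real"
  shows "(\<Sum>m\<le>n. x m * y (n - m)) = (\<Sum>m\<le>n. y m * x (n - m))"
  by (rule sum.reindex_bij_witness[of _ "\<lambda>m. n - m" "\<lambda>m. n - m"]) auto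

lemma cesaro_null:
  fixes e :: "nat \<Rightarrow> real"
  assumes "e \<longlonglongrightarrow> 0"
  shows "(\<lambda>n. (\<Sum>m\<le>n. e m) / real (Suc n)) \<longlonglongrightarrow> 0"
proof (rule LIMSEQ_I)
  fix \<epsilon> :: real assume "\<epsilon> > 0"
  then obtain N where N: "\<And>n. n \<ge> N \<Longrightarrow> \<bar>e n\<bar> < \<epsilon> / 2"
    using LIMSEQ_D[OF assms, of "\<epsilon> / 2"] by auto
  define C where "C = (\<Sum>m<N. \<bar>e m\<bar>)"
  have "(\<lambda>n. C / real (Suc n)) \<longlonglongrightarrow> 0"
    using LIMSEQ_Suc[OF lim_const_over_n[of C]] .
  then have "\<forall>\<^sub>F n in sequentially. C / real (Suc n) < \<epsilon> / 2"
    using \<open>\<epsilon> > 0\<close> by (intro order_tendstoD(2)) auto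
  then obtain M where M: "\<And>n. n \<ge> M \<Longrightarrow> C / real (Suc n) < \<epsilon> / 2"
    unfolding eventually_sequentially by blast
  show "\<exists>M. \<forall>n\<ge>M. norm ((\<Sum>m\<le>n. e m) / real (Suc n) - 0) < \<epsilon>"
  proof (intro exI[of _ "max M N"] allI impI)
    fix n assume n: "max M N \<le> n"
    have "\<bar>\<Sum>m\<le>n. e m\<bar> \<le> (\<Sum>m\<le>n. \<bar>e m\<bar>)" by (rule sum_abs)
    also have "\<dots> = C + (\<Sum>m=N..n. \<bar>e m\<bar>)"
    proof -
      have "{..n} = {..<N} \<union> {N..n}" using n by auto
      then show ?thesis unfolding C_def by (subst sum.union_disjoint[symmetric]) auto
    qed
    also have "(\<Sum>m=N..n. \<bar>e m\<bar>) \<le> (\<Sum>m=N..n. \<epsilon> / 2)"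
      using N by (intro sum_mono) (auto intro: less_imp_le)
    also have "\<dots> \<le> real (Suc n) * (\<epsilon> / 2)"
      using \<open>\<epsilon> > 0\<close> n by (auto intro!: mult_right_mono simp: of_nat_diff)
    finally have "\<bar>\<Sum>m\<le>n. e m\<bar> / real (Suc n) \<le> C / real (Suc n) + \<epsilon> / 2"
      by (simp add: divide_simps del: of_nat_Suc) (simp add: algebra_simps del: of_nat_Suc)
    also have "\<dots> < \<epsilon>" using M[of n] n by linarith
    finally show "norm ((\<Sum>m\<le>n. e m) / real (Suc n) - 0) < \<epsilon>"
      by (simp add: abs_divide)
  qed
qed

text \<open>The hockey-stick identity: convolution with the constant sequence 1 multiplies the
  generating function by \<open>1 / (1 - z)\<close>.\<close>

lemma sum_multichoose: "(\<Sum>m\<le>n. multichoose r m) = multichoose (Suc r) n"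
proof -
  have "(r + m) choose r = (r + m) choose m" for m
    by (subst binomial_symmetric) auto
  moreover have "Suc (r + n) choose n = (Suc r + n) choose Suc r"
    by (subst binomial_symmetric) auto
  ultimately show ?thesis
    using sum_choose_lower[of r n] by (simp add: multichoose_def flip: of_nat_sum)
qed

text \<open>A convergent factor adds a simple pole. For \<open>p = 0\<close> the roles swap:
  \<open>x\<close> is the summable factor and \<open>z\<close> has order 1. Otherwise the normalised
  convolution is a weighted mean of \<open>t m * z (n - m)\<close> whose weights are at most
  \<open>Suc r\<close> times the uniform ones, so Cesaro means control the error.\<close>

lemma pole_growth_convolution_1:
  assumes z: "z \<longlonglongrightarrow> b" and x: "pole_growth p c x"
  shows "pole_growth (Suc p) (b * c) (\<lambda>n. \<Sum>m\<le>n. z m * x (n - m))"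
proof (cases p)
  case 0
  then show ?thesis
    using pole_growth_convolution_0[OF x[unfolded 0], of 1 b z] z
    by (simp add: pole_growth_Suc multichoose_def convolution_commute[of z] mult.commute)
next
  case (Suc r)
  define t where "t n = x n / multichoose r n" for n
  have t: "t \<longlonglongrightarrow> c"
    using x Suc by (simp add: pole_growth_Suc t_def[abs_def])
  have xt: "x n = t n * multichoose r n" for n
    using multichoose_pos[of r n] by (simp add: t_def)
  obtain Z where Z: "\<And>n. \<bar>z n\<bar> \<le> Z"
    using convergent_imp_Bseq[OF convergentI[OF z]] by (auto simp: Bseq_def)
  \<comment> \<open>\<open>e1\<close> and \<open>e2\<close> bound the two parts of
    \<open>t z - b c = z (t - c) + c (z - b)\<close>.\<close>
  define e1 where "e1 m = Z * \<bar>t m - c\<bar>" for m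
  define e2 where "e2 m = \<bar>c\<bar> * \<bar>z m - b\<bar>" for m
  have "e1 \<longlonglongrightarrow> Z * \<bar>c - c\<bar>" "e2 \<longlonglongrightarrow> \<bar>c\<bar> * \<bar>b - b\<bar>"
    unfolding e1_def e2_def by (intro tendsto_intros t z)+
  then have e_lim: "(\<lambda>n. (\<Sum>m\<le>n. e1 m) / real (Suc n)) \<longlonglongrightarrow> 0"
     "(\<lambda>n. (\<Sum>m\<le>n. e2 m) / real (Suc n)) \<longlonglongrightarrow> 0"
    by (simp_all only: cesaro_null diff_self abs_zero mult_zero_right)
  define y where "y n = (\<Sum>m\<le>n. z m * x (n - m)) / multichoose (Suc r) n" for n
  have bound: "\<bar>y n - b * c\<bar> \<le> real (Suc r) * ((\<Sum>m\<le>n. e1 m) / real (Suc n) + (\<Sum>m\<le>n. e2 m) / real (Suc n))" for n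
  proof -
    define w where "w m = multichoose r m / multichoose (Suc r) n" for m
    have w0: "w m \<ge> 0" for m
      unfolding w_def using multichoose_pos less_imp_le by (intro divide_nonneg_pos) auto
    have w1: "w m \<le> real (Suc r) / real (Suc n)" if "m \<le> n" for m
    proof -
      have "w m \<le> multichoose r n / multichoose (Suc r) n"
        unfolding w_def using that multichoose_pos by (intro divide_right_mono multichoose_mono) (auto intro: less_imp_le)
      also have "\<dots> \<le> real (Suc r) / real (Suc n)"
        unfolding multichoose_Suc_left by (intro divide_left_mono) auto
      finally show ?thesis .
    qed
    have wsum: "(\<Sum>m\<le>n. w m) = 1"
      using multichoose_pos[of "Suc r" n]
      by (simp add: w_def sum_multichoose flip: sum_divide_distrib)
    have "y n = (\<Sum>m\<le>n. x m * z (n - m)) / multichoose (Suc r) n"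
      unfolding y_def by (subst convolution_commute) simp
    also have "\<dots> = (\<Sum>m\<le>n. w m * (t m * z (n - m)))"
      unfolding sum_divide_distrib xt w_def by (intro sum.cong) auto
    finally have "y n - b * c = (\<Sum>m\<le>n. w m * (t m * z (n - m))) - (\<Sum>m\<le>n. w m) * (b * c)"
      using wsum by simp
    also have "\<dots> = (\<Sum>m\<le>n. w m * (t m * z (n - m) - b * c))"
      by (simp add: sum_distrib_right sum_subtractf right_diff_distrib)
    finally have "\<bar>y n - b * c\<bar> \<le> (\<Sum>m\<le>n. \<bar>w m * (t m * z (n - m) - b * c)\<bar>)"
      by (simp add: sum_abs)
    also have "\<dots> \<le> (\<Sum>m\<le>n. real (Suc r) / real (Suc n) * (e1 m + e2 (n - m)))"
    proof (rule sum_mono)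
      fix m assume "m \<in> {..n}"
      have "t m * z (n - m) - b * c = z (n - m) * (t m - c) + c * (z (n - m) - b)"
        by (simp add: algebra_simps)
      also have "\<bar>\<dots>\<bar> \<le> \<bar>z (n - m)\<bar> * \<bar>t m - c\<bar> + \<bar>c\<bar> * \<bar>z (n - m) - b\<bar>"
        by (rule order_trans[OF abs_triangle_ineq]) (simp add: abs_mult)
      also have "\<dots> \<le> e1 m + e2 (n - m)"
        unfolding e1_def e2_def using Z by (intro add_mono mult_right_mono) auto
      finally have *: "\<bar>t m * z (n - m) - b * c\<bar> \<le> e1 m + e2 (n - m)" .
      have "\<bar>w m * (t m * z (n - m) - b * c)\<bar> = w m * \<bar>t m * z (n - m) - b * c\<bar>"
        using w0 by (simp add: abs_mult)
      also have "\<dots> \<le> real (Suc r) / real (Suc n) * (e1 m + e2 (n - m))"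
        using w1[of m] \<open>m \<in> {..n}\<close> * by (intro mult_mono) auto
      finally show "\<bar>w m * (t m * z (n - m) - b * c)\<bar>
          \<le> real (Suc r) / real (Suc n) * (e1 m + e2 (n - m))" .
    qed
    also have "\<dots> = real (Suc r) / real (Suc n) * ((\<Sum>m\<le>n. e1 m) + (\<Sum>m\<le>n. e2 (n - m)))"
      by (simp only: sum.distrib sum_distrib_left distrib_left)
    also have "(\<Sum>m\<le>n. e2 (n - m)) = (\<Sum>m\<le>n. e2 m)"
      using convolution_commute[of "\<lambda>_. 1" e2 n] by simp
    also have "real (Suc r) / real (Suc n) * ((\<Sum>m\<le>n. e1 m) + (\<Sum>m\<le>n. e2 m))
      = real (Suc r) * ((\<Sum>m\<le>n. e1 m) / real (Suc n) + (\<Sum>m\<le>n. e2 m) / real (Suc n))"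
      by (simp add: add_divide_distrib distrib_left del: of_nat_Suc)
    finally show ?thesis .
  qed
  define G where "G n = real (Suc r) * ((\<Sum>m\<le>n. e1 m) / real (Suc n) + (\<Sum>m\<le>n. e2 m) / real (Suc n))" for n
  have "G \<longlonglongrightarrow> real (Suc r) * (0 + 0)"
    unfolding G_def by (intro tendsto_intros e_lim)
  then have "G \<longlonglongrightarrow> 0" by simp
  then have "(\<lambda>n. \<bar>y n - b * c\<bar>) \<longlonglongrightarrow> 0"
    by (rule tendsto_sandwich[of "\<lambda>_. 0" _ _ G, rotated 3]) (simp_all add: bound[folded G_def])
  then have "(\<lambda>n. y n - b * c) \<longlonglongrightarrow> 0" by (rule tendsto_rabs_zero_cancel)
  then have "y \<longlonglongrightarrow> b * c" by (rule LIM_zero_cancel)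
  then show ?thesis using Suc by (simp add: pole_growth_Suc y_def[abs_def])
qed

section \<open>Forced linear recursions and Perron limits\<close>

text \<open>An inhomogeneous recursion instead of matrix powers, because sources occur twice: a
  block is driven by the blocks it feeds into, and the visits to a state are driven by the survival
  probabilities from that state.\<close>

primrec forced :: "(nat \<Rightarrow> nat \<Rightarrow> real) \<Rightarrow> nat set \<Rightarrow> (nat \<Rightarrow> nat \<Rightarrow> real) \<Rightarrow> nat \<Rightarrow> nat \<Rightarrow> real" where
  "forced A S y 0 a = y 0 a"
| "forced A S y (Suc n) a = (\<Sum>b\<in>S. A a b * forced A S y n b) + y (Suc n) a"

text \<open>Matrices are functions of global indices, so the powers of a diagonal block are those of
  \<open>A\<close> restricted to an index set, without reindexing.\<close>

primrec sub_power :: "(nat \<Rightarrow> nat \<Rightarrow> real) \<Rightarrow> nat set \<Rightarrow> nat \<Rightarrow> nat \<Rightarrow> nat \<Rightarrow> real" where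
  "sub_power A S 0 a b = of_bool (a = b)"
| "sub_power A S (Suc n) a b = (\<Sum>c\<in>S. A a c * sub_power A S n c b)"

text \<open>Duhamel's formula: the source at time \<open>n - m\<close> is propagated by the
  \<open>m\<close>-th power. It turns the recursion into convolutions.\<close>

lemma forced_eq_convolution:
  assumes "finite S" "a \<in> S"
  shows "forced A S y n a = (\<Sum>b\<in>S. \<Sum>m\<le>n. sub_power A S m a b * y (n - m) b)"
  using assms(2)
proof (induction n arbitrary: a)
  case 0
  then show ?case using assms(1) by (simp add: sum.remove[where x = a])
next
  case (Suc n)
  have "(\<Sum>c\<in>S. A a c * forced A S y n c)
      = (\<Sum>c\<in>S. \<Sum>b\<in>S. \<Sum>m\<le>n. A a c * (sub_power A S m c b * y (n - m) b))"
    using Suc.IH by (simp add: sum_distrib_left)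
  also have "\<dots> = (\<Sum>b\<in>S. \<Sum>m\<le>n. \<Sum>c\<in>S. A a c * (sub_power A S m c b * y (n - m) b))"
    by (rule trans[OF sum.swap]) (intro sum.cong refl sum.swap)
  also have "\<dots> = (\<Sum>b\<in>S. \<Sum>m\<le>n. sub_power A S (Suc m) a b * y (n - m) b)"
    by (simp add: sum_distrib_right mult.assoc)
  finally have 1: "(\<Sum>c\<in>S. A a c * forced A S y n c)
      = (\<Sum>b\<in>S. \<Sum>m\<le>n. sub_power A S (Suc m) a b * y (n - m) b)" .
  have 2: "y (Suc n) a = (\<Sum>b\<in>S. sub_power A S 0 a b * y (Suc n) b)"
    using assms(1) Suc.prems by (simp add: sum.remove[where x = a])
  show ?case
    unfolding forced.simps 1 2 sum.distrib[symmetric] sum.atMost_Suc_shift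
    by (simp add: add.commute)
qed

lemma forced_scale:
  "forced (\<lambda>a b. A a b / r) S (\<lambda>n a. y n a / r ^ n) n a = forced A S y n a / r ^ n"
proof (induction n arbitrary: a)
  case (Suc n)
  then show ?case by (simp add: sum_divide_distrib add_divide_distrib)
qed simp

lemma forced_sum:
  "forced A S (\<lambda>n a. \<Sum>j\<in>J. y j n a) n a = (\<Sum>j\<in>J. forced A S (y j) n a)"
proof (induction n arbitrary: a)
  case (Suc n)
  have "(\<Sum>b\<in>S. A a b * (\<Sum>j\<in>J. forced A S (y j) n b))
      = (\<Sum>j\<in>J. \<Sum>b\<in>S. A a b * forced A S (y j) n b)"
    unfolding sum_distrib_left by (rule sum.swap)
  then show ?case by (simp add: Suc.IH sum.distrib)
qed simp

lemma forced_cong: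
  assumes "\<And>n b. b \<in> S \<Longrightarrow> y n b = y' n b" "a \<in> S"
  shows "forced A S y n a = forced A S y' n a"
  using assms(2)
proof (induction n arbitrary: a)
  case (Suc n)
  then show ?case using assms(1) by (auto intro!: sum.cong)
qed (simp add: assms(1))

lemma forced_zero: "forced A S (\<lambda>_ _. 0) n a = 0"
  by (induction n arbitrary: a) auto

section \<open>Powers of a nonnegative block and their limit\<close>

lemma sub_power_add:
  assumes "finite S" "a \<in> S"
  shows "sub_power A S (m + n) a b = (\<Sum>c\<in>S. sub_power A S m a c * sub_power A S n c b)"
  using assms(2)
proof (induction m arbitrary: a)
  case 0
  then show ?case using assms(1) by (simp add: sum.remove[where x = a])
next
  case (Suc m)
  have "sub_power A S (Suc m + n) a b
      = (\<Sum>e\<in>S. \<Sum>c\<in>S. A a e * (sub_power A S m e c * sub_power A S n c b))"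
    using Suc by (simp add: sum_distrib_left)
  also have "\<dots> = (\<Sum>c\<in>S. \<Sum>e\<in>S. A a e * (sub_power A S m e c * sub_power A S n c b))"
    by (rule sum.swap)
  finally show ?case by (simp add: sum_distrib_right mult.assoc)
qed

lemma sub_power_nonneg:
  assumes "\<And>a b. a \<in> S \<Longrightarrow> b \<in> S \<Longrightarrow> A a b \<ge> 0" "a \<in> S" "b \<in> S"
  shows "sub_power A S n a b \<ge> 0"
  using assms(2)
  by (induction n arbitrary: a) (auto intro!: sum_nonneg mult_nonneg_nonneg assms(1))

lemma sub_power_eigenvector:
  assumes "finite S" "\<And>a. a \<in> S \<Longrightarrow> (\<Sum>b\<in>S. A a b * f b) = r * f a" "a \<in> S"
  shows "(\<Sum>b\<in>S. sub_power A S n a b * f b) = r ^ n * f a"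
  using assms(3)
proof (induction n arbitrary: a)
  case 0
  then show ?case using assms(1) by (simp add: sum.remove[where x = a])
next
  case (Suc n)
  have "(\<Sum>b\<in>S. sub_power A S (Suc n) a b * f b)
      = (\<Sum>b\<in>S. \<Sum>c\<in>S. A a c * (sub_power A S n c b * f b))"
    by (simp add: sum_distrib_right mult.assoc)
  also have "\<dots> = (\<Sum>c\<in>S. A a c * (\<Sum>b\<in>S. sub_power A S n c b * f b))"
    by (subst sum.swap) (simp add: sum_distrib_left)
  also have "\<dots> = r ^ n * (\<Sum>c\<in>S. A a c * f c)"
    using Suc.IH by (simp add: sum_distrib_left algebra_simps)
  finally show ?case using assms(2)[OF Suc.prems] by simp
qed

lemma sub_power_scale:
  "sub_power (\<lambda>a b. A a b / r) S n a b = sub_power A S n a b / r ^ n"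
  by (induction n arbitrary: a) (simp_all add: sum_divide_distrib)

text \<open>Doeblin's argument: after conjugation by \<open>v\<close> the matrix is stochastic, and a positive power
  of a stochastic matrix strictly contracts the oscillation of every function.\<close>
lemma sub_power_tendsto:
  assumes S: "finite S" "S \<noteq> {}"
    and A_nonneg: "\<And>a b. a \<in> S \<Longrightarrow> b \<in> S \<Longrightarrow> A a b \<ge> 0"
    and v_pos: "\<And>a. a \<in> S \<Longrightarrow> v a > 0"
    and v_eig: "\<And>a. a \<in> S \<Longrightarrow> (\<Sum>b\<in>S. A a b * v b) = v a"
    and N_pos: "\<And>a b. a \<in> S \<Longrightarrow> b \<in> S \<Longrightarrow> sub_power A S N a b > 0"
    and b: "b \<in> S"
  shows "\<exists>L\<ge>0. \<forall>a\<in>S. (\<lambda>n. sub_power A S n a b) \<longlonglongrightarrow> v a * L"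
proof -
  \<comment> \<open>\<open>T m\<close> is the \<open>m\<close>-th power conjugated by
    \<open>v\<close>, hence stochastic; \<open>f n\<close> is column \<open>b\<close> of the
    \<open>n\<close>-th power divided by \<open>v\<close>. Later columns are
    \<open>T\<close>-averages of earlier ones.\<close>
  define f where "f n a = sub_power A S n a b / v a" for n a
  define T where "T m a c = sub_power A S m a c * v c / v a" for m a c
  have T_sum: "(\<Sum>c\<in>S. T m a c) = 1" if "a \<in> S" for m a
    using sub_power_eigenvector[of S A v 1 a m] S(1) v_eig v_pos[OF that] that
    by (simp add: T_def flip: sum_divide_distrib)
  have T_nonneg: "T m a c \<ge> 0" if "a \<in> S" "c \<in> S" for m a c
    unfolding T_def using that A_nonneg v_pos
    by (intro divide_nonneg_nonneg mult_nonneg_nonneg sub_power_nonneg) (auto intro: less_imp_le)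
  have f_add: "f (m + n) a = (\<Sum>c\<in>S. T m a c * f n c)" if "a \<in> S" for m n a
  proof -
    have "T m a c * f n c = sub_power A S m a c * sub_power A S n c b / v a" if "c \<in> S" for c
      using v_pos[OF that] by (simp add: T_def f_def)
    then show ?thesis
      by (simp add: f_def[of "m + n"] sub_power_add[OF S(1) that] sum_divide_distrib)
  qed
  define lo where "lo n = Min (f n ` S)" for n
  define hi where "hi n = Max (f n ` S)" for n
  have lo_le: "lo n \<le> f n a" and le_hi: "f n a \<le> hi n" if "a \<in> S" for n a
    using S that by (auto simp: lo_def hi_def)
  have lo_in: "\<exists>a\<in>S. f n a = lo n" for n
    using Min_in[of "f n ` S"] S unfolding lo_def by fastforce
  have hi_in: "\<exists>a\<in>S. f n a = hi n" for n
    using Max_in[of "f n ` S"] S unfolding hi_def by fastforce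
  have lo_hi: "lo n \<le> hi n" for n
    using lo_le[OF b, of n] le_hi[OF b, of n] by linarith
  have lo_mono: "lo n \<le> f (m + n) a" and hi_mono: "f (m + n) a \<le> hi n" if "a \<in> S" for m n a
  proof -
    have "lo n = (\<Sum>c\<in>S. T m a c * lo n)" using T_sum[OF that] by (simp flip: sum_distrib_right)
    also have "\<dots> \<le> f (m + n) a"
      unfolding f_add[OF that] using that T_nonneg lo_le by (intro sum_mono mult_left_mono) auto
    finally show "lo n \<le> f (m + n) a" .
    have "f (m + n) a \<le> (\<Sum>c\<in>S. T m a c * hi n)"
      unfolding f_add[OF that] using that T_nonneg le_hi by (intro sum_mono mult_left_mono) auto
    also have "\<dots> = hi n" using T_sum[OF that] by (simp flip: sum_distrib_right)
    finally show "f (m + n) a \<le> hi n" .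
  qed
  \<comment> \<open>Every row of \<open>T N\<close> puts mass at least \<delta> on the point where
    \<open>f n\<close> attains its minimum, which pulls the new maximum down by \<delta> times the
    oscillation.\<close>
  define \<delta> where "\<delta> = Min ((\<lambda>(a, c). T N a c) ` (S \<times> S))"
  have \<delta>_le: "\<delta> \<le> T N a c" if "a \<in> S" "c \<in> S" for a c
    unfolding \<delta>_def using S that by (intro Min_le) auto
  have "\<delta> > 0"
    unfolding \<delta>_def using S N_pos v_pos by (subst Min_gr_iff) (auto simp: T_def)
  have contract: "hi (N + n) - lo (N + n) \<le> (1 - \<delta>) * (hi n - lo n)" for n
  proof -
    obtain c0 where c0: "c0 \<in> S" "f n c0 = lo n" using lo_in by blast
    obtain a where a: "a \<in> S" "f (N + n) a = hi (N + n)" using hi_in by blast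
    have "hi (N + n) = (\<Sum>c\<in>S. T N a c * f n c)" using a f_add by auto
    also have "\<dots> = T N a c0 * lo n + (\<Sum>c\<in>S - {c0}. T N a c * f n c)"
      using S(1) c0 by (simp add: sum.remove)
    also have "\<dots> \<le> T N a c0 * lo n + (\<Sum>c\<in>S - {c0}. T N a c * hi n)"
      using a T_nonneg le_hi by (intro add_left_mono sum_mono mult_left_mono) auto
    also have "(\<Sum>c\<in>S - {c0}. T N a c * hi n) = (1 - T N a c0) * hi n"
      using T_sum[OF a(1), of N] S(1) c0 by (simp add: sum.remove flip: sum_distrib_right)
    also have "T N a c0 * lo n + (1 - T N a c0) * hi n = hi n - T N a c0 * (hi n - lo n)"
      by (simp add: algebra_simps)
    also have "\<dots> \<le> hi n - \<delta> * (hi n - lo n)"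
      using \<delta>_le[OF a(1) c0(1)] lo_hi[of n] by (simp add: mult_right_mono)
    finally have "hi (N + n) \<le> hi n - \<delta> * (hi n - lo n)" .
    moreover obtain a' where "a' \<in> S" "f (N + n) a' = lo (N + n)" using lo_in by blast
    then have "lo n \<le> lo (N + n)" using lo_mono by metis
    ultimately show ?thesis by (simp add: algebra_simps)
  qed
  have lo_inc: "incseq lo"
  proof (rule incseq_SucI)
    fix n
    obtain a where "a \<in> S" "f (Suc n) a = lo (Suc n)" using lo_in by blast
    then show "lo n \<le> lo (Suc n)" using lo_mono[of a n 1] by simp
  qed
  have hi_dec: "decseq hi"
  proof (rule decseq_SucI)
    fix n
    obtain a where "a \<in> S" "f (Suc n) a = hi (Suc n)" using hi_in by blast
    then show "hi (Suc n) \<le> hi n" using hi_mono[of a 1 n] by simp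
  qed
  have "lo n \<le> hi 0" for n
    using lo_hi[of n] decseqD[OF hi_dec, of 0 n] by simp
  then obtain L where L: "lo \<longlonglongrightarrow> L"
    using incseq_convergent[OF lo_inc] by blast
  have "lo 0 \<le> hi n" for n
    using lo_hi[of n] incseqD[OF lo_inc, of 0 n] by simp
  then obtain H where H: "hi \<longlonglongrightarrow> H"
    using decseq_convergent[OF hi_dec] by blast
  \<comment> \<open>Both extremes are monotone and bounded, so letting \<open>n\<close> grow in
    \<open>contract\<close> already forces \<open>H \<le> L\<close>, without computing a
    rate.\<close>
  have "(\<lambda>n. hi (N + n) - lo (N + n)) \<longlonglongrightarrow> H - L"
    using LIMSEQ_ignore_initial_segment[OF H, of N] LIMSEQ_ignore_initial_segment[OF L, of N]
    by (intro tendsto_diff) (simp_all add: add.commute)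
  moreover have "(\<lambda>n. (1 - \<delta>) * (hi n - lo n)) \<longlonglongrightarrow> (1 - \<delta>) * (H - L)"
    by (intro tendsto_intros H L)
  ultimately have "H - L \<le> (1 - \<delta>) * (H - L)"
    by (rule LIMSEQ_le) (use contract in auto)
  then have "\<delta> * (H - L) \<le> 0" by (simp add: algebra_simps)
  then have "H \<le> L" using \<open>\<delta> > 0\<close> by (simp add: mult_le_0_iff)
  moreover have "L \<le> H" by (rule LIMSEQ_le[OF L H]) (use lo_hi in auto)
  ultimately have "hi \<longlonglongrightarrow> L" using H by simp
  have "lo 0 \<ge> 0"
  proof -
    obtain a where a: "a \<in> S" "f 0 a = lo 0" using lo_in by blast
    have "f 0 a \<ge> 0" using v_pos[OF a(1)] by (simp add: f_def less_imp_le)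
    then show ?thesis using a(2) by simp
  qed
  moreover have "lo 0 \<le> L"
    by (rule incseq_le[OF lo_inc L])
  ultimately have "L \<ge> 0" by simp
  moreover have "(\<lambda>n. sub_power A S n a b) \<longlonglongrightarrow> v a * L" if "a \<in> S" for a
  proof -
    have "(\<lambda>n. f n a) \<longlonglongrightarrow> L"
      by (rule tendsto_sandwich[OF _ _ L \<open>hi \<longlonglongrightarrow> L\<close>]) (use lo_le le_hi that in auto)
    from tendsto_mult_left[OF this, of "v a"] show ?thesis
      using v_pos[OF that] by (simp add: f_def less_imp_neq[symmetric])
  qed
  ultimately show ?thesis by blast
qed

text \<open>The entries of \<open>u\<close> are the scalar factors in the column limits.
  Normalisation and the left eigenvector equation follow by letting \<open>n\<close> tend to
  infinity in \<open>A^n v = v\<close> and \<open>A^(n+1) = A^n A\<close>.\<close>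

lemma sub_power_perron_limit:
  assumes S: "finite S" "S \<noteq> {}"
    and A_nonneg: "\<And>a b. a \<in> S \<Longrightarrow> b \<in> S \<Longrightarrow> A a b \<ge> 0"
    and v_pos: "\<And>a. a \<in> S \<Longrightarrow> v a > 0"
    and v_eig: "\<And>a. a \<in> S \<Longrightarrow> (\<Sum>b\<in>S. A a b * v b) = v a"
    and N_pos: "\<And>a b. a \<in> S \<Longrightarrow> b \<in> S \<Longrightarrow> sub_power A S N a b > 0"
  obtains u where "\<And>b. b \<in> S \<Longrightarrow> u b \<ge> 0"
    and "\<And>a b. a \<in> S \<Longrightarrow> b \<in> S \<Longrightarrow> (\<lambda>n. sub_power A S n a b) \<longlonglongrightarrow> v a * u b"
    and "(\<Sum>b\<in>S. u b * v b) = 1"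
    and "\<And>b. b \<in> S \<Longrightarrow> (\<Sum>a\<in>S. u a * A a b) = u b"
proof -
  have "\<forall>b\<in>S. \<exists>L\<ge>0. \<forall>a\<in>S. (\<lambda>n. sub_power A S n a b) \<longlonglongrightarrow> v a * L"
    using sub_power_tendsto[OF assms] by blast
  then obtain u where u: "\<And>b. b \<in> S \<Longrightarrow> u b \<ge> 0"
    and lim: "\<And>a b. a \<in> S \<Longrightarrow> b \<in> S \<Longrightarrow> (\<lambda>n. sub_power A S n a b) \<longlonglongrightarrow> v a * u b"
    by metis
  obtain a where a: "a \<in> S" using S by blast
  have "(\<lambda>n. \<Sum>b\<in>S. sub_power A S n a b * v b) \<longlonglongrightarrow> (\<Sum>b\<in>S. v a * u b * v b)"
    by (intro tendsto_intros lim a)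
  moreover have "(\<Sum>b\<in>S. sub_power A S n a b * v b) = v a" for n
    using sub_power_eigenvector[of S A v 1 a n] S v_eig a by simp
  ultimately have "(\<Sum>b\<in>S. v a * u b * v b) = v a"
    using LIMSEQ_unique[OF tendsto_const] by fastforce
  then have uv: "(\<Sum>b\<in>S. u b * v b) = 1"
    using v_pos[OF a] by (simp add: mult.assoc flip: sum_distrib_left)
  have "(\<Sum>c\<in>S. u c * A c b) = u b" if b: "b \<in> S" for b
  proof -
    have "sub_power A S 1 c b = A c b" if "c \<in> S" for c
      using b S(1) by (simp add: sum.remove[where x = b])
    then have "sub_power A S (n + 1) a b = (\<Sum>c\<in>S. sub_power A S n a c * A c b)" for n
      unfolding sub_power_add[OF S(1) a] by simp
    moreover have "(\<lambda>n. \<Sum>c\<in>S. sub_power A S n a c * A c b) \<longlonglongrightarrow> (\<Sum>c\<in>S. v a * u c * A c b)"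
      by (intro tendsto_intros lim a)
    moreover have "(\<lambda>n. sub_power A S (n + 1) a b) \<longlonglongrightarrow> v a * u b"
      by (rule LIMSEQ_ignore_initial_segment[OF lim[OF a b]])
    ultimately have "(\<Sum>c\<in>S. v a * u c * A c b) = v a * u b"
      using LIMSEQ_unique by force
    then show ?thesis
      using v_pos[OF a] by (simp add: mult.assoc flip: sum_distrib_left)
  qed
  with u lim uv show ?thesis by (rule that)
qed

section \<open>Trajectories\<close>

text \<open>As a source it puts one on every state at time 0, so
  \<open>forced A S impulse n a\<close> is a row sum of the \<open>n\<close>-th power: for
  \<open>Q\<close>, the probability of surviving \<open>n\<close> steps.\<close>

definition impulse :: "nat \<Rightarrow> nat \<Rightarrow> real" where
  "impulse n a = of_bool (n = 0)"

definition alive_lists :: "nat \<Rightarrow> nat \<Rightarrow> nat list set" where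
  "alive_lists d n = {ys. length ys = n \<and> set ys \<subseteq> {1..d}}"

definition walk_weight :: "real mat \<Rightarrow> real vec \<Rightarrow> nat list \<Rightarrow> real" where
  "walk_weight Q R xs = (\<Prod>i<length xs - 1. trans Q R (xs ! i) (xs ! Suc i))"

lemma walk_weight_Cons_Cons:
  "walk_weight Q R (x # y # ys) = trans Q R x y * walk_weight Q R (y # ys)"
  unfolding walk_weight_def by (simp add: prod.lessThan_Suc_shift del: prod.lessThan_Suc)

lemma sum_alive_lists_Suc:
  "(\<Sum>ys\<in>alive_lists d (Suc n). g ys) = (\<Sum>b<d. \<Sum>ys\<in>alive_lists d n. g (Suc b # ys))"
proof -
  have "(\<Sum>b<d. \<Sum>ys\<in>alive_lists d n. g (Suc b # ys))
      = (\<Sum>(b, ys)\<in>{..<d} \<times> alive_lists d n. g (Suc b # ys))"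
    by (simp add: sum.cartesian_product)
  also have "\<dots> = (\<Sum>ys\<in>alive_lists d (Suc n). g ys)"
    by (rule sum.reindex_bij_witness[of _ "\<lambda>ys. (hd ys - 1, tl ys)" "\<lambda>(b, ys). Suc b # ys"])
       (auto simp: alive_lists_def length_Suc_conv)
  finally show ?thesis by simp
qed

text \<open>First-step analysis. State \<open>Suc a\<close> of the chain is row \<open>a\<close> of
  \<open>Q\<close>, since state 0 is the absorbing one.\<close>

lemma sum_walk_weight:
  "(\<Sum>ys\<in>alive_lists d n. walk_weight Q R (Suc a # ys))
    = forced (\<lambda>a b. Q $$ (a, b)) {..<d} impulse n a"
proof (induction n arbitrary: a)
  case 0
  have "alive_lists d 0 = {[]}" by (auto simp: alive_lists_def)
  then show ?case by (simp add: walk_weight_def impulse_def)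
next
  case (Suc n)
  have "(\<Sum>ys\<in>alive_lists d (Suc n). walk_weight Q R (Suc a # ys))
      = (\<Sum>b<d. Q $$ (a, b) * (\<Sum>ys\<in>alive_lists d n. walk_weight Q R (Suc b # ys)))"
    by (simp add: sum_alive_lists_Suc walk_weight_Cons_Cons trans_def sum_distrib_left)
  then show ?case using Suc.IH by (simp add: impulse_def)
qed

text \<open>First-step analysis again: a visit at time 0 contributes the mass surviving from
  \<open>s\<close>, and later visits are counted after the first step. So the visits solve the same
  recursion, driven by the survival sequence of \<open>s\<close>.\<close>

lemma sum_walk_weight_visits:
  "(\<Sum>ys\<in>alive_lists d n. walk_weight Q R (Suc a # ys) * real (length (filter (\<lambda>x. x = Suc s) (Suc a # ys))))
    = forced (\<lambda>a b. Q $$ (a, b)) {..<d}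
        (\<lambda>m b. of_bool (b = s) * forced (\<lambda>a b. Q $$ (a, b)) {..<d} impulse m s) n a"
proof (induction n arbitrary: a)
  case 0
  have "alive_lists d 0 = {[]}" by (auto simp: alive_lists_def)
  then show ?case by (simp add: walk_weight_def impulse_def)
next
  case (Suc n)
  let ?N = "\<lambda>xs. real (length (filter (\<lambda>x. x = Suc s) xs))"
  have split: "walk_weight Q R (Suc a # ys) * ?N (Suc a # ys)
      = walk_weight Q R (Suc a # ys) * ?N ys + of_bool (a = s) * walk_weight Q R (Suc a # ys)" for ys
    by (simp add: algebra_simps)
  have "(\<Sum>ys\<in>alive_lists d (Suc n). walk_weight Q R (Suc a # ys) * ?N (Suc a # ys))
      = (\<Sum>ys\<in>alive_lists d (Suc n). walk_weight Q R (Suc a # ys) * ?N ys)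
        + of_bool (a = s) * (\<Sum>ys\<in>alive_lists d (Suc n). walk_weight Q R (Suc a # ys))"
    unfolding split sum.distrib sum_distrib_left ..
  also have "(\<Sum>ys\<in>alive_lists d (Suc n). walk_weight Q R (Suc a # ys) * ?N ys)
      = (\<Sum>b<d. Q $$ (a, b) * (\<Sum>ys\<in>alive_lists d n. walk_weight Q R (Suc b # ys) * ?N (Suc b # ys)))"
    unfolding sum_alive_lists_Suc walk_weight_Cons_Cons sum_distrib_left
    by (simp add: trans_def mult.assoc)
  also have "of_bool (a = s) * (\<Sum>ys\<in>alive_lists d (Suc n). walk_weight Q R (Suc a # ys))
      = of_bool (a = s) * forced (\<lambda>a b. Q $$ (a, b)) {..<d} impulse (Suc n) s"
    unfolding sum_walk_weight by (cases "a = s") auto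
  finally show ?case unfolding Suc.IH by simp
qed

lemma cond_occupation_eq_forced:
  fixes \<pi> :: "real vec"
  shows "cond_occupation Q R \<pi> d n (Suc s) =
    (\<Sum>a<d. \<pi> $ a * forced (\<lambda>a b. Q $$ (a, b)) {..<d}
        (\<lambda>m b. of_bool (b = s) * forced (\<lambda>a b. Q $$ (a, b)) {..<d} impulse m s) n a) / real (Suc n) /
    (\<Sum>a<d. \<pi> $ a * forced (\<lambda>a b. Q $$ (a, b)) {..<d} impulse n a)"
proof -
  let ?N = "\<lambda>xs. real (length (filter (\<lambda>x. x = Suc s) xs))"
  have fin: "finite (traj d n)"
    unfolding traj_def using finite_lists_length_eq[of "{0..d}" "Suc n"] by (simp add: conj_commute)
  have alive: "{xs \<in> traj d n. 0 \<notin> set xs} = alive_lists d (Suc n)"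
    by (auto simp: traj_def alive_lists_def subset_iff Suc_le_eq intro: gr0I)
  have restrict: "(\<Sum>xs\<in>traj d n. if 0 \<notin> set xs then g xs else 0)
      = (\<Sum>b<d. \<Sum>ys\<in>alive_lists d n. g (Suc b # ys))" for g :: "nat list \<Rightarrow> real"
    using fin by (simp add: sum.inter_filter[symmetric] alive sum_alive_lists_Suc)
  have prob: "path_prob Q R \<pi> (Suc b # ys) = \<pi> $ b * walk_weight Q R (Suc b # ys)" for b ys
    by (simp add: path_prob_def init_dist_def walk_weight_def)
  have visits: "real (card {m. m \<le> n \<and> (Suc b # ys) ! m = Suc s}) = ?N (Suc b # ys)"
    if "ys \<in> alive_lists d n" for b ys
    using that by (simp only: length_filter_conv_card) (simp add: alive_lists_def less_Suc_eq_le)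
  have "(\<Sum>xs\<in>traj d n. if 0 \<notin> set xs
        then path_prob Q R \<pi> xs * (real (card {m. m \<le> n \<and> xs ! m = Suc s}) / real (Suc n)) else 0)
      = (\<Sum>b<d. \<Sum>ys\<in>alive_lists d n. \<pi> $ b * (walk_weight Q R (Suc b # ys) * ?N (Suc b # ys)) / real (Suc n))"
    unfolding restrict prob by (intro sum.cong refl) (simp only: visits times_divide_eq_right mult.assoc)
  also have "\<dots> = (\<Sum>b<d. \<pi> $ b * (\<Sum>ys\<in>alive_lists d n. walk_weight Q R (Suc b # ys) * ?N (Suc b # ys))) / real (Suc n)"
    by (simp only: sum_divide_distrib sum_distrib_left)
  finally show ?thesis
    unfolding cond_occupation_def restrict prob sum_walk_weight_visits
    by (simp only: sum_walk_weight flip: sum_distrib_left)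
qed

section \<open>Block triangular systems\<close>

text \<open>Blocks enter one at a time, so \<open>q\<close> is 0 or 1; for \<open>q = 1\<close> the
  assumption on \<open>z\<close> is plain convergence, \<open>multichoose 0\<close> being constantly
  1.\<close>

lemma pole_growth_convolution:
  assumes "q \<le> 1" "pole_growth q b z" "pole_growth p c x"
  shows "pole_growth (p + q) (b * c) (\<lambda>n. \<Sum>m\<le>n. z m * x (n - m))"
proof (cases q)
  case 0
  then show ?thesis using assms pole_growth_convolution_0 by simp
next
  case (Suc r)
  then show ?thesis
    using assms pole_growth_convolution_1[of z b p c x] by (simp add: pole_growth_Suc multichoose_def)
qed

definition delay :: "(nat \<Rightarrow> real) \<Rightarrow> nat \<Rightarrow> real" where
  "delay x n = (case n of 0 \<Rightarrow> 0 | Suc m \<Rightarrow> x m)"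

lemma delay_simps [simp]: "delay x 0 = 0" "delay x (Suc n) = x n"
  by (simp_all add: delay_def)

lemma pole_growth_impulse: "pole_growth 0 1 (\<lambda>n. impulse n a)"
proof -
  have "(\<lambda>n. impulse n a) sums (\<Sum>n\<in>{0}. impulse n a)"
    by (rule sums_finite) (auto simp: impulse_def)
  moreover have "summable (\<lambda>n. \<bar>impulse n a\<bar>)"
    by (rule summable_finite[of "{0}"]) (auto simp: impulse_def)
  ultimately show ?thesis by (simp add: pole_growth_0 sums_iff impulse_def)
qed

text \<open>A delay is the convolution with a unit mass at time 1, whose total is 1.\<close>

lemma pole_growth_delay:
  assumes "pole_growth p c x"
  shows "pole_growth p c (delay x)"
proof -
  have "(\<lambda>n. of_bool (n = 1)) sums (\<Sum>n\<in>{1::nat}. of_bool (n = 1) :: real)"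
    by (rule sums_finite) auto
  moreover have "summable (\<lambda>n::nat. \<bar>of_bool (n = 1) :: real\<bar>)"
    by (rule summable_finite[of "{1}"]) auto
  ultimately have "pole_growth 0 1 (\<lambda>n. of_bool (n = 1))" by (simp add: pole_growth_0 sums_iff)
  from pole_growth_convolution_0[OF this assms]
  have "pole_growth p c (\<lambda>n. \<Sum>m\<le>n. of_bool (m = 1) * x (n - m))" by simp
  also have "(\<lambda>n. \<Sum>m\<le>n. of_bool (m = 1) * x (n - m)) = delay x"
  proof
    fix n
    show "(\<Sum>m\<le>n. of_bool (m = 1) * x (n - m)) = delay x n"
      by (cases n) (auto simp: sum.remove[of _ 1])
  qed
  finally show ?thesis .
qed

text \<open>\<open>ord i\<close> is the order of the pole contributed by block \<open>i\<close>, and \<open>tot i\<close> the factor by which its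
  constant differs from \<open>v u\<^sup>T\<close>: one for a maximal block, the sum of the geometric series otherwise.\<close>
locale block_triangular =
  fixes A :: "nat \<Rightarrow> nat \<Rightarrow> real" and B :: "nat \<Rightarrow> nat set" and k :: nat
    and v u :: "nat \<Rightarrow> nat \<Rightarrow> real" and ord :: "nat \<Rightarrow> nat" and tot :: "nat \<Rightarrow> real"
  assumes finite_block: "\<And>i. i \<in> {1..k} \<Longrightarrow> finite (B i)"
    and disjoint_blocks: "\<And>i j. i \<in> {1..k} \<Longrightarrow> j \<in> {1..k} \<Longrightarrow> i \<noteq> j \<Longrightarrow> B i \<inter> B j = {}"
    and triangular: "\<And>i j a b. i \<in> {1..k} \<Longrightarrow> j \<in> {1..k} \<Longrightarrow> i < j \<Longrightarrow> a \<in> B i \<Longrightarrow> b \<in> B j \<Longrightarrow> A a b = 0"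
    and ord_le: "\<And>i. ord i \<le> 1"
    and block_growth: "\<And>i a b. i \<in> {1..k} \<Longrightarrow> a \<in> B i \<Longrightarrow> b \<in> B i \<Longrightarrow>
        pole_growth (ord i) (v i a * (tot i * u i b)) (\<lambda>n. sub_power A (B i) n a b)"
begin

text \<open>Contribution of the walks that pass through exactly these blocks in this order: the last
  block is driven by \<open>y\<close>, each earlier one by its successor, and \<open>delay\<close>
  accounts for the time step of the jump.\<close>

fun path_seq :: "nat list \<Rightarrow> (nat \<Rightarrow> nat \<Rightarrow> real) \<Rightarrow> nat \<Rightarrow> nat \<Rightarrow> real" where
  "path_seq [] y = (\<lambda>_ _. 0)"
| "path_seq [i] y = forced A (B i) y"
| "path_seq (i # j # \<theta>) y =
     forced A (B i) (\<lambda>n a. delay (\<lambda>m. \<Sum>b\<in>B j. A a b * path_seq (j # \<theta>) y m b) n)"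

text \<open>A link from \<open>i\<close> to \<open>j\<close> contributes the left Perron vector of
  \<open>i\<close> paired with the image of \<open>v j\<close>, which is the quantity behind alpha.
  \<open>c\<close> holds the growth constants of the source on the last block.\<close>

fun path_const :: "nat list \<Rightarrow> (nat \<Rightarrow> real) \<Rightarrow> real" where
  "path_const [] c = 0"
| "path_const [i] c = tot i * (\<Sum>b\<in>B i. u i b * c b)"
| "path_const (i # j # \<theta>) c =
     tot i * (\<Sum>b\<in>B i. u i b * (\<Sum>e\<in>B j. A b e * v j e)) * path_const (j # \<theta>) c"

definition path_ord :: "nat list \<Rightarrow> nat" where
  "path_ord \<theta> = (\<Sum>i\<leftarrow>\<theta>. ord i)"

definition linked :: "nat \<Rightarrow> nat \<Rightarrow> bool" where
  "linked i j \<longleftrightarrow> (\<exists>a\<in>B i. \<exists>b\<in>B j. A a b \<noteq> 0)"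

definition paths :: "nat list set" where
  "paths = {\<theta>. \<theta> \<noteq> [] \<and> sorted_wrt (>) \<theta> \<and> set \<theta> \<subseteq> {1..k} \<and> successively linked \<theta>}"

definition decreasing_from :: "nat \<Rightarrow> nat list set" where
  "decreasing_from i = {\<theta>. \<theta> \<noteq> [] \<and> sorted_wrt (>) \<theta> \<and> set \<theta> \<subseteq> {1..k} \<and> hd \<theta> = i}"

lemma forced_growth:
  assumes i: "i \<in> {1..k}" and a: "a \<in> B i"
    and y: "\<And>b. b \<in> B i \<Longrightarrow> pole_growth p (c b) (\<lambda>n. y n b)"
  shows "pole_growth (p + ord i) (v i a * (tot i * (\<Sum>b\<in>B i. u i b * c b)))
    (\<lambda>n. forced A (B i) y n a)"
proof -
  have "pole_growth (p + ord i) (\<Sum>b\<in>B i. v i a * (tot i * u i b) * c b)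
      (\<lambda>n. \<Sum>b\<in>B i. \<Sum>m\<le>n. sub_power A (B i) m a b * y (n - m) b)"
    by (intro pole_growth_sum pole_growth_convolution ord_le block_growth i a y)
  then show ?thesis
    unfolding forced_eq_convolution[OF finite_block[OF i] a]
    by (simp add: sum_distrib_left mult.assoc)
qed

text \<open>Orders add and constants multiply: what a block receives from its successor
  \<open>j\<close> has constants that depend on \<open>b\<close> only through \<open>v j b\<close>,
  so a single scalar is passed along the path.\<close>

lemma path_seq_growth:
  assumes "\<theta> \<noteq> []" "set \<theta> \<subseteq> {1..k}" "a \<in> B (hd \<theta>)"
    and "\<And>b. b \<in> B (last \<theta>) \<Longrightarrow> pole_growth p (c b) (\<lambda>n. y n b)"
  shows "pole_growth (p + path_ord \<theta>) (v (hd \<theta>) a * path_const \<theta> c) (\<lambda>n. path_seq \<theta> y n a)"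
  using assms
proof (induction \<theta> y arbitrary: a rule: path_seq.induct)
  case (2 i y)
  then show ?case using forced_growth[of i a p c y] by (simp add: path_ord_def)
next
  case (3 i j \<theta> y)
  have i: "i \<in> {1..k}" using 3 by simp
  let ?q = "p + path_ord (j # \<theta>)"
  let ?c = "\<lambda>a. \<Sum>b\<in>B j. A a b * (v j b * path_const (j # \<theta>) c)"
  have "pole_growth ?q (?c a') (\<lambda>n. delay (\<lambda>m. \<Sum>b\<in>B j. A a' b * path_seq (j # \<theta>) y m b) n)" for a'
    using "3.IH" "3.prems" by (intro pole_growth_delay pole_growth_sum pole_growth_cmult) auto
  from forced_growth[OF i _ this, of a]
  have "pole_growth (?q + ord i) (v i a * (tot i * (\<Sum>b\<in>B i. u i b * ?c b)))
     (\<lambda>n. path_seq (i # j # \<theta>) y n a)" using "3.prems" by simp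
  moreover have "(\<Sum>b\<in>B i. u i b * ?c b)
      = (\<Sum>b\<in>B i. u i b * (\<Sum>e\<in>B j. A b e * v j e)) * path_const (j # \<theta>) c"
    by (simp add: sum_distrib_right sum_distrib_left mult.assoc)
  ultimately show ?case by (simp add: path_ord_def algebra_simps)
qed simp

lemma path_seq_sum:
  "path_seq \<theta> (\<lambda>n a. \<Sum>j\<in>J. y j n a) n a = (\<Sum>j\<in>J. path_seq \<theta> (y j) n a)"
proof (induction \<theta> arbitrary: n a rule: induct_list012)
  case (3 i j' \<theta>)
  have *: "delay (\<lambda>m. \<Sum>b\<in>B j'. A a b * (\<Sum>j\<in>J. path_seq (j' # \<theta>) (y j) m b)) n
      = (\<Sum>j\<in>J. delay (\<lambda>m. \<Sum>b\<in>B j'. A a b * path_seq (j' # \<theta>) (y j) m b) n)" for n a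
    by (cases n) (auto simp: sum_distrib_left intro: sum.swap)
  show ?case by (simp only: path_seq.simps "3.IH"(2) * forced_sum)
qed (simp_all add: forced_sum)

lemma path_seq_eq_0_if_not_linked:
  assumes "\<not> successively linked \<theta>" "a \<in> B (hd \<theta>)"
  shows "path_seq \<theta> y n a = 0"
  using assms
proof (induction \<theta> arbitrary: n a rule: induct_list012)
  case (3 i j \<theta>)
  have "delay (\<lambda>m. \<Sum>b\<in>B j. A a' b * path_seq (j # \<theta>) y m b) n' = 0" if "a' \<in> B i" for a' n'
  proof (cases n')
    case (Suc m)
    have "A a' b * path_seq (j # \<theta>) y m b = 0" if "b \<in> B j" for b
    proof (cases "linked i j")
      case True
      then show ?thesis using 3 that by simp
    next
      case False
      then show ?thesis using \<open>a' \<in> B i\<close> that by (simp add: linked_def)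
    qed
    then show ?thesis using Suc by simp
  qed simp
  then show ?case
    using forced_cong[of "B i" _ "\<lambda>_ _. 0" a] "3.prems" by (simp add: forced_zero)
qed simp_all

lemma path_seq_eq_0_if_no_forcing:
  assumes "\<And>n b. b \<in> B (last \<theta>) \<Longrightarrow> y n b = 0" "a \<in> B (hd \<theta>)"
  shows "path_seq \<theta> y n a = 0"
  using assms
proof (induction \<theta> arbitrary: n a rule: induct_list012)
  case (2 i)
  then show ?case using forced_cong[of "B i" y "\<lambda>_ _. 0" a] by (simp add: forced_zero)
next
  case (3 i j \<theta>)
  have "delay (\<lambda>m. \<Sum>b\<in>B j. A a' b * path_seq (j # \<theta>) y m b) n' = 0" for a' n'
    using 3 by (cases n') auto
  then show ?case by (simp add: forced_zero)
qed simp

section \<open>Expanding the block triangular recursion over paths\<close>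

lemma decreasing_imp_distinct: "sorted_wrt (>) \<theta> \<Longrightarrow> distinct \<theta>" for \<theta> :: "nat list"
  by (induction \<theta>) auto

lemma finite_decreasing: "finite {\<theta>. sorted_wrt (>) \<theta> \<and> set \<theta> \<subseteq> {1..k}}"
proof (rule finite_subset)
  show "{\<theta>. sorted_wrt (>) \<theta> \<and> set \<theta> \<subseteq> {1..k}} \<subseteq> {\<theta>. set \<theta> \<subseteq> {1..k} \<and> distinct \<theta>}"
    using decreasing_imp_distinct by auto
  show "finite {\<theta>. set \<theta> \<subseteq> {1..k} \<and> distinct \<theta>}"
    by (rule finite_subset_distinct) simp
qed

lemma finite_decreasing_from: "finite (decreasing_from i)"
  unfolding decreasing_from_def by (rule finite_subset[OF _ finite_decreasing]) auto

lemma finite_paths: "finite paths"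
  unfolding paths_def by (rule finite_subset[OF _ finite_decreasing]) auto

lemma decreasing_from_eq:
  assumes "i \<in> {1..k}"
  shows "decreasing_from i = (#) i ` ({[]} \<union> (\<Union>j\<in>{1..<i}. decreasing_from j))"
proof (rule subset_antisym; rule subsetI)
  fix \<theta> assume *: "\<theta> \<in> decreasing_from i"
  then obtain \<theta>' where \<theta>: "\<theta> = i # \<theta>'" by (cases \<theta>) (auto simp: decreasing_from_def)
  have "\<theta>' = [] \<or> (\<exists>j\<in>{1..<i}. \<theta>' \<in> decreasing_from j)"
    using * unfolding \<theta> decreasing_from_def by (cases \<theta>') auto
  then show "\<theta> \<in> (#) i ` ({[]} \<union> (\<Union>j\<in>{1..<i}. decreasing_from j))" using \<theta> by auto
next
  fix \<theta> assume "\<theta> \<in> (#) i ` ({[]} \<union> (\<Union>j\<in>{1..<i}. decreasing_from j))"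
  then show "\<theta> \<in> decreasing_from i"
    using assms by (fastforce simp: decreasing_from_def neq_Nil_conv)
qed

lemma sum_decreasing_from:
  assumes "i \<in> {1..k}"
  shows "(\<Sum>\<theta>\<in>decreasing_from i. g \<theta>) = (g [i] :: real) + (\<Sum>j\<in>{1..<i}. \<Sum>\<theta>\<in>decreasing_from j. g (i # \<theta>))"
proof -
  have disj: "[] \<notin> decreasing_from j" "j \<noteq> j' \<Longrightarrow> decreasing_from j \<inter> decreasing_from j' = {}" for j j'
    by (auto simp: decreasing_from_def)
  have "(\<Sum>\<theta>\<in>decreasing_from i. g \<theta>) = (\<Sum>\<theta>\<in>{[]} \<union> (\<Union>j\<in>{1..<i}. decreasing_from j). g (i # \<theta>))"
    unfolding decreasing_from_eq[OF assms] by (subst sum.reindex) auto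
  also have "\<dots> = g [i] + (\<Sum>\<theta>\<in>(\<Union>j\<in>{1..<i}. decreasing_from j). g (i # \<theta>))"
    by (subst sum.union_disjoint) (auto simp: finite_decreasing_from disj)
  also have "(\<Sum>\<theta>\<in>(\<Union>j\<in>{1..<i}. decreasing_from j). g (i # \<theta>))
      = (\<Sum>j\<in>{1..<i}. \<Sum>\<theta>\<in>decreasing_from j. g (i # \<theta>))"
    by (rule sum.UNION_disjoint) (simp_all add: finite_decreasing_from disj)
  finally show ?thesis .
qed

lemma sum_blocks: "(\<Sum>b\<in>(\<Union>j\<in>{1..k}. B j). g b) = (\<Sum>j\<in>{1..k}. \<Sum>b\<in>B j. g b)"
  using finite_block disjoint_blocks by (intro sum.UNION_disjoint) auto

text \<open>Induction on time. A step from block \<open>i\<close> either stays in \<open>i\<close>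
  and keeps the list, or enters a lower block and removes the head; together these are the recursion
  of \<open>path_seq\<close>. Higher-numbered blocks are unreachable.\<close>

lemma forced_eq_sum_path_seq:
  assumes "i \<in> {1..k}" "a \<in> B i"
  shows "forced A (\<Union>j\<in>{1..k}. B j) y n a = (\<Sum>\<theta>\<in>decreasing_from i. path_seq \<theta> y n a)"
  using assms
proof (induction n arbitrary: i a)
  case 0
  have "path_seq (i # \<theta>) y 0 a = 0" if "\<theta> \<in> decreasing_from j" for \<theta> j
    using that by (cases \<theta>) (auto simp: decreasing_from_def)
  then show ?case using 0 by (simp add: sum_decreasing_from)
next
  case (Suc n)
  let ?G = "\<lambda>j. \<Sum>b\<in>B j. A a b * (\<Sum>\<theta>\<in>decreasing_from j. path_seq \<theta> y n b)"
  have G: "?G j = (\<Sum>\<theta>\<in>decreasing_from j. \<Sum>b\<in>B j. A a b * path_seq \<theta> y n b)" for j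
    unfolding sum_distrib_left by (rule sum.swap)
  have "forced A (\<Union>j\<in>{1..k}. B j) y (Suc n) a = (\<Sum>j\<in>{1..k}. ?G j) + y (Suc n) a"
    unfolding forced.simps sum_blocks using Suc.IH by simp
  also have "(\<Sum>j\<in>{1..k}. ?G j) = (\<Sum>j\<in>insert i {1..<i}. ?G j)"
  proof (rule sum.mono_neutral_right)
    show "\<forall>j\<in>{1..k} - insert i {1..<i}. ?G j = 0"
    proof
      fix j assume "j \<in> {1..k} - insert i {1..<i}"
      then have j: "j \<in> {1..k}" "i < j" by auto
      have "A a b = 0" if "b \<in> B j" for b
        by (rule triangular[OF Suc.prems(1) j Suc.prems(2) that])
      then show "?G j = 0" by simp
    qed
  qed (use Suc.prems in auto)
  also have "\<dots> = ?G i + (\<Sum>j\<in>{1..<i}. ?G j)" by simp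
  \<comment> \<open>Splitting off \<open>[i]\<close> lets each \<open>i # \<theta>\<close> meet the
    jump term of the same \<theta> in the sum over lower blocks.\<close>
  also have "?G i = (\<Sum>b\<in>B i. A a b * path_seq [i] y n b)
      + (\<Sum>j\<in>{1..<i}. \<Sum>\<theta>\<in>decreasing_from j. \<Sum>b\<in>B i. A a b * path_seq (i # \<theta>) y n b)"
    unfolding G[of i] by (rule sum_decreasing_from[OF Suc.prems(1)])
  finally have "forced A (\<Union>j\<in>{1..k}. B j) y (Suc n) a =
      ((\<Sum>b\<in>B i. A a b * path_seq [i] y n b) + y (Suc n) a) +
      (\<Sum>j\<in>{1..<i}. \<Sum>\<theta>\<in>decreasing_from j. (\<Sum>b\<in>B i. A a b * path_seq (i # \<theta>) y n b)
         + (\<Sum>b\<in>B j. A a b * path_seq \<theta> y n b))"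
    unfolding G sum.distrib by simp
  also have "(\<Sum>j\<in>{1..<i}. \<Sum>\<theta>\<in>decreasing_from j. (\<Sum>b\<in>B i. A a b * path_seq (i # \<theta>) y n b)
         + (\<Sum>b\<in>B j. A a b * path_seq \<theta> y n b))
     = (\<Sum>j\<in>{1..<i}. \<Sum>\<theta>\<in>decreasing_from j. path_seq (i # \<theta>) y (Suc n) a)"
  proof (intro sum.cong refl)
    fix j \<theta> assume "\<theta> \<in> decreasing_from j"
    then obtain \<theta>' where "\<theta> = j # \<theta>'" by (cases \<theta>) (auto simp: decreasing_from_def)
    then show "(\<Sum>b\<in>B i. A a b * path_seq (i # \<theta>) y n b) + (\<Sum>b\<in>B j. A a b * path_seq \<theta> y n b)
       = path_seq (i # \<theta>) y (Suc n) a" by simp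
  qed
  finally show ?case unfolding sum_decreasing_from[OF Suc.prems(1)] by simp
qed

lemma forced_eq_sum_paths:
  assumes "i \<in> {1..k}" "a \<in> B i"
  shows "forced A (\<Union>j\<in>{1..k}. B j) y n a = (\<Sum>\<theta>\<in>{\<theta> \<in> paths. hd \<theta> = i}. path_seq \<theta> y n a)"
  unfolding forced_eq_sum_path_seq[OF assms]
proof (rule sum.mono_neutral_right)
  show "\<forall>\<theta>\<in>decreasing_from i - {\<theta> \<in> paths. hd \<theta> = i}. path_seq \<theta> y n a = 0"
    using assms by (auto simp: decreasing_from_def paths_def intro!: path_seq_eq_0_if_not_linked)
qed (auto simp: finite_decreasing_from, auto simp: paths_def decreasing_from_def)

lemma sum_forced_eq_sum_paths:
  "(\<Sum>a\<in>(\<Union>j\<in>{1..k}. B j). w a * forced A (\<Union>j\<in>{1..k}. B j) y n a)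
    = (\<Sum>\<theta>\<in>paths. \<Sum>a\<in>B (hd \<theta>). w a * path_seq \<theta> y n a)"
proof -
  have "(\<Sum>a\<in>(\<Union>j\<in>{1..k}. B j). w a * forced A (\<Union>j\<in>{1..k}. B j) y n a)
      = (\<Sum>i\<in>{1..k}. \<Sum>a\<in>B i. \<Sum>\<theta>\<in>{\<theta> \<in> paths. hd \<theta> = i}. w a * path_seq \<theta> y n a)"
    unfolding sum_blocks by (intro sum.cong refl) (simp only: forced_eq_sum_paths sum_distrib_left)
  also have "\<dots> = (\<Sum>i\<in>{1..k}. \<Sum>\<theta>\<in>{\<theta> \<in> paths. hd \<theta> = i}. \<Sum>a\<in>B (hd \<theta>). w a * path_seq \<theta> y n a)"
    by (intro sum.cong refl, subst sum.swap) (auto intro: sum.cong)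
  also have "\<dots> = (\<Sum>\<theta>\<in>paths. \<Sum>a\<in>B (hd \<theta>). w a * path_seq \<theta> y n a)"
    by (rule sum.group[OF finite_paths]) (auto simp: paths_def neq_Nil_conv)
  finally show ?thesis .
qed

text \<open>Cutting at \<open>l\<close> makes the path run through that block twice. The second
  passage only inserts the factor \<open>tot l * u l s * v l s\<close>, and
  \<open>tot l = 1\<close>.\<close>

lemma path_const_split:
  assumes l: "l \<in> {1..k}" "s \<in> B l" "tot l = 1"
  shows "path_const (P @ [l]) (\<lambda>b. of_bool (b = s) * (v l s * path_const (l # T) c))
    = u l s * v l s * path_const (P @ l # T) c"
proof (induction P rule: induct_list012)
  case 1
  have "(\<Sum>b\<in>B l. u l b * (of_bool (b = s) * (v l s * path_const (l # T) c)))
      = u l s * (v l s * path_const (l # T) c)"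
    using finite_block[OF l(1)] l(2) by (simp add: sum.remove[of _ s])
  then show ?case using l by simp
next
  case (2 i)
  have "(\<Sum>b\<in>B l. u l b * (of_bool (b = s) * (v l s * path_const (l # T) c)))
      = u l s * (v l s * path_const (l # T) c)"
    using finite_block[OF l(1)] l(2) by (simp add: sum.remove[of _ s])
  then show ?case using l by simp
qed simp

lemma path_const_mult_growth:
  assumes "\<theta> \<in> paths" "path_ord \<theta> \<le> h"
  shows "pole_growth h (if path_ord \<theta> = h then path_const \<theta> (\<lambda>_. 1) * (\<Sum>a\<in>B (hd \<theta>). w a * v (hd \<theta>) a) else 0)
    (\<lambda>n. \<Sum>a\<in>B (hd \<theta>). w a * path_seq \<theta> impulse n a)"
proof -
  have "pole_growth (0 + path_ord \<theta>) (\<Sum>a\<in>B (hd \<theta>). w a * (v (hd \<theta>) a * path_const \<theta> (\<lambda>_. 1)))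
      (\<lambda>n. \<Sum>a\<in>B (hd \<theta>). w a * path_seq \<theta> impulse n a)"
    using assms by (intro pole_growth_sum pole_growth_cmult path_seq_growth pole_growth_impulse)
      (auto simp: paths_def)
  also have "(\<Sum>a\<in>B (hd \<theta>). w a * (v (hd \<theta>) a * path_const \<theta> (\<lambda>_. 1)))
      = path_const \<theta> (\<lambda>_. 1) * (\<Sum>a\<in>B (hd \<theta>). w a * v (hd \<theta>) a)"
    by (simp add: sum_distrib_left algebra_simps)
  finally show ?thesis
    using assms(2) pole_growth_higher_order by auto
qed

lemma survival_growth:
  assumes "\<And>\<theta>. \<theta> \<in> paths \<Longrightarrow> path_ord \<theta> \<le> h"
  shows "pole_growth h
    (\<Sum>\<theta>\<in>{\<theta> \<in> paths. path_ord \<theta> = h}. path_const \<theta> (\<lambda>_. 1) * (\<Sum>a\<in>B (hd \<theta>). w a * v (hd \<theta>) a))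
    (\<lambda>n. \<Sum>a\<in>(\<Union>j\<in>{1..k}. B j). w a * forced A (\<Union>j\<in>{1..k}. B j) impulse n a)"
  unfolding sum_forced_eq_sum_paths sum.inter_filter[OF finite_paths]
  by (rule pole_growth_sum, rule path_const_mult_growth) (use assms in auto)

lemma append_in_paths_iff:
  "P @ l # T \<in> paths \<longleftrightarrow> P @ [l] \<in> paths \<and> l # T \<in> paths"
proof -
  have "sorted_wrt (>) (P @ l # T) \<longleftrightarrow> sorted_wrt (>) (P @ [l]) \<and> sorted_wrt (>) (l # T)"
    unfolding sorted_wrt_append by auto (meson less_trans)
  moreover have "successively linked (P @ l # T) \<longleftrightarrow>
      successively linked (P @ [l]) \<and> successively linked (l # T)"
    unfolding successively_append_iff by auto
  ultimately show ?thesis unfolding paths_def by auto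
qed

text \<open>A decreasing path meets \<open>l\<close> at most once, so cutting there and gluing are
  mutually inverse; both pieces keep the block \<open>l\<close>.\<close>

lemma sum_path_pairs:
  "(\<Sum>\<theta>'\<in>{\<theta> \<in> paths. last \<theta> = l}. \<Sum>\<theta>''\<in>{\<theta> \<in> paths. hd \<theta> = l}. g \<theta>' \<theta>'')
    = (\<Sum>\<theta>\<in>{\<theta> \<in> paths. l \<in> set \<theta>}. g (takeWhile (\<lambda>i. i \<noteq> l) \<theta> @ [l]) (dropWhile (\<lambda>i. i \<noteq> l) \<theta>))"
proof -
  have split: "\<exists>P T. \<theta> = P @ l # T \<and> takeWhile (\<lambda>i. i \<noteq> l) \<theta> = P \<and> dropWhile (\<lambda>i. i \<noteq> l) \<theta> = l # T"
    if l_in: "l \<in> set \<theta>" for \<theta>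
  proof -
    obtain P T where "\<theta> = P @ l # T" "l \<notin> set P" using split_list_first[OF l_in] by blast
    then show ?thesis by (auto simp: takeWhile_append dropWhile_append)
  qed
  have ends: "\<exists>P T. \<theta>' = P @ [l] \<and> \<theta>'' = l # T \<and> l \<notin> set P"
    if ends: "\<theta>' \<in> paths" "last \<theta>' = l" "\<theta>'' \<in> paths" "hd \<theta>'' = l" for \<theta>' \<theta>''
  proof -
    have ne: "\<theta>' \<noteq> []" "\<theta>'' \<noteq> []" using that by (auto simp: paths_def)
    obtain P where P: "\<theta>' = P @ [l]" using ne(1) ends(2) by (cases \<theta>' rule: rev_cases) auto
    moreover obtain T where "\<theta>'' = l # T" using ne(2) ends(4) by (cases \<theta>'') auto
    moreover have "l \<notin> set P"
      using that(1) decreasing_imp_distinct[of \<theta>'] unfolding paths_def P by simp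
    ultimately show ?thesis by blast
  qed
  have "(\<Sum>\<theta>'\<in>{\<theta> \<in> paths. last \<theta> = l}. \<Sum>\<theta>''\<in>{\<theta> \<in> paths. hd \<theta> = l}. g \<theta>' \<theta>'')
      = (\<Sum>(\<theta>', \<theta>'')\<in>{\<theta> \<in> paths. last \<theta> = l} \<times> {\<theta> \<in> paths. hd \<theta> = l}. g \<theta>' \<theta>'')"
    by (rule sum.cartesian_product)
  also have "\<dots> = (\<Sum>\<theta>\<in>{\<theta> \<in> paths. l \<in> set \<theta>}. g (takeWhile (\<lambda>i. i \<noteq> l) \<theta> @ [l]) (dropWhile (\<lambda>i. i \<noteq> l) \<theta>))"
  proof (rule sum.reindex_bij_witness[of _ "\<lambda>\<theta>. (takeWhile (\<lambda>i. i \<noteq> l) \<theta> @ [l], dropWhile (\<lambda>i. i \<noteq> l) \<theta>)"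
        "\<lambda>(\<theta>', \<theta>''). \<theta>' @ tl \<theta>''"])
    fix \<theta> assume \<theta>: "\<theta> \<in> {\<theta> \<in> paths. l \<in> set \<theta>}"
    then obtain P T where PT: "\<theta> = P @ l # T" "takeWhile (\<lambda>i. i \<noteq> l) \<theta> = P" "dropWhile (\<lambda>i. i \<noteq> l) \<theta> = l # T"
      using split[of \<theta>] by blast
    then show "(case (takeWhile (\<lambda>i. i \<noteq> l) \<theta> @ [l], dropWhile (\<lambda>i. i \<noteq> l) \<theta>) of (\<theta>', \<theta>'') \<Rightarrow> \<theta>' @ tl \<theta>'') = \<theta>"
      by simp
    show "(takeWhile (\<lambda>i. i \<noteq> l) \<theta> @ [l], dropWhile (\<lambda>i. i \<noteq> l) \<theta>)
        \<in> {\<theta> \<in> paths. last \<theta> = l} \<times> {\<theta> \<in> paths. hd \<theta> = l}"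
      using \<theta> append_in_paths_iff[of P l T] unfolding PT(2,3) by (simp add: PT(1))
  next
    fix z assume "z \<in> {\<theta> \<in> paths. last \<theta> = l} \<times> {\<theta> \<in> paths. hd \<theta> = l}"
    then obtain P T where z: "z = (P @ [l], l # T)" "P @ [l] \<in> paths" "l # T \<in> paths" "l \<notin> set P"
      using ends by force
    show "(case z of (\<theta>', \<theta>'') \<Rightarrow> \<theta>' @ tl \<theta>'') \<in> {\<theta> \<in> paths. l \<in> set \<theta>}"
      using z append_in_paths_iff[of P l T] by simp
    show "(takeWhile (\<lambda>i. i \<noteq> l) (case z of (\<theta>', \<theta>'') \<Rightarrow> \<theta>' @ tl \<theta>'') @ [l],
        dropWhile (\<lambda>i. i \<noteq> l) (case z of (\<theta>', \<theta>'') \<Rightarrow> \<theta>' @ tl \<theta>'')) = z"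
      using z by (auto simp: takeWhile_append dropWhile_append)
    show "g (takeWhile (\<lambda>i. i \<noteq> l) (case z of (\<theta>', \<theta>'') \<Rightarrow> \<theta>' @ tl \<theta>'') @ [l])
        (dropWhile (\<lambda>i. i \<noteq> l) (case z of (\<theta>', \<theta>'') \<Rightarrow> \<theta>' @ tl \<theta>'')) = (case z of (\<theta>', \<theta>'') \<Rightarrow> g \<theta>' \<theta>'')"
      using z by (auto simp: takeWhile_append dropWhile_append)
  qed
  finally show ?thesis .
qed

text \<open>Visits to \<open>s\<close> act as a new forcing that starts at block \<open>l\<close>; gluing the path before the visit
  and the path after it counts block \<open>l\<close> twice, which raises the order by one.\<close>
lemma occupation_growth:
  assumes bound: "\<And>\<theta>. \<theta> \<in> paths \<Longrightarrow> path_ord \<theta> \<le> h"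
    and l: "l \<in> {1..k}" "s \<in> B l" "ord l = 1" "tot l = 1"
  shows "pole_growth (Suc h)
    (u l s * v l s * (\<Sum>\<theta>\<in>{\<theta> \<in> paths. l \<in> set \<theta> \<and> path_ord \<theta> = h}.
       path_const \<theta> (\<lambda>_. 1) * (\<Sum>a\<in>B (hd \<theta>). w a * v (hd \<theta>) a)))
    (\<lambda>n. \<Sum>a\<in>(\<Union>j\<in>{1..k}. B j). w a * forced A (\<Union>j\<in>{1..k}. B j)
       (\<lambda>m b. of_bool (b = s) * forced A (\<Union>j\<in>{1..k}. B j) impulse m s) n a)"
proof -
  let ?U = "\<Union>j\<in>{1..k}. B j"
  \<comment> \<open>The source created by a visit to \<open>s\<close>, split by the path \<theta>
    followed after the visit; the path before the visit is the outer one in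
    \<open>X\<close>.\<close>
  define y where "y \<theta> m b = of_bool (b = s) * path_seq \<theta> impulse m s" for \<theta> m b
  define X where "X \<theta>' \<theta>'' n = (\<Sum>a\<in>B (hd \<theta>'). w a * path_seq \<theta>' (y \<theta>'') n a)" for \<theta>' \<theta>'' n
  have y_eq: "(\<lambda>m b. of_bool (b = s) * forced A ?U impulse m s)
      = (\<lambda>m b. \<Sum>\<theta>\<in>{\<theta> \<in> paths. hd \<theta> = l}. y \<theta> m b)"
    unfolding forced_eq_sum_paths[OF l(1,2)] y_def sum_distrib_left ..
  have expand: "(\<Sum>a\<in>?U. w a * forced A ?U (\<lambda>m b. of_bool (b = s) * forced A ?U impulse m s) n a)
      = (\<Sum>\<theta>\<in>{\<theta> \<in> paths. l \<in> set \<theta>}. X (takeWhile (\<lambda>i. i \<noteq> l) \<theta> @ [l]) (dropWhile (\<lambda>i. i \<noteq> l) \<theta>) n)" for n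
  proof -
    have "(\<Sum>a\<in>?U. w a * forced A ?U (\<lambda>m b. of_bool (b = s) * forced A ?U impulse m s) n a)
        = (\<Sum>\<theta>'\<in>paths. \<Sum>\<theta>''\<in>{\<theta> \<in> paths. hd \<theta> = l}. X \<theta>' \<theta>'' n)"
      unfolding y_eq sum_forced_eq_sum_paths path_seq_sum X_def sum_distrib_left
      by (intro sum.cong refl sum.swap)
    \<comment> \<open>The source lives on the single state \<open>s\<close>, so an outer path ending
      in a block other than \<open>l\<close> carries nothing.\<close>
    also have "\<dots> = (\<Sum>\<theta>'\<in>{\<theta> \<in> paths. last \<theta> = l}. \<Sum>\<theta>''\<in>{\<theta> \<in> paths. hd \<theta> = l}. X \<theta>' \<theta>'' n)"
    proof (rule sum.mono_neutral_right[OF finite_paths])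
      show "\<forall>\<theta>'\<in>paths - {\<theta> \<in> paths. last \<theta> = l}. (\<Sum>\<theta>''\<in>{\<theta> \<in> paths. hd \<theta> = l}. X \<theta>' \<theta>'' n) = 0"
      proof
        fix \<theta>' assume \<theta>': "\<theta>' \<in> paths - {\<theta> \<in> paths. last \<theta> = l}"
        then have "last \<theta>' \<in> {1..k}" "last \<theta>' \<noteq> l" by (auto simp: paths_def subset_iff)
        then have "s \<notin> B (last \<theta>')" using disjoint_blocks[of "last \<theta>'" l] l by blast
        then have "y \<theta>'' m b = 0" if "b \<in> B (last \<theta>')" for \<theta>'' m b using that by (auto simp: y_def)
        then have "path_seq \<theta>' (y \<theta>'') n a = 0" if "a \<in> B (hd \<theta>')" for \<theta>'' a
          using that by (intro path_seq_eq_0_if_no_forcing) auto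
        then show "(\<Sum>\<theta>''\<in>{\<theta> \<in> paths. hd \<theta> = l}. X \<theta>' \<theta>'' n) = 0" by (simp add: X_def)
      qed
    qed auto
    finally show ?thesis unfolding sum_path_pairs .
  qed
  have X_growth: "pole_growth (Suc h)
      (if path_ord \<theta> = h then u l s * v l s * (path_const \<theta> (\<lambda>_. 1) * (\<Sum>a\<in>B (hd \<theta>). w a * v (hd \<theta>) a)) else 0)
      (X (takeWhile (\<lambda>i. i \<noteq> l) \<theta> @ [l]) (dropWhile (\<lambda>i. i \<noteq> l) \<theta>))"
    if \<theta>: "\<theta> \<in> {\<theta> \<in> paths. l \<in> set \<theta>}" for \<theta>
  proof -
    obtain P T where "\<theta> = P @ l # T" "l \<notin> set P" using split_list_first[of l \<theta>] \<theta> by blast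
    then have PT: "\<theta> = P @ l # T" "takeWhile (\<lambda>i. i \<noteq> l) \<theta> = P" "dropWhile (\<lambda>i. i \<noteq> l) \<theta> = l # T"
      by (auto simp: takeWhile_append dropWhile_append)
    have paths: "P @ [l] \<in> paths" "l # T \<in> paths" using \<theta> append_in_paths_iff[of P l T] PT(1) by auto
    have hd: "hd (P @ [l]) = hd \<theta>" unfolding PT(1) by (cases P) auto
    let ?t = "v l s * path_const (l # T) (\<lambda>_. 1)"
    have "pole_growth (0 + path_ord (l # T)) ?t (\<lambda>n. path_seq (l # T) impulse n s)"
      using path_seq_growth[of "l # T" s 0 "\<lambda>_. 1" impulse] paths(2) l(2) pole_growth_impulse
      by (simp add: paths_def)
    then have yg: "pole_growth (path_ord (l # T)) (of_bool (b = s) * ?t) (\<lambda>n. y (l # T) n b)" for b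
      unfolding y_def by (intro pole_growth_cmult) simp
    have "pole_growth (path_ord (l # T) + path_ord (P @ [l]))
        (\<Sum>a\<in>B (hd (P @ [l])). w a * (v (hd (P @ [l])) a * path_const (P @ [l]) (\<lambda>b. of_bool (b = s) * ?t)))
        (\<lambda>n. X (P @ [l]) (l # T) n)"
      unfolding X_def using paths(1)
      by (intro pole_growth_sum pole_growth_cmult path_seq_growth yg) (auto simp: paths_def)
    also have "path_ord (l # T) + path_ord (P @ [l]) = Suc (path_ord \<theta>)"
      using l(3) by (simp add: path_ord_def PT(1))
    also have "(\<Sum>a\<in>B (hd (P @ [l])). w a * (v (hd (P @ [l])) a * path_const (P @ [l]) (\<lambda>b. of_bool (b = s) * ?t)))
       = u l s * v l s * (path_const \<theta> (\<lambda>_. 1) * (\<Sum>a\<in>B (hd \<theta>). w a * v (hd \<theta>) a))"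
      unfolding path_const_split[OF l(1,2,4)] hd PT(1)[symmetric]
      by (simp add: sum_distrib_left algebra_simps)
    finally show ?thesis
      unfolding PT(2,3) using bound[of \<theta>] \<theta> pole_growth_higher_order by fastforce
  qed
  have "pole_growth (Suc h)
    (\<Sum>\<theta>\<in>{\<theta> \<in> paths. l \<in> set \<theta>}.
      if path_ord \<theta> = h then u l s * v l s * (path_const \<theta> (\<lambda>_. 1) * (\<Sum>a\<in>B (hd \<theta>). w a * v (hd \<theta>) a)) else 0)
    (\<lambda>n. \<Sum>\<theta>\<in>{\<theta> \<in> paths. l \<in> set \<theta>}. X (takeWhile (\<lambda>i. i \<noteq> l) \<theta> @ [l]) (dropWhile (\<lambda>i. i \<noteq> l) \<theta>) n)"
    by (rule pole_growth_sum) (rule X_growth)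
  then show ?thesis
    unfolding expand using finite_paths
    by (simp add: sum.inter_filter[symmetric] sum_distrib_left conj_assoc)
qed

end

section \<open>Generalised eigenspaces\<close>

definition shift_mat :: "'a::field mat \<Rightarrow> 'a \<Rightarrow> 'a mat" where
  "shift_mat A \<mu> = A - \<mu> \<cdot>\<^sub>m 1\<^sub>m (dim_row A)"

lemma shift_mat_carrier: "A \<in> carrier_mat n n \<Longrightarrow> shift_mat A \<mu> \<in> carrier_mat n n"
  by (simp add: shift_mat_def minus_carrier_mat)

lemma mult_mat_zero_vec:
  fixes B :: "'a::field mat"
  shows "B \<in> carrier_mat n n \<Longrightarrow> B *\<^sub>v 0\<^sub>v n = 0\<^sub>v n"
  by (intro eq_vecI) auto

lemma shift_mat_mult_vec:
  assumes "A \<in> carrier_mat n n" "x \<in> carrier_vec n"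
  shows "shift_mat A \<mu> *\<^sub>v x = A *\<^sub>v x - \<mu> \<cdot>\<^sub>v x"
proof -
  have "(\<mu> \<cdot>\<^sub>m 1\<^sub>m n) *\<^sub>v x = \<mu> \<cdot>\<^sub>v x"
    using assms(2) by (intro eq_vecI) (auto simp: row_smult)
  then show ?thesis
    using assms by (simp add: shift_mat_def minus_mult_distrib_mat_vec[where nr = n and nc = n])
qed

lemma pow_mat_Suc_mult_vec:
  fixes B :: "'a::field mat"
  assumes "B \<in> carrier_mat n n" "x \<in> carrier_vec n"
  shows "(B ^\<^sub>m Suc m) *\<^sub>v x = (B ^\<^sub>m m) *\<^sub>v (B *\<^sub>v x)"
    and "(B ^\<^sub>m Suc m) *\<^sub>v x = B *\<^sub>v ((B ^\<^sub>m m) *\<^sub>v x)"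
proof -
  have 1: "(B ^\<^sub>m Suc m) *\<^sub>v x = (B ^\<^sub>m m) *\<^sub>v (B *\<^sub>v x)"
    if "x \<in> carrier_vec n" for m x
    using assoc_mult_mat_vec[OF pow_carrier_mat[OF assms(1)] assms(1) that] by simp
  from 1[OF assms(2)] show "(B ^\<^sub>m Suc m) *\<^sub>v x = (B ^\<^sub>m m) *\<^sub>v (B *\<^sub>v x)" .
  from assms(2) show "(B ^\<^sub>m Suc m) *\<^sub>v x = B *\<^sub>v ((B ^\<^sub>m m) *\<^sub>v x)"
  proof (induction m arbitrary: x)
    case (Suc m)
    have Bx: "B *\<^sub>v x \<in> carrier_vec n" using assms(1) Suc.prems by simp
    show ?case
      unfolding 1[OF Suc.prems, of "Suc m"] Suc.IH[OF Bx] 1[OF Suc.prems, of m] ..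
  qed (use assms(1) in simp)
qed

context
  fixes A :: "complex mat" and n :: nat
  assumes A: "A \<in> carrier_mat n n"
begin

lemma gen_eigenspace_iff:
  "x \<in> gen_eigenspace A \<mu> \<longleftrightarrow> x \<in> carrier_vec n \<and> (\<exists>m. (shift_mat A \<mu> ^\<^sub>m m) *\<^sub>v x = 0\<^sub>v n)"
  using A by (simp add: gen_eigenspace_def shift_mat_def)

lemma pow_shift_mat_carrier: "shift_mat A \<mu> ^\<^sub>m m \<in> carrier_mat n n"
  using shift_mat_carrier[OF A] by simp

lemma zero_in_gen_eigenspace: "0\<^sub>v n \<in> gen_eigenspace A \<mu>"
  unfolding gen_eigenspace_iff using mult_mat_zero_vec[OF pow_shift_mat_carrier] by auto

lemma gen_eigenspace_if_shift:
  assumes "x \<in> carrier_vec n" "shift_mat A \<mu> *\<^sub>v x \<in> gen_eigenspace A \<mu>"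
  shows "x \<in> gen_eigenspace A \<mu>"
proof -
  obtain m where "(shift_mat A \<mu> ^\<^sub>m m) *\<^sub>v (shift_mat A \<mu> *\<^sub>v x) = 0\<^sub>v n"
    using assms(2) unfolding gen_eigenspace_iff by blast
  then have "(shift_mat A \<mu> ^\<^sub>m Suc m) *\<^sub>v x = 0\<^sub>v n"
    using pow_mat_Suc_mult_vec(1)[OF shift_mat_carrier[OF A] assms(1)] by simp
  then show ?thesis using assms(1) unfolding gen_eigenspace_iff by blast
qed

text \<open>Induction on the exponent through
  \<open>(A - a) f = (A - \<mu>) f + (\<mu> - a) f\<close>: the first summand is killed by one power
  less, so it has a preimage \<open>g'\<close>, and \<open>(f - g') / (\<mu> - a)\<close> is mapped
  to \<open>f\<close>.\<close>

lemma shift_mat_surj_aux: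
  assumes "a \<noteq> \<mu>" "f \<in> carrier_vec n" "(shift_mat A \<mu> ^\<^sub>m m) *\<^sub>v f = 0\<^sub>v n"
  shows "\<exists>g\<in>carrier_vec n. (shift_mat A \<mu> ^\<^sub>m m) *\<^sub>v g = 0\<^sub>v n \<and> shift_mat A a *\<^sub>v g = f"
  using assms(2,3)
proof (induction m arbitrary: f)
  case 0
  then have "f = 0\<^sub>v n" using carrier_matD(1)[OF shift_mat_carrier[OF A, of \<mu>]] by simp
  then show ?case
    using mult_mat_zero_vec[OF shift_mat_carrier[OF A]] mult_mat_zero_vec[OF pow_shift_mat_carrier]
    by (intro bexI[of _ "0\<^sub>v n"]) (simp_all del: pow_mat.simps)
next
  case (Suc m)
  note B = shift_mat_carrier[OF A, of \<mu>] and P = pow_shift_mat_carrier[of \<mu>]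
  define f' where "f' = shift_mat A \<mu> *\<^sub>v f"
  have f': "f' \<in> carrier_vec n" using B Suc.prems by (simp add: f'_def)
  have "(shift_mat A \<mu> ^\<^sub>m m) *\<^sub>v f' = 0\<^sub>v n"
    using Suc.prems unfolding f'_def pow_mat_Suc_mult_vec(1)[OF B Suc.prems(1)] by simp
  then obtain g' where g': "g' \<in> carrier_vec n" "(shift_mat A \<mu> ^\<^sub>m m) *\<^sub>v g' = 0\<^sub>v n"
      "shift_mat A a *\<^sub>v g' = f'"
    using Suc.IH[OF f'] by blast
  define g where "g = (1 / (\<mu> - a)) \<cdot>\<^sub>v (f - g')"
  have g: "g \<in> carrier_vec n" using Suc.prems g' by (simp add: g_def)
  have "(shift_mat A \<mu> ^\<^sub>m Suc m) *\<^sub>v g' = 0\<^sub>v n"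
    unfolding pow_mat_Suc_mult_vec(2)[OF B g'(1)] g'(2) by (rule mult_mat_zero_vec[OF B])
  moreover have "(shift_mat A \<mu> ^\<^sub>m Suc m) *\<^sub>v g
      = (1 / (\<mu> - a)) \<cdot>\<^sub>v ((shift_mat A \<mu> ^\<^sub>m Suc m) *\<^sub>v f - (shift_mat A \<mu> ^\<^sub>m Suc m) *\<^sub>v g')"
    unfolding g_def using P[of "Suc m"] Suc.prems g'(1)
    by (simp add: mult_mat_vec[where nr = n and nc = n] mult_minus_distrib_mat_vec[where nr = n and nc = n]
        del: pow_mat.simps)
  ultimately have "(shift_mat A \<mu> ^\<^sub>m Suc m) *\<^sub>v g = 0\<^sub>v n"
    using Suc.prems(2) by (simp del: pow_mat.simps) (intro eq_vecI, auto)
  moreover have "shift_mat A a *\<^sub>v g = f"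
  proof -
    have "shift_mat A a *\<^sub>v g = (1 / (\<mu> - a)) \<cdot>\<^sub>v (shift_mat A a *\<^sub>v f - f')"
      unfolding g_def g'(3)[symmetric] using shift_mat_carrier[OF A, of a] Suc.prems g'(1)
      by (simp add: mult_mat_vec[where nr = n and nc = n] mult_minus_distrib_mat_vec[where nr = n and nc = n])
    also have "shift_mat A a *\<^sub>v f - f' = (\<mu> - a) \<cdot>\<^sub>v f"
      unfolding f'_def shift_mat_mult_vec[OF A Suc.prems(1)] using A Suc.prems(1)
      by (intro eq_vecI) (auto simp: algebra_simps)
    also have "(1 / (\<mu> - a)) \<cdot>\<^sub>v ((\<mu> - a) \<cdot>\<^sub>v f) = f"
      using \<open>a \<noteq> \<mu>\<close> by (simp add: smult_smult_assoc)
    finally show ?thesis .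
  qed
  ultimately show ?case using g by blast
qed

lemma shift_mat_surj_on_gen_eigenspace:
  assumes "a \<noteq> \<mu>" "f \<in> gen_eigenspace A \<mu>"
  shows "\<exists>g\<in>gen_eigenspace A \<mu>. shift_mat A a *\<^sub>v g = f"
proof -
  obtain m where "f \<in> carrier_vec n" "(shift_mat A \<mu> ^\<^sub>m m) *\<^sub>v f = 0\<^sub>v n"
    using assms(2) unfolding gen_eigenspace_iff by blast
  then obtain g where "g \<in> carrier_vec n" "(shift_mat A \<mu> ^\<^sub>m m) *\<^sub>v g = 0\<^sub>v n" "shift_mat A a *\<^sub>v g = f"
    using shift_mat_surj_aux[OF assms(1)] by blast
  then show ?thesis by (intro bexI[of _ g]) (auto simp: gen_eigenspace_iff)
qed

text \<open>\<open>S\<close> is any finite set of complex numbers rather than the spectrum, so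
  values can be added freely; the spaces of non-eigenvalues are trivial and drop out later.\<close>

definition gen_eigen_sum :: "complex vec \<Rightarrow> bool" where
  "gen_eigen_sum x \<longleftrightarrow> (\<exists>S f. finite S \<and> (\<forall>\<mu>. f \<mu> \<in> gen_eigenspace A \<mu>) \<and>
     (\<forall>j<n. x $ j = (\<Sum>\<mu>\<in>S. f \<mu> $ j)))"

lemma mult_vec_sum:
  fixes B :: "complex mat"
  assumes "B \<in> carrier_mat n n" "\<And>\<mu>. \<mu> \<in> S \<Longrightarrow> g \<mu> \<in> carrier_vec n" "i < n"
  shows "(B *\<^sub>v vec n (\<lambda>j. \<Sum>\<mu>\<in>S. g \<mu> $ j)) $ i = (\<Sum>\<mu>\<in>S. (B *\<^sub>v g \<mu>) $ i)"
proof -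
  have "(B *\<^sub>v vec n (\<lambda>j. \<Sum>\<mu>\<in>S. g \<mu> $ j)) $ i = (\<Sum>j<n. \<Sum>\<mu>\<in>S. B $$ (i, j) * g \<mu> $ j)"
    using assms(1,3) by (simp add: scalar_prod_def sum_distrib_left lessThan_atLeast0)
  also have "\<dots> = (\<Sum>\<mu>\<in>S. \<Sum>j<n. B $$ (i, j) * g \<mu> $ j)" by (rule sum.swap)
  also have "\<dots> = (\<Sum>\<mu>\<in>S. (B *\<^sub>v g \<mu>) $ i)"
  proof (rule sum.cong)
    fix \<mu> assume "\<mu> \<in> S"
    then show "(\<Sum>j<n. B $$ (i, j) * g \<mu> $ j) = (B *\<^sub>v g \<mu>) $ i"
      using assms(1,3) carrier_vecD[OF assms(2)[of \<mu>]] by (simp add: scalar_prod_def lessThan_atLeast0)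
  qed simp
  finally show ?thesis .
qed

text \<open>The components of \<open>(A - a) x\<close> outside \<open>a\<close> are solved within
  their own spaces, where \<open>A - a\<close> is onto. The rest of \<open>x\<close> is mapped by
  \<open>A - a\<close> into the space of \<open>a\<close>, so it lies in that space itself.\<close>

lemma gen_eigen_sum_if_shift:
  assumes x: "x \<in> carrier_vec n" and "gen_eigen_sum (shift_mat A a *\<^sub>v x)"
  shows "gen_eigen_sum x"
proof -
  from assms(2) obtain S f where S: "finite S" and f: "\<And>\<mu>. f \<mu> \<in> gen_eigenspace A \<mu>"
    and sum: "\<And>j. j < n \<Longrightarrow> (shift_mat A a *\<^sub>v x) $ j = (\<Sum>\<mu>\<in>S. f \<mu> $ j)"
    unfolding gen_eigen_sum_def by auto
  have "\<forall>\<mu>. \<exists>g. \<mu> \<noteq> a \<longrightarrow> g \<in> gen_eigenspace A \<mu> \<and> shift_mat A a *\<^sub>v g = f \<mu>"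
  proof
    fix \<mu>
    show "\<exists>g. \<mu> \<noteq> a \<longrightarrow> g \<in> gen_eigenspace A \<mu> \<and> shift_mat A a *\<^sub>v g = f \<mu>"
      using shift_mat_surj_on_gen_eigenspace[of a \<mu> "f \<mu>"] f by (cases "a = \<mu>") auto
  qed
  then have "\<exists>g. \<forall>\<mu>. \<mu> \<noteq> a \<longrightarrow> g \<mu> \<in> gen_eigenspace A \<mu> \<and> shift_mat A a *\<^sub>v g \<mu> = f \<mu>"
    by (rule choice)
  then obtain g where g: "\<And>\<mu>. \<mu> \<noteq> a \<Longrightarrow> g \<mu> \<in> gen_eigenspace A \<mu>"
    "\<And>\<mu>. \<mu> \<noteq> a \<Longrightarrow> shift_mat A a *\<^sub>v g \<mu> = f \<mu>" by blast
  have gc: "\<mu> \<in> S - {a} \<Longrightarrow> g \<mu> \<in> carrier_vec n" for \<mu> using g(1) gen_eigenspace_iff by blast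
  define s where "s = vec n (\<lambda>j. \<Sum>\<mu>\<in>S - {a}. g \<mu> $ j)"
  define x' where "x' = x - s"
  have s: "s \<in> carrier_vec n" and x': "x' \<in> carrier_vec n" using x by (simp_all add: s_def x'_def)
  note B = shift_mat_carrier[OF A, of a]
  have "shift_mat A a *\<^sub>v x' = (if a \<in> S then f a else 0\<^sub>v n)"
  proof (rule eq_vecI)
    have fa: "f a \<in> carrier_vec n" using f gen_eigenspace_iff by blast
    then show "dim_vec (shift_mat A a *\<^sub>v x') = dim_vec (if a \<in> S then f a else 0\<^sub>v n)"
      using B by simp
    fix i assume "i < dim_vec (if a \<in> S then f a else 0\<^sub>v n)"
    then have i: "i < n" using fa by (simp split: if_splits)
    have "(shift_mat A a *\<^sub>v x') $ i = (shift_mat A a *\<^sub>v x) $ i - (shift_mat A a *\<^sub>v s) $ i"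
      using B i x s by (simp add: x'_def mult_minus_distrib_mat_vec[where nr = n and nc = n]
        del: index_mult_mat_vec)
    also have "(shift_mat A a *\<^sub>v s) $ i = (\<Sum>\<mu>\<in>S - {a}. f \<mu> $ i)"
      unfolding s_def using mult_vec_sum[OF B, of "S - {a}" g i] gc i g(2) by simp
    also have "(shift_mat A a *\<^sub>v x) $ i - \<dots> = (if a \<in> S then f a else 0\<^sub>v n) $ i"
      using sum[OF i] S i by (simp add: sum.remove[of S a])
    finally show "(shift_mat A a *\<^sub>v x') $ i = (if a \<in> S then f a else 0\<^sub>v n) $ i" .
  qed
  then have "x' \<in> gen_eigenspace A a"
    using gen_eigenspace_if_shift[OF x'] f zero_in_gen_eigenspace by (simp split: if_splits)
  moreover have "x $ j = (\<Sum>\<mu>\<in>insert a S. (g(a := x')) \<mu> $ j)" if "j < n" for j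
  proof -
    have "(\<Sum>\<mu>\<in>insert a S. (g(a := x')) \<mu> $ j) = x' $ j + (\<Sum>\<mu>\<in>S - {a}. (g(a := x')) \<mu> $ j)"
      using S by (simp add: sum.insert_remove)
    also have "(\<Sum>\<mu>\<in>S - {a}. (g(a := x')) \<mu> $ j) = (\<Sum>\<mu>\<in>S - {a}. g \<mu> $ j)"
      by (intro sum.cong) auto
    finally show ?thesis using that s x by (simp add: x'_def) (simp add: s_def)
  qed
  ultimately show ?thesis
    unfolding gen_eigen_sum_def using S g(1)
    by (intro exI[of _ "insert a S"] exI[of _ "g(a := x')"]) auto
qed

text \<open>In triangular coordinates, subtracting the last relevant diagonal entry shortens the support.\<close>
lemma gen_eigen_sum_all:
  assumes "x \<in> carrier_vec n"
  shows "gen_eigen_sum x"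
proof -
  obtain as where "char_poly A = (\<Prod>a\<leftarrow>as. [:- a, 1:])"
    using char_poly_factorized[OF A] by blast
  then obtain T where T: "T \<in> carrier_mat n n" "upper_triangular T" "similar_mat A T"
    using schur_decomposition_exists[OF A] by blast
  then obtain P P' where "similar_mat_wit A T P P'" by (auto simp: similar_mat_def)
  note w = similar_mat_witD2[OF A this]
  have AP: "A * P = P * T"
  proof -
    have "A * P = P * T * P' * P" using w(3) by simp
    also have "\<dots> = P * T * (P' * P)"
      using w by (intro assoc_mult_mat[where n\<^sub>2 = n and n\<^sub>3 = n]) auto
    also have "\<dots> = P * T" using w by simp
    finally show ?thesis .
  qed
  have main: "gen_eigen_sum (P *\<^sub>v y)"
    if "m \<le> n" "y \<in> carrier_vec n" "\<And>j. m \<le> j \<Longrightarrow> j < n \<Longrightarrow> y $ j = 0" for m y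
    using that
  proof (induction m arbitrary: y)
    case 0
    then have "y = 0\<^sub>v n" by (intro eq_vecI) auto
    then have "P *\<^sub>v y = 0\<^sub>v n" using mult_mat_zero_vec[OF w(6)] by simp
    then show ?case unfolding gen_eigen_sum_def
      by (auto intro!: exI[of _ "{}"] exI[of _ "\<lambda>_. 0\<^sub>v n"] zero_in_gen_eigenspace)
  next
    case (Suc m)
    define a where "a = T $$ (m, m)"
    define y' where "y' = T *\<^sub>v y - a \<cdot>\<^sub>v y"
    have y': "y' \<in> carrier_vec n" using T Suc.prems by (simp add: y'_def)
    have "y' $ i = 0" if i: "m \<le> i" "i < n" for i
    proof -
      have "(T *\<^sub>v y) $ i = (\<Sum>j<n. T $$ (i, j) * y $ j)"
        using T i Suc.prems by (simp add: scalar_prod_def lessThan_atLeast0)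
      also have "\<dots> = (\<Sum>j<n. if j = m then T $$ (i, m) * y $ m else 0)"
      proof (intro sum.cong refl)
        fix j assume "j \<in> {..<n}"
        then show "T $$ (i, j) * y $ j = (if j = m then T $$ (i, m) * y $ m else 0)"
          using T i Suc.prems(3)[of j] by (cases j m rule: linorder_cases) (auto simp: upper_triangular_def)
      qed
      also have "\<dots> = T $$ (i, m) * y $ m" using Suc.prems by simp
      also have "\<dots> = a * y $ i"
      proof (cases "i = m")
        case False
        then show ?thesis using T i Suc.prems by (simp add: upper_triangular_def)
      qed (simp add: a_def)
      finally show ?thesis using i T Suc.prems by (simp add: y'_def)
    qed
    then have "gen_eigen_sum (P *\<^sub>v y')" using Suc.IH[of y'] Suc.prems y' by simp
    also have "P *\<^sub>v y' = shift_mat A a *\<^sub>v (P *\<^sub>v y)"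
    proof -
      have "P *\<^sub>v y' = P *\<^sub>v (T *\<^sub>v y) - a \<cdot>\<^sub>v (P *\<^sub>v y)"
        unfolding y'_def using w T Suc.prems
        by (simp add: mult_mat_vec[where nr = n and nc = n] mult_minus_distrib_mat_vec[where nr = n and nc = n])
      also have "P *\<^sub>v (T *\<^sub>v y) = A *\<^sub>v (P *\<^sub>v y)"
        using assoc_mult_mat_vec[OF w(6) T(1) Suc.prems(2)] assoc_mult_mat_vec[OF A w(6) Suc.prems(2)] AP
        by simp
      finally show ?thesis using w Suc.prems by (subst shift_mat_mult_vec[OF A]) auto
    qed
    finally have shifted: "gen_eigen_sum (shift_mat A a *\<^sub>v (P *\<^sub>v y))" .
    show ?case by (rule gen_eigen_sum_if_shift[OF mult_mat_vec_carrier[OF w(6) Suc.prems(2)] shifted])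
  qed
  have "gen_eigen_sum (P *\<^sub>v (P' *\<^sub>v x))"
    using w assms by (intro main[of n]) auto
  also have "P *\<^sub>v (P' *\<^sub>v x) = x"
    using assoc_mult_mat_vec[OF w(6,7) assms] w(1) assms by simp
  finally show ?thesis .
qed

text \<open>The last nonzero vector in the chain \<open>f\<close>, \<open>(A - \<mu>) f\<close>, ...
  is a genuine eigenvector; this carries facts about eigenvectors over to generalised ones.\<close>

lemma gen_eigenspace_top:
  assumes "f \<in> gen_eigenspace A \<mu>" "f \<noteq> 0\<^sub>v n"
  obtains j where "(shift_mat A \<mu> ^\<^sub>m j) *\<^sub>v f \<noteq> 0\<^sub>v n"
    and "A *\<^sub>v ((shift_mat A \<mu> ^\<^sub>m j) *\<^sub>v f) = \<mu> \<cdot>\<^sub>v ((shift_mat A \<mu> ^\<^sub>m j) *\<^sub>v f)"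
proof -
  note B = shift_mat_carrier[OF A, of \<mu>]
  have f: "f \<in> carrier_vec n" and ex: "\<exists>m. (shift_mat A \<mu> ^\<^sub>m m) *\<^sub>v f = 0\<^sub>v n"
    using assms(1) gen_eigenspace_iff by auto
  define m where "m = (LEAST m. (shift_mat A \<mu> ^\<^sub>m m) *\<^sub>v f = 0\<^sub>v n)"
  have m: "(shift_mat A \<mu> ^\<^sub>m m) *\<^sub>v f = 0\<^sub>v n"
    unfolding m_def using ex by (rule LeastI_ex)
  have "m \<noteq> 0" using m f assms(2) carrier_matD(1)[OF B] by (intro notI) simp
  then obtain j where j: "m = Suc j" using not0_implies_Suc by blast
  have nz: "(shift_mat A \<mu> ^\<^sub>m j) *\<^sub>v f \<noteq> 0\<^sub>v n"
    using not_less_Least[of j "\<lambda>m. (shift_mat A \<mu> ^\<^sub>m m) *\<^sub>v f = 0\<^sub>v n"] j m_def by simp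
  define g where "g = (shift_mat A \<mu> ^\<^sub>m j) *\<^sub>v f"
  have g: "g \<in> carrier_vec n" using pow_shift_mat_carrier f by (auto simp: g_def intro: mult_mat_vec_carrier)
  have "shift_mat A \<mu> *\<^sub>v g = 0\<^sub>v n"
    using m unfolding j g_def pow_mat_Suc_mult_vec(2)[OF B f] .
  then have z: "A *\<^sub>v g - \<mu> \<cdot>\<^sub>v g = 0\<^sub>v n" unfolding shift_mat_mult_vec[OF A g] .
  have "A *\<^sub>v g = \<mu> \<cdot>\<^sub>v g"
  proof (rule eq_vecI)
    fix i assume "i < dim_vec (\<mu> \<cdot>\<^sub>v g)"
    then have i: "i < n" using g by simp
    then have "(A *\<^sub>v g - \<mu> \<cdot>\<^sub>v g) $ i = 0" using z by simp
    then show "(A *\<^sub>v g) $ i = (\<mu> \<cdot>\<^sub>v g) $ i" using i A g by simp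
  qed (use A g in simp)
  with nz show ?thesis unfolding g_def by (rule that)
qed

lemma gen_eigenspace_trivial:
  assumes "f \<in> gen_eigenspace A \<mu>" "\<not> eigenvalue A \<mu>"
  shows "f = 0\<^sub>v n"
proof (rule ccontr)
  assume "f \<noteq> 0\<^sub>v n"
  from gen_eigenspace_top[OF assms(1) this] obtain j where
    "(shift_mat A \<mu> ^\<^sub>m j) *\<^sub>v f \<noteq> 0\<^sub>v n"
    "A *\<^sub>v ((shift_mat A \<mu> ^\<^sub>m j) *\<^sub>v f) = \<mu> \<cdot>\<^sub>v ((shift_mat A \<mu> ^\<^sub>m j) *\<^sub>v f)" .
  moreover have "(shift_mat A \<mu> ^\<^sub>m j) *\<^sub>v f \<in> carrier_vec n"
    using pow_shift_mat_carrier assms(1) by (auto simp: gen_eigenspace_iff intro: mult_mat_vec_carrier)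
  ultimately show False
    using assms(2) A unfolding eigenvalue_def eigenvector_def by auto
qed

end


section \<open>The coefficient along the Perron direction\<close>

lemma cmat_carrier: "M \<in> carrier_mat n n \<Longrightarrow> cmat M \<in> carrier_mat n n"
  by (simp add: cmat_def)

text \<open>Against a left eigenvector, \<open>A - \<mu>\<close> acts as the scalar
  \<open>\<rho> - \<mu>\<close>. If that scalar is nonzero, the pairing with every generalised
  eigenvector of \<mu> must vanish.\<close>

lemma left_eigenvector_shift_pow:
  fixes M :: "real mat" and u :: "nat \<Rightarrow> real"
  assumes M: "M \<in> carrier_mat n n"
    and left: "\<And>b. b < n \<Longrightarrow> (\<Sum>a<n. u a * M $$ (a, b)) = \<rho> * u b"
    and x: "x \<in> carrier_vec n"
  shows "(\<Sum>a<n. of_real (u a) * ((shift_mat (cmat M) \<mu> ^\<^sub>m m) *\<^sub>v x) $ a)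
    = (of_real \<rho> - \<mu>) ^ m * (\<Sum>a<n. of_real (u a) * x $ a)"
proof (induction m)
  case 0
  then show ?case using x carrier_matD(1)[OF shift_mat_carrier[OF cmat_carrier[OF M], of \<mu>]] by simp
next
  case (Suc m)
  note C = cmat_carrier[OF M]
  note B = shift_mat_carrier[OF C, of \<mu>]
  define y where "y = (shift_mat (cmat M) \<mu> ^\<^sub>m m) *\<^sub>v x"
  have y: "y \<in> carrier_vec n"
    unfolding y_def using pow_carrier_mat[OF B] x by (rule mult_mat_vec_carrier)
  have "(\<Sum>a<n. of_real (u a) * ((cmat M *\<^sub>v y) $ a)) = (\<Sum>a<n. \<Sum>b<n. of_real (u a) * (of_real (M $$ (a, b)) * y $ b))"
    using M y by (intro sum.cong refl)
      (simp add: cmat_def scalar_prod_def lessThan_atLeast0 sum_distrib_left)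
  also have "\<dots> = (\<Sum>b<n. of_real (\<Sum>a<n. u a * M $$ (a, b)) * y $ b)"
    by (subst sum.swap) (simp add: sum_distrib_right mult.assoc)
  also have "\<dots> = of_real \<rho> * (\<Sum>b<n. of_real (u b) * y $ b)"
    by (simp add: left sum_distrib_left mult.assoc)
  finally have 1: "(\<Sum>a<n. of_real (u a) * ((cmat M *\<^sub>v y) $ a)) = of_real \<rho> * (\<Sum>b<n. of_real (u b) * y $ b)" .
  have "(\<Sum>a<n. of_real (u a) * ((shift_mat (cmat M) \<mu> ^\<^sub>m Suc m) *\<^sub>v x) $ a)
      = (\<Sum>a<n. of_real (u a) * ((cmat M *\<^sub>v y) $ a) - \<mu> * (of_real (u a) * y $ a))"
    unfolding pow_mat_Suc_mult_vec(2)[OF B x] y_def[symmetric] shift_mat_mult_vec[OF C y]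
    using C y by (intro sum.cong refl) (simp add: algebra_simps del: index_mult_mat_vec)
  also have "\<dots> = (of_real \<rho> - \<mu>) * (\<Sum>a<n. of_real (u a) * y $ a)"
    unfolding sum_subtractf 1 by (simp add: left_diff_distrib flip: sum_distrib_left)
  finally show ?case unfolding y_def Suc.IH by (simp add: mult.assoc)
qed

text \<open>The pairing with \<open>u\<close> vanishes on the other generalised eigenspaces and is 1
  at \<open>v\<close>, so it gives the only possible coefficient. Conversely, \<open>x\<close> minus
  that multiple of \<open>v\<close> pairs to zero, which leaves it no component at \<rho>. The
  premise \<open>simple\<close> states simplicity in the form used: an eigenvector for \<rho> that
  pairs to zero with \<open>u\<close> is zero.\<close>

lemma coefficient_of_eigenvector:
  fixes M :: "real mat" and u :: "nat \<Rightarrow> real" and x v :: "real vec" and \<rho> :: real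
  assumes M: "M \<in> carrier_mat n n" and v: "v \<in> carrier_vec n" and x: "x \<in> carrier_vec n"
    and left: "\<And>b. b < n \<Longrightarrow> (\<Sum>a<n. u a * M $$ (a, b)) = \<rho> * u b"
    and uv: "(\<Sum>a<n. u a * v $ a) = 1"
    and simple: "\<And>g :: nat \<Rightarrow> complex. (\<And>a. a < n \<Longrightarrow> (\<Sum>b<n. of_real (M $$ (a, b)) * g b) = of_real \<rho> * g a)
        \<Longrightarrow> (\<Sum>a<n. of_real (u a) * g a) = 0 \<Longrightarrow> (\<And>a. a < n \<Longrightarrow> g a = 0)"
  shows "(THE c::real. \<exists>w\<in>other_gen_eigenspaces (cmat M) (of_real \<rho>).
      cvec x = complex_of_real c \<cdot>\<^sub>v cvec v + w) = (\<Sum>a<n. u a * x $ a)"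
proof -
  note C = cmat_carrier[OF M]
  define \<phi> where "\<phi> y = (\<Sum>a<n. of_real (u a) * y $ a)" for y :: "complex vec"
  have \<phi>_shift: "\<phi> ((shift_mat (cmat M) \<mu> ^\<^sub>m m) *\<^sub>v y) = (of_real \<rho> - \<mu>) ^ m * \<phi> y"
    if "y \<in> carrier_vec n" for y \<mu> m
    unfolding \<phi>_def by (rule left_eigenvector_shift_pow[OF M _ that]) (rule left)
  have \<phi>_ge: "\<phi> y = 0" if y_in: "y \<in> gen_eigenspace (cmat M) \<mu>" "\<mu> \<noteq> of_real \<rho>" for y \<mu>
  proof -
    obtain m where y: "y \<in> carrier_vec n" and m: "(shift_mat (cmat M) \<mu> ^\<^sub>m m) *\<^sub>v y = 0\<^sub>v n"
      using y_in unfolding gen_eigenspace_iff[OF C] by blast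
    have "(of_real \<rho> - \<mu>) ^ m * \<phi> y = \<phi> (0\<^sub>v n)" using \<phi>_shift[OF y, of \<mu> m] m by simp
    also have "\<dots> = 0" by (simp add: \<phi>_def)
    finally show ?thesis using that(2) by simp
  qed
  have \<phi>_sum: "\<phi> y = (\<Sum>\<mu>\<in>S. \<phi> (f \<mu>))" if "\<And>j. j < n \<Longrightarrow> y $ j = (\<Sum>\<mu>\<in>S. f \<mu> $ j)" for y S f
  proof -
    have "\<phi> y = (\<Sum>a<n. \<Sum>\<mu>\<in>S. of_real (u a) * f \<mu> $ a)"
      unfolding \<phi>_def using that by (simp add: sum_distrib_left)
    also have "\<dots> = (\<Sum>\<mu>\<in>S. \<phi> (f \<mu>))" unfolding \<phi>_def by (rule sum.swap)
    finally show ?thesis .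
  qed
  have cv: "cvec v \<in> carrier_vec n" and cx: "cvec x \<in> carrier_vec n"
    using v x by (auto simp: cvec_def)
  have \<phi>v: "\<phi> (cvec v) = 1"
    using uv v by (simp add: \<phi>_def cvec_def flip: of_real_mult of_real_sum)
  have \<phi>x: "\<phi> (cvec x) = of_real (\<Sum>a<n. u a * x $ a)"
    using x by (simp add: \<phi>_def cvec_def)
  define c where "c = (\<Sum>a<n. u a * x $ a)"
  define w where "w = cvec x - complex_of_real c \<cdot>\<^sub>v cvec v"
  have w: "w \<in> carrier_vec n" using cv cx by (simp add: w_def)
  have "\<phi> w = \<phi> (cvec x) - of_real c * \<phi> (cvec v)"
    unfolding \<phi>_def w_def sum_distrib_left sum_subtractf[symmetric] using cv cx
    by (intro sum.cong refl) (simp add: algebra_simps)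
  then have \<phi>w: "\<phi> w = 0" unfolding \<phi>x \<phi>v c_def by simp
  obtain S f where S: "finite S" and f: "\<And>\<mu>. f \<mu> \<in> gen_eigenspace (cmat M) \<mu>"
    and wf: "\<And>j. j < n \<Longrightarrow> w $ j = (\<Sum>\<mu>\<in>S. f \<mu> $ j)"
    using gen_eigen_sum_all[OF C w] unfolding gen_eigen_sum_def[OF C] by auto
  \<comment> \<open>A nonzero component at \<rho> would be killed by \<phi>, and so would the
    eigenvector on top of its chain, contradicting \<open>simple\<close>.\<close>
  have f\<rho>: "f (of_real \<rho>) = 0\<^sub>v n" if "complex_of_real \<rho> \<in> S"
  proof (rule ccontr)
    assume nz: "f (of_real \<rho>) \<noteq> 0\<^sub>v n"
    have fc: "f (of_real \<rho>) \<in> carrier_vec n" using f gen_eigenspace_iff[OF C] by blast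
    have "0 = (\<Sum>\<mu>\<in>S. \<phi> (f \<mu>))" using \<phi>_sum[OF wf] \<phi>w by simp
    also have "\<dots> = \<phi> (f (of_real \<rho>)) + (\<Sum>\<mu>\<in>S - {of_real \<rho>}. \<phi> (f \<mu>))"
      using S that by (simp add: sum.remove)
    also have "(\<Sum>\<mu>\<in>S - {of_real \<rho>}. \<phi> (f \<mu>)) = 0"
      using \<phi>_ge f by (intro sum.neutral) auto
    finally have \<phi>f: "\<phi> (f (of_real \<rho>)) = 0" by simp
    from gen_eigenspace_top[OF C f nz] obtain j where
      j: "(shift_mat (cmat M) (of_real \<rho>) ^\<^sub>m j) *\<^sub>v f (of_real \<rho>) \<noteq> 0\<^sub>v n"
      "cmat M *\<^sub>v ((shift_mat (cmat M) (of_real \<rho>) ^\<^sub>m j) *\<^sub>v f (of_real \<rho>))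
        = of_real \<rho> \<cdot>\<^sub>v ((shift_mat (cmat M) (of_real \<rho>) ^\<^sub>m j) *\<^sub>v f (of_real \<rho>))" .
    define g where "g = (shift_mat (cmat M) (of_real \<rho>) ^\<^sub>m j) *\<^sub>v f (of_real \<rho>)"
    have g: "g \<in> carrier_vec n"
      unfolding g_def using pow_shift_mat_carrier[OF C] fc by (rule mult_mat_vec_carrier)
    have "\<phi> g = 0" unfolding g_def \<phi>_shift[OF fc] \<phi>f by simp
    moreover have "(\<Sum>b<n. of_real (M $$ (a, b)) * g $ b) = of_real \<rho> * g $ a" if "a < n" for a
    proof -
      have "(cmat M *\<^sub>v g) $ a = (of_real \<rho> \<cdot>\<^sub>v g) $ a" using j(2) by (simp add: g_def)
      then show ?thesis
        using that g M by (simp add: cmat_def scalar_prod_def lessThan_atLeast0)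
    qed
    ultimately have "g $ a = 0" if "a < n" for a
      using simple[of "\<lambda>a. g $ a"] that unfolding \<phi>_def by blast
    then have "g = 0\<^sub>v n" using g by (intro eq_vecI) auto
    then show False using j(1) by (simp add: g_def)
  qed
  \<comment> \<open>Zero outside \<open>S\<close>, since \<open>other_gen_eigenspaces\<close> sums
    over all eigenvalues other than \<rho>.\<close>
  define f' where "f' \<mu> = (if \<mu> \<in> S then f \<mu> else 0\<^sub>v n)" for \<mu>
  have f': "f' \<mu> \<in> gen_eigenspace (cmat M) \<mu>" for \<mu>
    using f zero_in_gen_eigenspace[OF C] by (simp add: f'_def)
  let ?E = "{\<mu>. eigenvalue (cmat M) \<mu> \<and> \<mu> \<noteq> of_real \<rho>}"
  have finE: "finite ?E"
    using card_finite_spectrum(1)[OF C] by (rule rev_finite_subset) (auto simp: spectrum_def)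
  have "w $ j = (\<Sum>\<mu>\<in>?E. f' \<mu> $ j)" if "j < n" for j
  proof -
    have "(\<Sum>\<mu>\<in>?E. f' \<mu> $ j) = (\<Sum>\<mu>\<in>S \<inter> ?E. f \<mu> $ j)"
      using finE S that by (intro sum.mono_neutral_cong_right) (auto simp: f'_def)
    also have "\<dots> = (\<Sum>\<mu>\<in>S. f \<mu> $ j)"
    proof (rule sum.mono_neutral_left)
      show "\<forall>\<mu>\<in>S - S \<inter> ?E. f \<mu> $ j = 0"
        using f\<rho> gen_eigenspace_trivial[OF C f] that by force
    qed (use S in auto)
    finally show ?thesis using wf[OF that] by simp
  qed
  then have "w \<in> other_gen_eigenspaces (cmat M) (of_real \<rho>)"
    using w f' C unfolding other_gen_eigenspaces_def by auto
  moreover have "cvec x = complex_of_real c \<cdot>\<^sub>v cvec v + w"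
    using cv cx by (intro eq_vecI) (auto simp: w_def)
  moreover have "c' = c" if "w' \<in> other_gen_eigenspaces (cmat M) (of_real \<rho>)"
    "cvec x = complex_of_real c' \<cdot>\<^sub>v cvec v + w'" for c' w'
  proof -
    from that(1) obtain f where w': "w' \<in> carrier_vec n"
      and f: "\<And>\<mu>. f \<mu> \<in> gen_eigenspace (cmat M) \<mu>" "\<And>j. j < n \<Longrightarrow> w' $ j = (\<Sum>\<mu>\<in>?E. f \<mu> $ j)"
      using C unfolding other_gen_eigenspaces_def by auto
    have "\<phi> w' = (\<Sum>\<mu>\<in>?E. \<phi> (f \<mu>))" by (rule \<phi>_sum) (rule f(2))
    also have "\<dots> = 0" using \<phi>_ge f(1) by (intro sum.neutral) auto
    finally have "\<phi> w' = 0" .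
    have "\<phi> (cvec x) = of_real c' * \<phi> (cvec v) + \<phi> w'"
      unfolding that(2) \<phi>_def sum_distrib_left sum.distrib[symmetric] using cv w'
      by (intro sum.cong refl) (simp add: algebra_simps)
    then show ?thesis unfolding \<phi>x \<phi>v \<open>\<phi> w' = 0\<close> c_def by (simp del: of_real_sum of_real_mult)
  qed
  ultimately show ?thesis unfolding c_def[symmetric] by (intro the_equality) blast+
qed

section \<open>The Frobenius normal form\<close>

definition block :: "(nat \<Rightarrow> nat) \<Rightarrow> nat \<Rightarrow> nat set" where
  "block ds i = {off ds i..<off ds i + ds i}"

lemma off_Suc: "1 \<le> i \<Longrightarrow> off ds (Suc i) = off ds i + ds i"
  by (simp add: off_def)

lemma off_add_le: "1 \<le> i \<Longrightarrow> i < j \<Longrightarrow> off ds i + ds i \<le> off ds j"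
proof -
  assume "1 \<le> i" "i < j"
  moreover from this have "(\<Sum>i\<in>{1..<Suc i}. ds i) \<le> (\<Sum>i\<in>{1..<j}. ds i)" by (intro sum_mono2) auto
  ultimately show ?thesis using off_Suc[of i ds] by (simp add: off_def)
qed

lemma UN_block: "(\<Union>j\<in>{1..k}. block ds j) = {..<off ds (Suc k)}"
proof (induction k)
  case 0
  then show ?case by (simp add: off_def)
next
  case (Suc k)
  have "{1..Suc k} = insert (Suc k) {1..k}" by auto
  then have "(\<Union>j\<in>{1..Suc k}. block ds j) = block ds (Suc k) \<union> {..<off ds (Suc k)}"
    using Suc by simp
  also have "\<dots> = {..<off ds (Suc (Suc k))}"
    unfolding off_Suc[of "Suc k", simplified] block_def by auto
  finally show ?case .
qed

lemma block_disjoint: "1 \<le> i \<Longrightarrow> 1 \<le> j \<Longrightarrow> i \<noteq> j \<Longrightarrow> block ds i \<inter> block ds j = {}"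
proof (induction i j rule: linorder_wlog)
  case (le i j)
  then show ?case using off_add_le[of i j ds] by (auto simp: block_def)
next
  case (sym i j)
  then show ?case by auto
qed

lemma block_image: "block ds i = (+) (off ds i) ` {..<ds i}"
  by (simp add: block_def lessThan_atLeast0 add.commute)

lemma sum_block: "(\<Sum>b\<in>block ds i. g b) = (\<Sum>b<ds i. g (off ds i + b))"
  unfolding block_def
  by (rule sum.reindex_bij_witness[of _ "\<lambda>b. off ds i + b" "\<lambda>b. b - off ds i"]) auto

locale frobenius_form =
  fixes d k :: nat and Q :: "real mat" and ds :: "nat \<Rightarrow> nat" and v :: "nat \<Rightarrow> real vec"
  assumes Q_nonneg: "\<And>i j. i < d \<Longrightarrow> j < d \<Longrightarrow> Q $$ (i, j) \<ge> 0"
    and k_pos: "k \<ge> 1" and ds_pos: "\<And>i. i \<in> {1..k} \<Longrightarrow> ds i \<ge> 1" and ds_sum: "(\<Sum>i\<in>{1..k}. ds i) = d"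
    and lower: "\<And>i j. i \<in> {1..k} \<Longrightarrow> j \<in> {1..k} \<Longrightarrow> i < j \<Longrightarrow> blk Q ds i j = 0\<^sub>m (ds i) (ds j)"
    and evpos: "\<And>i. i \<in> {1..k} \<Longrightarrow> eventually_positive (blk Q ds i i)"
    and v_carrier: "\<And>i. i \<in> {1..k} \<Longrightarrow> v i \<in> carrier_vec (ds i)"
    and v_pos: "\<And>i a. i \<in> {1..k} \<Longrightarrow> a < ds i \<Longrightarrow> v i $ a > 0"
    and v_eig: "\<And>i. i \<in> {1..k} \<Longrightarrow> blk Q ds i i *\<^sub>v v i = PF_eig Q ds i \<cdot>\<^sub>v v i"
    and v_sum: "\<And>i. i \<in> {1..k} \<Longrightarrow> (\<Sum>a<ds i. v i $ a) = 1"
    and scalar: "\<And>i. i \<in> {1..k} \<Longrightarrow> PF_eig Q ds i < rho_max Q ds k \<Longrightarrow> ds i = 1"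
begin

abbreviation qf :: "nat \<Rightarrow> nat \<Rightarrow> real" where "qf a b \<equiv> Q $$ (a, b)"

abbreviation \<rho> :: "nat \<Rightarrow> real" where "\<rho> i \<equiv> PF_eig Q ds i"

abbreviation \<rho>m :: real where "\<rho>m \<equiv> rho_max Q ds k"

definition vf :: "nat \<Rightarrow> nat \<Rightarrow> real" where "vf i a = v i $ (a - off ds i)"

lemma UN_block_eq: "(\<Union>j\<in>{1..k}. block ds j) = {..<d}"
  unfolding UN_block using ds_sum by (simp add: off_def atLeastLessThanSuc_atLeastAtMost)

lemma block_less: "i \<in> {1..k} \<Longrightarrow> a \<in> block ds i \<Longrightarrow> a < d"
  using UN_block_eq by blast

lemma block_offset: "a \<in> block ds i \<Longrightarrow> \<exists>c<ds i. a = off ds i + c"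
  unfolding block_def by (auto simp: le_iff_add)

lemma finite_block: "finite (block ds i)"
  by (simp add: block_def)

lemma vf_pos: "i \<in> {1..k} \<Longrightarrow> a \<in> block ds i \<Longrightarrow> vf i a > 0"
  using v_pos block_offset by (fastforce simp: vf_def)

lemma vf_eig:
  assumes "i \<in> {1..k}" "a \<in> block ds i"
  shows "(\<Sum>b\<in>block ds i. qf a b * vf i b) = \<rho> i * vf i a"
proof -
  obtain c where c: "c < ds i" "a = off ds i + c" using block_offset[OF assms(2)] by blast
  have "(blk Q ds i i *\<^sub>v v i) $ c = (\<rho> i \<cdot>\<^sub>v v i) $ c" using v_eig[OF assms(1)] by simp
  then show ?thesis
    using c v_carrier[OF assms(1)]
    by (simp add: sum_block vf_def blk_def scalar_prod_def lessThan_atLeast0)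
qed

lemma blk_carrier: "blk Q ds i j \<in> carrier_mat (ds i) (ds j)"
  by (simp add: blk_def)

lemma blk_pow:
  assumes "a < ds i" "b < ds i"
  shows "(blk Q ds i i ^\<^sub>m n) $$ (a, b) = sub_power qf (block ds i) n (off ds i + a) (off ds i + b)"
  using assms(2)
proof (induction n arbitrary: b)
  case 0
  then show ?case using assms(1) by (simp add: blk_def)
next
  case (Suc n)
  have a: "off ds i + a \<in> block ds i" and b: "off ds i + b \<in> block ds i"
    using assms(1) Suc.prems by (auto simp: block_def)
  have 1: "sub_power qf (block ds i) 1 c (off ds i + b) = qf c (off ds i + b)" for c
    using b finite_block by (simp add: sum.remove[where x = "off ds i + b"])
  have P: "blk Q ds i i ^\<^sub>m n \<in> carrier_mat (ds i) (ds i)" using blk_carrier by simp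
  have "(blk Q ds i i ^\<^sub>m Suc n) $$ (a, b)
      = (\<Sum>c<ds i. (blk Q ds i i ^\<^sub>m n) $$ (a, c) * blk Q ds i i $$ (c, b))"
    using P blk_carrier[of i i] assms(1) Suc.prems by (simp add: scalar_prod_def lessThan_atLeast0)
  also have "\<dots> = (\<Sum>c<ds i. sub_power qf (block ds i) n (off ds i + a) (off ds i + c) * qf (off ds i + c) (off ds i + b))"
    using Suc by (intro sum.cong) (auto simp: blk_def)
  also have "\<dots> = sub_power qf (block ds i) (n + 1) (off ds i + a) (off ds i + b)"
    unfolding sub_power_add[OF finite_block a] 1 sum_block ..
  finally show ?case by simp
qed

lemma sub_power_positive:
  assumes "i \<in> {1..k}"
  shows "\<exists>N\<ge>1. \<forall>a\<in>block ds i. \<forall>b\<in>block ds i. sub_power qf (block ds i) N a b > 0"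
proof -
  obtain m0 where m0: "\<And>m a b. m \<ge> m0 \<Longrightarrow> a < ds i \<Longrightarrow> b < ds i \<Longrightarrow> (blk Q ds i i ^\<^sub>m m) $$ (a, b) > 0"
    using evpos[OF assms] unfolding eventually_positive_def by (auto simp: blk_def)
  \<comment> \<open>\<open>Suc m0\<close> makes the exponent positive; otherwise a positive power
    could not exclude a root equal to zero.\<close>
  have "sub_power qf (block ds i) (Suc m0) a b > 0" if "a \<in> block ds i" "b \<in> block ds i" for a b
    using block_offset[OF that(1)] block_offset[OF that(2)] m0[of "Suc m0"] blk_pow[where n = "Suc m0"]
    by (metis le_Suc_eq order_refl)
  then show ?thesis by (intro exI[of _ "Suc m0"]) auto
qed

lemma off_in_block: "i \<in> {1..k} \<Longrightarrow> off ds i \<in> block ds i"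
  using ds_pos[of i] by (simp add: block_def)

text \<open>Only the eigenvector equation is used: nonnegative entries give
  \<open>\<rho> i \<ge> 0\<close>, and a power with positive entries rules out 0.\<close>

lemma rho_pos:
  assumes i: "i \<in> {1..k}"
  shows "\<rho> i > 0"
proof -
  obtain N where N: "N \<ge> 1" "\<And>a b. a \<in> block ds i \<Longrightarrow> b \<in> block ds i \<Longrightarrow> sub_power qf (block ds i) N a b > 0"
    using sub_power_positive[OF i] by blast
  note a = off_in_block[OF i]
  have "0 \<le> (\<Sum>b\<in>block ds i. qf (off ds i) b * vf i b)"
    using block_less[OF i] a vf_pos[OF i] Q_nonneg
    by (intro sum_nonneg mult_nonneg_nonneg) (auto intro: less_imp_le)
  then have "\<rho> i * vf i (off ds i) \<ge> 0" unfolding vf_eig[OF i a] .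
  then have "\<rho> i \<ge> 0" using vf_pos[OF i a] by (simp add: zero_le_mult_iff)
  have "0 < (\<Sum>b\<in>block ds i. sub_power qf (block ds i) N (off ds i) b * vf i b)"
    using a N(2) vf_pos[OF i] finite_block by (intro sum_pos mult_pos_pos) auto
  also have "\<dots> = \<rho> i ^ N * vf i (off ds i)"
    by (rule sub_power_eigenvector[OF finite_block vf_eig[OF i] a])
  finally have "\<rho> i \<noteq> 0" using N(1) by (auto simp: power_0_left)
  with \<open>\<rho> i \<ge> 0\<close> show ?thesis by simp
qed

definition perron_vec :: "nat \<Rightarrow> (nat \<Rightarrow> real) \<Rightarrow> bool" where
  "perron_vec i u \<longleftrightarrow> (\<forall>b\<in>block ds i. u b \<ge> 0) \<and>
     (\<forall>a\<in>block ds i. \<forall>b\<in>block ds i.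
        (\<lambda>n. sub_power (\<lambda>a b. qf a b / \<rho> i) (block ds i) n a b) \<longlonglongrightarrow> vf i a * u b) \<and>
     (\<Sum>b\<in>block ds i. u b * vf i b) = 1 \<and>
     (\<forall>b\<in>block ds i. (\<Sum>a\<in>block ds i. u a * (qf a b / \<rho> i)) = u b)"

text \<open>Taken from the limit of the powers; uniqueness later identifies it with the left
  eigenvector named in the theorem.\<close>

definition uf :: "nat \<Rightarrow> nat \<Rightarrow> real" where
  "uf i = (SOME u. perron_vec i u)"

lemma perron_vec_uf:
  assumes i: "i \<in> {1..k}"
  shows "perron_vec i (uf i)"
proof -
  obtain N where N: "\<And>a b. a \<in> block ds i \<Longrightarrow> b \<in> block ds i \<Longrightarrow> sub_power qf (block ds i) N a b > 0"
    using sub_power_positive[OF i] by blast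
  have "\<exists>u. perron_vec i u"
  proof (rule sub_power_perron_limit[of "block ds i" "\<lambda>a b. qf a b / \<rho> i" "vf i" N])
    show "finite (block ds i)" "block ds i \<noteq> {}" using finite_block off_in_block[OF i] by auto
    show "qf a b / \<rho> i \<ge> 0" if "a \<in> block ds i" "b \<in> block ds i" for a b
      using that Q_nonneg block_less[OF i] rho_pos[OF i] by simp
    show "(\<Sum>b\<in>block ds i. qf a b / \<rho> i * vf i b) = vf i a" if "a \<in> block ds i" for a
      using vf_eig[OF i that] rho_pos[OF i] by (simp flip: sum_divide_distrib)
    show "sub_power (\<lambda>a b. qf a b / \<rho> i) (block ds i) N a b > 0" if "a \<in> block ds i" "b \<in> block ds i" for a b
      using N[OF that] rho_pos[OF i] by (simp add: sub_power_scale)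
  qed (use vf_pos[OF i] in blast, unfold perron_vec_def, blast)
  then show ?thesis unfolding uf_def by (rule someI_ex)
qed

lemma uf_nonneg: "i \<in> {1..k} \<Longrightarrow> b \<in> block ds i \<Longrightarrow> uf i b \<ge> 0"
  and uf_limit: "i \<in> {1..k} \<Longrightarrow> a \<in> block ds i \<Longrightarrow> b \<in> block ds i \<Longrightarrow>
     (\<lambda>n. sub_power (\<lambda>a b. qf a b / \<rho> i) (block ds i) n a b) \<longlonglongrightarrow> vf i a * uf i b"
  and uf_vf: "i \<in> {1..k} \<Longrightarrow> (\<Sum>b\<in>block ds i. uf i b * vf i b) = 1"
  using perron_vec_uf[of i] unfolding perron_vec_def by auto

lemma uf_left: "i \<in> {1..k} \<Longrightarrow> b \<in> block ds i \<Longrightarrow> (\<Sum>a\<in>block ds i. uf i a * qf a b) = \<rho> i * uf i b"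
  using perron_vec_uf[of i] rho_pos[of i] unfolding perron_vec_def
  by (simp flip: sum_divide_distrib) (simp add: field_simps)

text \<open>The scaled powers fix \<open>g\<close>, hence so does their rank one limit. This is the
  geometric simplicity of the root over the complex numbers.\<close>

lemma right_eigenvector_limit:
  fixes g :: "nat \<Rightarrow> complex"
  assumes i: "i \<in> {1..k}" and a: "a \<in> block ds i"
    and g: "\<And>a. a \<in> block ds i \<Longrightarrow> (\<Sum>b\<in>block ds i. of_real (qf a b) * g b) = of_real (\<rho> i) * g a"
  shows "g a = of_real (vf i a) * (\<Sum>b\<in>block ds i. of_real (uf i b) * g b)"
proof -
  let ?A = "\<lambda>a b. qf a b / \<rho> i"
  have "(\<Sum>b\<in>block ds i. of_real (sub_power ?A (block ds i) n a b) * g b) = g a" for n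
    using a
  proof (induction n arbitrary: a)
    case 0
    then show ?case using finite_block by (simp add: sum.remove[where x = a])
  next
    case (Suc n)
    have "(\<Sum>b\<in>block ds i. of_real (sub_power ?A (block ds i) (Suc n) a b) * g b)
        = (\<Sum>b\<in>block ds i. \<Sum>c\<in>block ds i. of_real (?A a c) * (of_real (sub_power ?A (block ds i) n c b) * g b))"
      by (simp add: sum_distrib_right mult.assoc)
    also have "\<dots> = (\<Sum>c\<in>block ds i. of_real (?A a c) * (\<Sum>b\<in>block ds i. of_real (sub_power ?A (block ds i) n c b) * g b))"
      unfolding sum_distrib_left by (rule sum.swap)
    also have "\<dots> = (\<Sum>c\<in>block ds i. of_real (qf a c) * g c) / of_real (\<rho> i)"
      using Suc.IH by (simp add: sum_divide_distrib)
    also have "\<dots> = g a" using g[OF Suc.prems] rho_pos[OF i] by simp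
    finally show ?case .
  qed
  moreover have "(\<lambda>n. \<Sum>b\<in>block ds i. of_real (sub_power ?A (block ds i) n a b) * g b)
      \<longlonglongrightarrow> (\<Sum>b\<in>block ds i. of_real (vf i a * uf i b) * g b)"
    by (intro tendsto_intros uf_limit i a)
  ultimately have "g a = (\<Sum>b\<in>block ds i. of_real (vf i a * uf i b) * g b)"
    using LIMSEQ_unique[OF tendsto_const] by fastforce
  then show ?thesis by (simp add: sum_distrib_left mult.assoc)
qed

text \<open>Replaces the \<open>THE\<close> in \<open>coef\<close> by the pairing that the growth
  constants contain.\<close>

lemma coef_eq:
  assumes i: "i \<in> {1..k}" and x: "x \<in> carrier_vec (ds i)"
  shows "coef Q ds v i x = (\<Sum>a<ds i. uf i (off ds i + a) * x $ a)"
  unfolding coef_def Vminus_def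
proof (rule coefficient_of_eigenvector[OF blk_carrier v_carrier[OF i] x])
  have in_block: "off ds i + a \<in> block ds i" if "a < ds i" for a using that by (simp add: block_def)
  show "(\<Sum>a<ds i. uf i (off ds i + a) * blk Q ds i i $$ (a, b)) = \<rho> i * uf i (off ds i + b)" if "b < ds i" for b
    using uf_left[OF i in_block[OF that]] that by (simp add: sum_block blk_def)
  show "(\<Sum>a<ds i. uf i (off ds i + a) * v i $ a) = 1"
    using uf_vf[OF i] by (simp add: sum_block vf_def)
  fix g :: "nat \<Rightarrow> complex" and a
  assume g: "\<And>a. a < ds i \<Longrightarrow> (\<Sum>b<ds i. of_real (blk Q ds i i $$ (a, b)) * g b) = of_real (\<rho> i) * g a"
    and 0: "(\<Sum>a<ds i. of_real (uf i (off ds i + a)) * g a) = 0" and a: "a < ds i"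
  define g' where "g' b = g (b - off ds i)" for b
  have "(\<Sum>b\<in>block ds i. of_real (qf c b) * g' b) = of_real (\<rho> i) * g' c" if c: "c \<in> block ds i" for c
  proof -
    obtain e where e: "e < ds i" "c = off ds i + e" using block_offset[OF c] by blast
    then show ?thesis using g[OF e(1)] by (simp add: sum_block g'_def blk_def)
  qed
  from right_eigenvector_limit[OF i in_block[OF a] this] 0 show "g a = 0"
    by (simp add: sum_block g'_def)
qed

section \<open>Growth constants as path weights\<close>

lemma rho_le_max: "i \<in> {1..k} \<Longrightarrow> \<rho> i \<le> \<rho>m"
  unfolding rho_max_def by (intro Max_ge) auto

lemma rho_max_pos: "\<rho>m > 0"
  using rho_le_max[of 1] rho_pos[of 1] k_pos by auto

definition ord :: "nat \<Rightarrow> nat" where "ord i = of_bool (\<rho> i = \<rho>m)"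

lemma ord_le_1: "ord i \<le> Suc 0"
  by (simp add: ord_def)

definition tot :: "nat \<Rightarrow> real" where "tot i = (if \<rho> i = \<rho>m then 1 else \<rho>m / (\<rho>m - \<rho> i))"

text \<open>A maximal block converges by the Perron limit. Otherwise (A1) makes the block scalar,
  normalisation makes both eigenvectors 1, and the powers are geometric with total
  \<open>1 / (1 - \<rho> i / \<rho>m)\<close>.\<close>

lemma sub_power_growth:
  assumes i: "i \<in> {1..k}" and a: "a \<in> block ds i" and b: "b \<in> block ds i"
  shows "pole_growth (ord i) (vf i a * (tot i * uf i b)) (\<lambda>n. sub_power (\<lambda>a b. qf a b / \<rho>m) (block ds i) n a b)"
proof (cases "\<rho> i = \<rho>m")
  case True
  then show ?thesis
    using uf_limit[OF i a b] by (simp add: ord_def tot_def pole_growth_Suc[of 0, simplified] multichoose_def)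
next
  case False
  then have lt: "\<rho> i < \<rho>m" using rho_le_max[OF i] by simp
  have bl: "block ds i = {off ds i}" using scalar[OF i lt] by (auto simp: block_def)
  have ab: "a = off ds i" "b = off ds i" using a b bl by auto
  have v1: "vf i (off ds i) = 1" using v_sum[OF i] scalar[OF i lt] by (simp add: vf_def)
  have u1: "uf i (off ds i) = 1" using uf_vf[OF i] v1 unfolding bl by simp
  have q: "qf (off ds i) (off ds i) = \<rho> i" using vf_eig[OF i a] v1 unfolding bl ab by simp
  have pow: "sub_power (\<lambda>a b. qf a b / \<rho>m) (block ds i) n (off ds i) (off ds i) = (\<rho> i / \<rho>m) ^ n" for n
    unfolding bl by (induction n) (simp_all add: q)
  have r: "\<bar>\<rho> i / \<rho>m\<bar> < 1" using lt rho_pos[OF i] by simp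
  have "(\<lambda>n. (\<rho> i / \<rho>m) ^ n) sums (1 / (1 - \<rho> i / \<rho>m))"
    using geometric_sums[of "\<rho> i / \<rho>m"] r by simp
  moreover have "1 / (1 - \<rho> i / \<rho>m) = \<rho>m / (\<rho>m - \<rho> i)"
    using rho_max_pos lt by (simp add: field_simps)
  moreover have "summable (\<lambda>n. \<bar>(\<rho> i / \<rho>m) ^ n\<bar>)"
    using summable_geometric[of "\<bar>\<rho> i / \<rho>m\<bar>"] r by (simp add: power_abs)
  ultimately show ?thesis
    using False unfolding ab pow u1 v1 by (simp add: ord_def tot_def pole_growth_0 sums_iff)
qed

sublocale bt: block_triangular "\<lambda>a b. qf a b / \<rho>m" "block ds" k vf uf ord tot
proof
  fix i j a b
  assume "i \<in> {1..k}" "j \<in> {1..k}" "i < j" "a \<in> block ds i" "b \<in> block ds j"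
  then obtain a' b' where "a' < ds i" "b' < ds j" "a = off ds i + a'" "b = off ds j + b'"
    using block_offset by metis
  moreover have "blk Q ds i j $$ (a', b') = 0"
    using lower[OF \<open>i \<in> {1..k}\<close> \<open>j \<in> {1..k}\<close> \<open>i < j\<close>] calculation by simp
  ultimately show "qf a b / \<rho>m = 0" by (simp add: blk_def)
qed (auto simp: finite_block block_disjoint intro: sub_power_growth ord_le_1)

lemma linked_iff:
  "bt.linked i j \<longleftrightarrow> blk Q ds i j \<noteq> 0\<^sub>m (ds i) (ds j)"
proof -
  have "blk Q ds i j = 0\<^sub>m (ds i) (ds j) \<longleftrightarrow> (\<forall>a<ds i. \<forall>b<ds j. qf (off ds i + a) (off ds j + b) = 0)"
    by (auto simp: mat_eq_iff blk_def)
  also have "\<dots> \<longleftrightarrow> (\<forall>a\<in>block ds i. \<forall>b\<in>block ds j. qf a b = 0)"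
    by (auto simp: block_image)
  finally show ?thesis using rho_max_pos by (auto simp: bt.linked_def)
qed

lemma paths_eq: "bt.paths = adm_paths Q ds k"
  unfolding bt.paths_def adm_paths_def admissible_def successively_conv_nth linked_iff ..

lemma path_ord_eq: "bt.path_ord \<theta> = card {t. t < length \<theta> \<and> \<rho> (\<theta> ! t) = \<rho>m}"
proof -
  have "bt.path_ord \<theta> = length (filter (\<lambda>i. \<rho> i = \<rho>m) \<theta>)"
    unfolding bt.path_ord_def by (induction \<theta>) (auto simp: ord_def)
  then show ?thesis by (simp add: length_filter_conv_card)
qed

lemma path_ord_pos_iff:
  assumes "\<theta> \<in> adm_paths Q ds k"
  shows "rho_path Q ds \<theta> = \<rho>m \<longleftrightarrow> bt.path_ord \<theta> \<ge> 1"
proof -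
  have \<theta>: "\<theta> \<noteq> []" "set \<theta> \<subseteq> {1..k}" using assms by (auto simp: adm_paths_def admissible_def)
  have "bt.path_ord \<theta> \<ge> 1 \<longleftrightarrow> {t. t < length \<theta> \<and> \<rho> (\<theta> ! t) = \<rho>m} \<noteq> {}"
    unfolding path_ord_eq by (auto simp: Suc_le_eq card_gt_0_iff)
  also have "\<dots> \<longleftrightarrow> (\<exists>i\<in>set \<theta>. \<rho> i = \<rho>m)"
    using nth_mem[of _ \<theta>] by (auto simp: in_set_conv_nth)
  also have "\<dots> \<longleftrightarrow> rho_path Q ds \<theta> = \<rho>m"
  proof
    assume "\<exists>i\<in>set \<theta>. \<rho> i = \<rho>m"
    then have "\<rho>m \<in> \<rho> ` set \<theta>" by (metis imageI)
    then show "rho_path Q ds \<theta> = \<rho>m"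
      unfolding rho_path_def using \<theta> rho_le_max by (intro Max_eqI) auto
  next
    assume "rho_path Q ds \<theta> = \<rho>m"
    moreover have "rho_path Q ds \<theta> \<in> \<rho> ` set \<theta>"
      unfolding rho_path_def using \<theta> by (intro Max_in) auto
    ultimately show "\<exists>i\<in>set \<theta>. \<rho> i = \<rho>m" by auto
  qed
  finally show ?thesis by simp
qed

lemma card_Hplus: "rho_path Q ds \<theta> = \<rho>m \<Longrightarrow> card (Hplus Q ds \<theta>) = bt.path_ord \<theta>"
  by (simp add: Hplus_def path_ord_eq)

text \<open>\<open>hplus_max\<close> ranges only over paths attaining \<rho>m. All other paths have
  order 0, and the maximum is at least 1 once \<open>Pmax\<close> is nonempty, so it bounds every
  order and \<open>Pmax\<close> is a level set of \<open>path_ord\<close>.\<close>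

lemma hplus_max_facts:
  assumes "Pmax Q ds k \<noteq> {}"
  shows "hplus_max Q ds k \<ge> 1"
    and "\<And>\<theta>. \<theta> \<in> bt.paths \<Longrightarrow> bt.path_ord \<theta> \<le> hplus_max Q ds k"
    and "Pmax Q ds k = {\<theta> \<in> bt.paths. bt.path_ord \<theta> = hplus_max Q ds k}"
proof -
  show 1: "hplus_max Q ds k \<ge> 1"
    using assms path_ord_pos_iff card_Hplus by (fastforce simp: Pmax_def)
  show 2: "bt.path_ord \<theta> \<le> hplus_max Q ds k" if "\<theta> \<in> bt.paths" for \<theta>
  proof (cases "rho_path Q ds \<theta> = \<rho>m")
    case True
    let ?S = "{card (Hplus Q ds \<theta>) |\<theta>. \<theta> \<in> adm_paths Q ds k \<and> rho_path Q ds \<theta> = \<rho>m}"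
    have "finite ?S" using bt.finite_paths unfolding paths_eq by simp
    moreover have "card (Hplus Q ds \<theta>) \<in> ?S" using that True by (auto simp: paths_eq)
    ultimately have "card (Hplus Q ds \<theta>) \<le> Max ?S" by (rule Max_ge)
    then show ?thesis using card_Hplus[OF True] by (simp add: hplus_max_def)
  next
    case False
    then show ?thesis using path_ord_pos_iff that 1 by (simp add: paths_eq)
  qed
  show "Pmax Q ds k = {\<theta> \<in> bt.paths. bt.path_ord \<theta> = hplus_max Q ds k}"
    unfolding Pmax_def paths_eq using path_ord_pos_iff card_Hplus 1 by auto
qed

lemma alpha_path_Cons:
  "alpha_path Q ds v (i # j # \<theta>) = coef Q ds v i (blk Q ds i j *\<^sub>v v j) * alpha_path Q ds v (j # \<theta>)"
  unfolding alpha_path_def by (simp add: prod.lessThan_Suc_shift del: prod.lessThan_Suc)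

lemma coef_blk_mult:
  assumes "i \<in> {1..k}" "j \<in> {1..k}"
  shows "coef Q ds v i (blk Q ds i j *\<^sub>v v j)
    = (\<Sum>b\<in>block ds i. uf i b * (\<Sum>e\<in>block ds j. qf b e * vf j e))"
proof -
  have "blk Q ds i j *\<^sub>v v j \<in> carrier_vec (ds i)"
    using blk_carrier v_carrier[OF assms(2)] by (rule mult_mat_vec_carrier)
  then have "coef Q ds v i (blk Q ds i j *\<^sub>v v j) = (\<Sum>a<ds i. uf i (off ds i + a) * (blk Q ds i j *\<^sub>v v j) $ a)"
    by (rule coef_eq[OF assms(1)])
  also have "\<dots> = (\<Sum>b\<in>block ds i. uf i b * (\<Sum>e\<in>block ds j. qf b e * vf j e))"
    using v_carrier[OF assms(2)]
    by (simp add: sum_block vf_def blk_def scalar_prod_def lessThan_atLeast0)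
  finally show ?thesis .
qed

text \<open>Each of the \<open>length \<theta> - 1\<close> links was computed with
  \<open>Q / \<rho>m\<close>; the power of \<rho>m undoes this.\<close>

lemma path_const_eq_alpha_path:
  assumes "\<theta> \<noteq> []" "set \<theta> \<subseteq> {1..k}"
  shows "bt.path_const \<theta> (\<lambda>_. 1) * \<rho>m ^ (length \<theta> - 1)
    = alpha_path Q ds v \<theta> * (\<Prod>t<length \<theta>. tot (\<theta> ! t))"
  using assms
proof (induction \<theta> rule: induct_list012)
  case (2 i)
  then have "coef Q ds v i (vec (ds i) (\<lambda>_. 1)) = (\<Sum>b\<in>block ds i. uf i b)"
    using coef_eq[of i "vec (ds i) (\<lambda>_. 1)"] by (simp add: sum_block)
  then show ?case by (simp add: alpha_path_def)
next
  case (3 i j \<theta>)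
  have "(\<Sum>b\<in>block ds i. uf i b * (\<Sum>e\<in>block ds j. qf b e / \<rho>m * vf j e)) * \<rho>m
      = coef Q ds v i (blk Q ds i j *\<^sub>v v j)"
    using 3 rho_max_pos by (simp add: coef_blk_mult sum_distrib_left sum_distrib_right)
  then have c: "(\<Sum>b\<in>block ds i. uf i b * (\<Sum>e\<in>block ds j. qf b e / \<rho>m * vf j e))
      = coef Q ds v i (blk Q ds i j *\<^sub>v v j) / \<rho>m"
    using rho_max_pos by (simp add: field_simps)
  have "bt.path_const (i # j # \<theta>) (\<lambda>_. 1) * \<rho>m ^ (length (i # j # \<theta>) - 1)
     = tot i * coef Q ds v i (blk Q ds i j *\<^sub>v v j) * (bt.path_const (j # \<theta>) (\<lambda>_. 1) * \<rho>m ^ (length (j # \<theta>) - 1))"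
    unfolding bt.path_const.simps c using rho_max_pos by simp
  also have "\<dots> = tot i * coef Q ds v i (blk Q ds i j *\<^sub>v v j) *
      (alpha_path Q ds v (j # \<theta>) * (\<Prod>t<length (j # \<theta>). tot ((j # \<theta>) ! t)))"
    using 3 by simp
  also have "\<dots> = alpha_path Q ds v (i # j # \<theta>) * (\<Prod>t<length (i # j # \<theta>). tot ((i # j # \<theta>) ! t))"
    unfolding alpha_path_Cons by (simp add: prod.lessThan_Suc_shift del: prod.lessThan_Suc)
  finally show ?case .
qed simp

lemma prod_tot:
  assumes "set \<theta> \<subseteq> {1..k}" "rho_path Q ds \<theta> = \<rho>m"
  shows "(\<Prod>t<length \<theta>. tot (\<theta> ! t))
    = \<rho>m ^ card (Hminus Q ds \<theta>) * (\<Prod>t\<in>Hminus Q ds \<theta>. 1 / (\<rho>m - \<rho> (\<theta> ! t)))"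
proof -
  have "(\<Prod>t<length \<theta>. tot (\<theta> ! t)) = (\<Prod>t\<in>Hminus Q ds \<theta>. tot (\<theta> ! t))"
  proof (rule prod.mono_neutral_right)
    show "\<forall>t\<in>{..<length \<theta>} - Hminus Q ds \<theta>. tot (\<theta> ! t) = 1"
    proof
      fix t assume t: "t \<in> {..<length \<theta>} - Hminus Q ds \<theta>"
      then have "\<theta> ! t \<in> {1..k}" using assms(1) nth_mem by blast
      then have "\<rho> (\<theta> ! t) \<le> \<rho>m" by (rule rho_le_max)
      then show "tot (\<theta> ! t) = 1" using t assms(2) by (auto simp: Hminus_def tot_def)
    qed
  qed (auto simp: Hminus_def)
  also have "\<dots> = (\<Prod>t\<in>Hminus Q ds \<theta>. \<rho>m * (1 / (\<rho>m - \<rho> (\<theta> ! t))))"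
    using assms(2) by (intro prod.cong) (auto simp: Hminus_def tot_def)
  finally show ?thesis by (simp only: prod.distrib prod_constant)
qed

lemma card_Hplus_Hminus:
  assumes "set \<theta> \<subseteq> {1..k}" "rho_path Q ds \<theta> = \<rho>m"
  shows "card (Hplus Q ds \<theta>) + card (Hminus Q ds \<theta>) = length \<theta>"
proof -
  have "Hplus Q ds \<theta> \<union> Hminus Q ds \<theta> = {..<length \<theta>}"
  proof (rule subset_antisym; rule subsetI)
    fix t assume "t \<in> {..<length \<theta>}"
    moreover from this have "\<theta> ! t \<in> {1..k}" using assms(1) nth_mem by blast
    then have "\<rho> (\<theta> ! t) \<le> \<rho>m" by (rule rho_le_max)
    ultimately show "t \<in> Hplus Q ds \<theta> \<union> Hminus Q ds \<theta>"
      using assms(2) by (auto simp: Hplus_def Hminus_def)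
  qed (auto simp: Hplus_def Hminus_def)
  moreover have "Hplus Q ds \<theta> \<inter> Hminus Q ds \<theta> = {}" by (auto simp: Hplus_def Hminus_def)
  moreover have "finite (Hplus Q ds \<theta>)" "finite (Hminus Q ds \<theta>)" by (auto simp: Hplus_def Hminus_def)
  ultimately show ?thesis by (simp flip: card_Un_disjoint)
qed

lemma piv_eq: "piv ds \<pi> v i = (\<Sum>a\<in>block ds i. \<pi> $ a * vf i a)"
  by (simp add: piv_def sum_block vf_def)

text \<open>The links give \<rho>m the exponent \<open>-(length \<theta> - 1)\<close>, and each
  position in \<open>Hminus\<close> returns one factor. What is left, \<open>-(h - 1)\<close> with
  \<open>h = hplus_max Q ds k\<close>, is the same for all paths in \<open>Pmax\<close>.\<close>

lemma path_const_eq_path_weight: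
  assumes "\<theta> \<in> Pmax Q ds k"
  shows "bt.path_const \<theta> (\<lambda>_. 1) * (\<Sum>a\<in>block ds (hd \<theta>). \<pi> $ a * vf (hd \<theta>) a)
    = path_weight Q ds k \<pi> v \<theta> / \<rho>m ^ (hplus_max Q ds k - 1)"
proof -
  let ?h = "hplus_max Q ds k"
  have h: "?h \<ge> 1" using hplus_max_facts(1) assms by blast
  have \<theta>: "\<theta> \<noteq> []" "set \<theta> \<subseteq> {1..k}" "rho_path Q ds \<theta> = \<rho>m" "card (Hplus Q ds \<theta>) = ?h"
    using assms by (auto simp: Pmax_def adm_paths_def admissible_def)
  let ?W = "\<Prod>t\<in>Hminus Q ds \<theta>. 1 / (\<rho>m - \<rho> (\<theta> ! t))"
  have len: "length \<theta> - 1 = (?h - 1) + card (Hminus Q ds \<theta>)"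
    using card_Hplus_Hminus[OF \<theta>(2,3)] \<theta>(4) h by simp
  have "bt.path_const \<theta> (\<lambda>_. 1) * \<rho>m ^ (?h - 1) * \<rho>m ^ card (Hminus Q ds \<theta>)
      = alpha_path Q ds v \<theta> * ?W * \<rho>m ^ card (Hminus Q ds \<theta>)"
    using path_const_eq_alpha_path[OF \<theta>(1,2)] unfolding prod_tot[OF \<theta>(2,3)] len power_add
    by (simp add: algebra_simps)
  then have "bt.path_const \<theta> (\<lambda>_. 1) * \<rho>m ^ (?h - 1) = alpha_path Q ds v \<theta> * ?W"
    using rho_max_pos by simp
  then have "bt.path_const \<theta> (\<lambda>_. 1) = alpha_path Q ds v \<theta> * ?W / \<rho>m ^ (?h - 1)"
    using rho_max_pos by (simp add: field_simps)
  then show ?thesis by (simp add: path_weight_def piv_eq)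
qed

lemma alpha_path_nonneg:
  assumes "\<theta> \<noteq> []" "set \<theta> \<subseteq> {1..k}"
  shows "alpha_path Q ds v \<theta> \<ge> 0"
  using assms
proof (induction \<theta> rule: induct_list012)
  case (2 i)
  then show ?case
    using coef_eq[of i "vec (ds i) (\<lambda>_. 1)"]
    by (auto simp: alpha_path_def block_def intro!: sum_nonneg uf_nonneg)
next
  case (3 i j \<theta>)
  have "coef Q ds v i (blk Q ds i j *\<^sub>v v j) \<ge> 0"
    using 3 block_less[of i] block_less[of j] vf_pos[of j]
    by (auto simp: coef_blk_mult intro!: sum_nonneg mult_nonneg_nonneg uf_nonneg Q_nonneg less_imp_le[OF vf_pos])
  then show ?case using 3 by (simp add: alpha_path_Cons)
qed simp

text \<open>Nonnegativity excludes cancellation between paths, so a single path as in (A2) makes the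
  denominator of the limit positive.\<close>

lemma path_weight_nonneg:
  assumes "\<theta> \<in> Pmax Q ds k" "\<And>a. a < d \<Longrightarrow> \<pi> $ a \<ge> 0"
  shows "path_weight Q ds k \<pi> v \<theta> \<ge> 0"
    and "alpha_path Q ds v \<theta> \<noteq> 0 \<Longrightarrow> piv ds \<pi> v (hd \<theta>) \<noteq> 0 \<Longrightarrow> path_weight Q ds k \<pi> v \<theta> > 0"
proof -
  have \<theta>: "\<theta> \<noteq> []" "set \<theta> \<subseteq> {1..k}" "rho_path Q ds \<theta> = \<rho>m"
    using assms(1) by (auto simp: Pmax_def adm_paths_def admissible_def)
  have hd: "hd \<theta> \<in> {1..k}" using \<theta> by (meson hd_in_set subsetD)
  have 1: "alpha_path Q ds v \<theta> \<ge> 0" by (rule alpha_path_nonneg[OF \<theta>(1,2)])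
  have 2: "piv ds \<pi> v (hd \<theta>) \<ge> 0"
    unfolding piv_eq using assms(2) block_less[OF hd] vf_pos[OF hd]
    by (intro sum_nonneg mult_nonneg_nonneg) (auto intro: less_imp_le)
  have 3: "(\<Prod>t\<in>Hminus Q ds \<theta>. 1 / (\<rho>m - \<rho> (\<theta> ! t))) > 0"
    using \<theta>(3) by (intro prod_pos) (auto simp: Hminus_def)
  show "path_weight Q ds k \<pi> v \<theta> \<ge> 0" unfolding path_weight_def using 1 2 3 by simp
  show "path_weight Q ds k \<pi> v \<theta> > 0" if "alpha_path Q ds v \<theta> \<noteq> 0" "piv ds \<pi> v (hd \<theta>) \<noteq> 0"
    unfolding path_weight_def using 1 2 3 that by simp
qed

end

section \<open>The quotient of occupation and survival\<close>

text \<open>The quotient of the two comparison sequences is \<open>(r + n + 1) / (r + 1)\<close>;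
  division by \<open>n + 1\<close> leaves \<open>1 / (r + 1)\<close> in the limit, and
  \<open>r + 1\<close> is the number of maximal blocks.\<close>

lemma pole_growth_quotient_tendsto:
  assumes "pole_growth (Suc (Suc r)) c x" "pole_growth (Suc r) c' y" "c' \<noteq> 0"
  shows "(\<lambda>n. x n / real (Suc n) / y n) \<longlonglongrightarrow> c / c' * (1 / real (Suc r))"
proof -
  have "(\<lambda>n. real r / real n) \<longlonglongrightarrow> 0" by (rule lim_const_over_n)
  then have "(\<lambda>n. 1 / real (Suc r) * (1 + real r / real (Suc n))) \<longlonglongrightarrow> 1 / real (Suc r) * (1 + 0)"
    by (intro tendsto_intros LIMSEQ_Suc)
  also have "(\<lambda>n. 1 / real (Suc r) * (1 + real r / real (Suc n)))
      = (\<lambda>n. multichoose (Suc r) n / multichoose r n / real (Suc n))"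
  proof
    fix n
    have "multichoose (Suc r) n / multichoose r n = inverse (multichoose r n / multichoose (Suc r) n)"
      by simp
    also have "\<dots> = real (Suc (r + n)) / real (Suc r)" unfolding multichoose_Suc_left by simp
    finally have *: "multichoose (Suc r) n / multichoose r n = real (Suc (r + n)) / real (Suc r)" .
    show "1 / real (Suc r) * (1 + real r / real (Suc n)) = multichoose (Suc r) n / multichoose r n / real (Suc n)"
      unfolding * by (simp add: field_simps)
  qed
  finally have ratio: "(\<lambda>n. multichoose (Suc r) n / multichoose r n / real (Suc n)) \<longlonglongrightarrow> 1 / real (Suc r)"
    by simp
  have "(\<lambda>n. x n / multichoose (Suc r) n / (y n / multichoose r n) * (multichoose (Suc r) n / multichoose r n / real (Suc n)))
      \<longlonglongrightarrow> c / c' * (1 / real (Suc r))"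
    using assms by (intro tendsto_mult tendsto_divide ratio) (simp_all add: pole_growth_Suc)
  moreover have "x n / multichoose (Suc r) n / (y n / multichoose r n) * (multichoose (Suc r) n / multichoose r n / real (Suc n))
      = x n / real (Suc n) / y n" for n
  proof -
    have cancel: "a / M / (b / m) * (M / m / S) = a / S / b" if "M \<noteq> 0" "m \<noteq> 0" for a b M m S :: real
      using that by (simp add: divide_simps)
    show ?thesis
      using multichoose_pos[of r n] multichoose_pos[of "Suc r" n] by (intro cancel) auto
  qed
  ultimately show ?thesis by (simp only:)
qed

context frobenius_form
begin

text \<open>Mirror image of \<open>right_eigenvector_limit\<close>: a row vector fixed by the scaled
  powers is a multiple of the row vector in their limit.\<close>

lemma left_eigenvector_limit:
  assumes i: "i \<in> {1..k}" and b: "b \<in> block ds i"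
    and w: "\<And>b. b \<in> block ds i \<Longrightarrow> (\<Sum>a\<in>block ds i. w a * qf a b) = \<rho> i * w b"
  shows "w b = (\<Sum>a\<in>block ds i. w a * vf i a) * uf i b"
proof -
  let ?A = "\<lambda>a b. qf a b / \<rho> i"
  have "(\<Sum>a\<in>block ds i. w a * sub_power ?A (block ds i) n a b) = w b" for n
  proof (induction n)
    case 0
    then show ?case using b finite_block by (simp add: sum.remove[where x = b])
  next
    case (Suc n)
    have "(\<Sum>a\<in>block ds i. w a * sub_power ?A (block ds i) (Suc n) a b)
        = (\<Sum>c\<in>block ds i. \<Sum>a\<in>block ds i. w a * (?A a c * sub_power ?A (block ds i) n c b))"
      unfolding sub_power.simps sum_distrib_left by (rule sum.swap)
    also have "\<dots> = (\<Sum>c\<in>block ds i. (\<Sum>a\<in>block ds i. w a * qf a c) / \<rho> i * sub_power ?A (block ds i) n c b)"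
      by (simp add: sum_distrib_right sum_divide_distrib mult.assoc)
    also have "\<dots> = w b" using Suc w rho_pos[OF i] by simp
    finally show ?case .
  qed
  moreover have "(\<lambda>n. \<Sum>a\<in>block ds i. w a * sub_power ?A (block ds i) n a b)
      \<longlonglongrightarrow> (\<Sum>a\<in>block ds i. w a * (vf i a * uf i b))"
    by (intro tendsto_intros uf_limit i b)
  ultimately have "w b = (\<Sum>a\<in>block ds i. w a * (vf i a * uf i b))"
    using LIMSEQ_unique[OF tendsto_const] by fastforce
  then show ?thesis by (simp add: sum_distrib_right mult.assoc)
qed

lemma right_eigenvector_unique:
  fixes x :: "real vec"
  assumes i: "i \<in> {1..k}" and x: "x \<in> carrier_vec (ds i)" "blk Q ds i i *\<^sub>v x = \<rho> i \<cdot>\<^sub>v x" "(\<Sum>a<ds i. x $ a) = 1"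
    and a: "a \<in> block ds i"
  shows "vf i a = x $ (a - off ds i)"
proof -
  define g where "g b = complex_of_real (x $ (b - off ds i))" for b
  define c where "c = (\<Sum>b\<in>block ds i. complex_of_real (uf i b) * g b)"
  have eig: "(\<Sum>b\<in>block ds i. of_real (qf e b) * g b) = of_real (\<rho> i) * g e" if e: "e \<in> block ds i" for e
  proof -
    obtain e' where e': "e' < ds i" "e = off ds i + e'" using block_offset[OF e] by blast
    have "(blk Q ds i i *\<^sub>v x) $ e' = (\<rho> i \<cdot>\<^sub>v x) $ e'" using x(2) by simp
    then have "(\<Sum>b<ds i. qf e (off ds i + b) * x $ b) = \<rho> i * x $ e'"
      using e' x(1) by (simp add: blk_def scalar_prod_def lessThan_atLeast0)
    then show ?thesis
      using e' by (simp add: sum_block g_def flip: of_real_mult of_real_sum)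
  qed
  have g: "g e = of_real (vf i e) * c" if "e \<in> block ds i" for e
    unfolding c_def by (rule right_eigenvector_limit[OF i that eig])
  have "(\<Sum>e\<in>block ds i. g e) = of_real (\<Sum>e\<in>block ds i. vf i e) * c"
    using g by (simp add: sum_distrib_right)
  moreover have "(\<Sum>e\<in>block ds i. g e) = 1"
    using x(3) by (simp add: sum_block g_def flip: of_real_sum)
  moreover have "(\<Sum>e\<in>block ds i. vf i e) = 1" using v_sum[OF i] by (simp add: sum_block vf_def)
  ultimately have "c = 1" by simp
  then show ?thesis using g[OF a] by (simp add: g_def)
qed

lemma left_eigenvector_unique:
  fixes w :: "real vec"
  assumes i: "i \<in> {1..k}" and w: "w \<in> carrier_vec (ds i)" "transpose_mat (blk Q ds i i) *\<^sub>v w = \<rho> i \<cdot>\<^sub>v w"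
      "(\<Sum>a<ds i. w $ a * vf i (off ds i + a)) = 1"
    and a: "a \<in> block ds i"
  shows "uf i a = w $ (a - off ds i)"
proof -
  define g where "g b = w $ (b - off ds i)" for b
  have "(\<Sum>b\<in>block ds i. g b * qf b e) = \<rho> i * g e" if e: "e \<in> block ds i" for e
  proof -
    obtain e' where e': "e' < ds i" "e = off ds i + e'" using block_offset[OF e] by blast
    have "(transpose_mat (blk Q ds i i) *\<^sub>v w) $ e' = (\<rho> i \<cdot>\<^sub>v w) $ e'" using w(2) by simp
    then show ?thesis
      using e' w(1) by (simp add: sum_block g_def blk_def scalar_prod_def lessThan_atLeast0 mult.commute)
  qed
  from left_eigenvector_limit[OF i a this] have "g a = (\<Sum>a\<in>block ds i. g a * vf i a) * uf i a" .
  then show ?thesis using w(3) by (simp add: sum_block g_def)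
qed

text \<open>Numerator and denominator both scale by \<open>\<rho>m ^ n\<close>, so the quotient is
  unchanged while the dominant rate becomes 1.\<close>

lemma cond_occupation_eq_scaled:
  "cond_occupation Q R \<pi> d n (Suc s) =
    (\<Sum>a<d. \<pi> $ a * forced (\<lambda>a b. qf a b / \<rho>m) {..<d}
        (\<lambda>m b. of_bool (b = s) * forced (\<lambda>a b. qf a b / \<rho>m) {..<d} impulse m s) n a) / real (Suc n) /
    (\<Sum>a<d. \<pi> $ a * forced (\<lambda>a b. qf a b / \<rho>m) {..<d} impulse n a)"
proof -
  have imp: "(\<lambda>n a. impulse n a / \<rho>m ^ n) = impulse"
    by (auto simp: impulse_def fun_eq_iff)
  have D: "forced (\<lambda>a b. qf a b / \<rho>m) {..<d} impulse n a = forced qf {..<d} impulse n a / \<rho>m ^ n" for n a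
    using forced_scale[of qf \<rho>m "{..<d}" impulse n a] unfolding imp .
  have "(\<lambda>m b. of_bool (b = s) * forced (\<lambda>a b. qf a b / \<rho>m) {..<d} impulse m s)
      = (\<lambda>m b. of_bool (b = s) * forced qf {..<d} impulse m s / \<rho>m ^ m)"
    unfolding D by simp
  then have N: "forced (\<lambda>a b. qf a b / \<rho>m) {..<d}
        (\<lambda>m b. of_bool (b = s) * forced (\<lambda>a b. qf a b / \<rho>m) {..<d} impulse m s) n a
      = forced qf {..<d} (\<lambda>m b. of_bool (b = s) * forced qf {..<d} impulse m s) n a / \<rho>m ^ n" for n a
    using forced_scale[of qf \<rho>m "{..<d}" "\<lambda>m b. of_bool (b = s) * forced qf {..<d} impulse m s" n a] by simp
  have cancel: "a / S / b = a / \<rho>m ^ n / S / (b / \<rho>m ^ n)" for a b S :: real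
    using rho_max_pos by (simp add: divide_simps)
  show ?thesis
    unfolding cond_occupation_eq_forced N
    unfolding D times_divide_eq_right sum_divide_distrib[symmetric]
    by (rule cancel)
qed

lemma cond_occupation_tendsto:
  assumes \<pi>: "\<And>a. a < d \<Longrightarrow> \<pi> $ a \<ge> 0"
    and pos: "\<exists>\<theta>\<in>Pmax Q ds k. alpha_path Q ds v \<theta> \<noteq> 0 \<and> piv ds \<pi> v (hd \<theta>) \<noteq> 0"
    and l: "l \<in> {1..k}" "\<rho> l = \<rho>m" "s \<in> block ds l"
  shows "(\<lambda>n. cond_occupation Q R \<pi> d n (Suc s)) \<longlonglongrightarrow>
     uf l s * vf l s * (1 / real (hplus_max Q ds k)) *
     ((\<Sum>\<theta>\<in>{\<theta> \<in> Pmax Q ds k. l \<in> set \<theta>}. path_weight Q ds k \<pi> v \<theta>) /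
      (\<Sum>\<theta>\<in>Pmax Q ds k. path_weight Q ds k \<pi> v \<theta>))"
proof -
  have Pne: "Pmax Q ds k \<noteq> {}" using pos by blast
  note hf = hplus_max_facts[OF Pne]
  obtain r where r: "hplus_max Q ds k = Suc r" using hf(1) by (cases "hplus_max Q ds k") auto
  have finP: "finite (Pmax Q ds k)" unfolding hf(3) using bt.finite_paths by simp
  let ?W = "\<Sum>\<theta>\<in>Pmax Q ds k. path_weight Q ds k \<pi> v \<theta>"
  let ?Wl = "\<Sum>\<theta>\<in>{\<theta> \<in> Pmax Q ds k. l \<in> set \<theta>}. path_weight Q ds k \<pi> v \<theta>"
  have "?W > 0"
    using pos finP path_weight_nonneg[of _ \<pi>] \<pi> by (meson sum_pos2)
  have weight: "bt.path_const \<theta> (\<lambda>_. 1) * (\<Sum>a\<in>block ds (hd \<theta>). \<pi> $ a * vf (hd \<theta>) a)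
      = path_weight Q ds k \<pi> v \<theta> / \<rho>m ^ r" if "\<theta> \<in> Pmax Q ds k" for \<theta>
    using path_const_eq_path_weight[OF that, of \<pi>] r by simp
  have "{\<theta> \<in> bt.paths. l \<in> set \<theta> \<and> bt.path_ord \<theta> = hplus_max Q ds k} = {\<theta> \<in> Pmax Q ds k. l \<in> set \<theta>}"
    unfolding hf(3) by auto
  then have occ: "pole_growth (Suc (Suc r)) (uf l s * vf l s * (?Wl / \<rho>m ^ r))
      (\<lambda>n. \<Sum>a<d. \<pi> $ a * forced (\<lambda>a b. qf a b / \<rho>m) {..<d}
        (\<lambda>m b. of_bool (b = s) * forced (\<lambda>a b. qf a b / \<rho>m) {..<d} impulse m s) n a)"
    using bt.occupation_growth[OF hf(2) l(1,3), where w = "\<lambda>a. \<pi> $ a", unfolded UN_block_eq] l(2)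
    by (simp add: weight r ord_def tot_def sum_divide_distrib)
  have surv: "pole_growth (Suc r) (?W / \<rho>m ^ r)
      (\<lambda>n. \<Sum>a<d. \<pi> $ a * forced (\<lambda>a b. qf a b / \<rho>m) {..<d} impulse n a)"
    using bt.survival_growth[OF hf(2), where w = "\<lambda>a. \<pi> $ a", unfolded UN_block_eq hf(3)[symmetric]]
    by (simp add: weight r sum_divide_distrib)
  have "?W / \<rho>m ^ r \<noteq> 0" using \<open>?W > 0\<close> rho_max_pos by simp
  from pole_growth_quotient_tendsto[OF occ surv this]
  have "(\<lambda>n. cond_occupation Q R \<pi> d n (Suc s)) \<longlonglongrightarrow>
      uf l s * vf l s * (?Wl / \<rho>m ^ r) / (?W / \<rho>m ^ r) * (1 / real (Suc r))"
    unfolding cond_occupation_eq_scaled .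
  also have "uf l s * vf l s * (?Wl / \<rho>m ^ r) / (?W / \<rho>m ^ r) * (1 / real (Suc r))
      = uf l s * vf l s * (1 / real (Suc r)) * (?Wl / ?W)"
    using rho_max_pos by simp
  finally show ?thesis unfolding r .
qed

end

theorem theorem3p20:
  fixes d k :: nat and Q :: "real mat" and R \<pi> :: "real vec" and ds :: "nat \<Rightarrow> nat"
    and v :: "nat \<Rightarrow> real vec" and l s :: nat and ul vl :: "real vec"
  assumes d2: "d \<ge> 2"
    and Qc: "Q \<in> carrier_mat d d" and Rc: "R \<in> carrier_vec d" and pic: "\<pi> \<in> carrier_vec d"
    and stoch: "\<forall>i<d. R $ i \<ge> 0 \<and> (\<forall>j<d. Q $$ (i,j) \<ge> 0) \<and> R $ i + (\<Sum>j<d. Q $$ (i,j)) = 1"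
    and R0: "R \<noteq> 0\<^sub>v d" and Q0: "Q \<noteq> 0\<^sub>m d d"
    and eig: "\<forall>\<mu>. eigenvalue (cmat Q) \<mu> \<longrightarrow> cmod \<mu> < 1"
    and pi_dist: "(\<forall>i<d. \<pi> $ i \<ge> 0) \<and> (\<Sum>i<d. \<pi> $ i) = 1"
    and k1: "k \<ge> 1" and ds_pos: "\<forall>i\<in>{1..k}. ds i \<ge> 1" and ds_sum: "(\<Sum>i\<in>{1..k}. ds i) = d"
    and lower: "\<forall>i\<in>{1..k}. \<forall>j\<in>{1..k}. i < j \<longrightarrow> blk Q ds i j = 0\<^sub>m (ds i) (ds j)"
    and evpos: "\<forall>i\<in>{1..k}. eventually_positive (blk Q ds i i)"
    and v_ok: "\<forall>i\<in>{1..k}. v i \<in> carrier_vec (ds i) \<and> (\<forall>a<ds i. v i $ a > 0) \<and>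
                 blk Q ds i i *\<^sub>v v i = PF_eig Q ds i \<cdot>\<^sub>v v i \<and> (\<Sum>a<ds i. v i $ a) = 1"
    and A1: "\<forall>i\<in>{1..k}. PF_eig Q ds i < rho_max Q ds k \<longrightarrow> ds i = 1"
    and A2: "\<exists>\<theta>\<in>Pmax Q ds k. alpha_path Q ds v \<theta> \<noteq> 0 \<and> piv ds \<pi> v (hd \<theta>) \<noteq> 0"
    and lk: "l \<in> {1..k}" and l_max: "PF_eig Q ds l = rho_max Q ds k"
    and Pl: "{\<theta> \<in> Pmax Q ds k. l \<in> set \<theta>} \<noteq> {}"
    and vl: "vl \<in> carrier_vec (ds l) \<and> (\<forall>a<ds l. vl $ a > 0) \<and>
             blk Q ds l l *\<^sub>v vl = PF_eig Q ds l \<cdot>\<^sub>v vl \<and> (\<Sum>a<ds l. vl $ a) = 1"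
    and ul: "ul \<in> carrier_vec (ds l) \<and> (\<forall>a<ds l. ul $ a > 0) \<and>
             transpose_mat (blk Q ds l l) *\<^sub>v ul = PF_eig Q ds l \<cdot>\<^sub>v ul \<and> ul \<bullet> vl = 1"
    and s: "s \<in> {off ds l + 1 .. off ds l + ds l}"
  shows "(\<lambda>n. cond_occupation Q R \<pi> d n s) \<longlonglongrightarrow>
     ul $ (s - off ds l - 1) * vl $ (s - off ds l - 1) * (1 / real (hplus_max Q ds k)) *
     ((\<Sum>\<theta>\<in>{\<theta> \<in> Pmax Q ds k. l \<in> set \<theta>}. path_weight Q ds k \<pi> v \<theta>) /
      (\<Sum>\<theta>\<in>Pmax Q ds k. path_weight Q ds k \<pi> v \<theta>))"
proof -
  interpret frobenius_form d k Q ds v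
    by unfold_locales (use stoch k1 ds_pos ds_sum lower evpos v_ok A1 in auto)
  \<comment> \<open>Transient states are numbered from 1 in the chain and from 0 in
    \<open>Q\<close>, so state \<open>s\<close> is index \<open>s - 1\<close>.\<close>
  have s1: "s = Suc (s - 1)" "s - off ds l - 1 = s - 1 - off ds l" and sb: "s - 1 \<in> block ds l"
    using s by (auto simp: block_def)
  \<comment> \<open>Uniqueness pins down \<open>vl\<close> first, because the normalisation of
    \<open>ul\<close> refers to it.\<close>
  have v_eq: "vf l a = vl $ (a - off ds l)" if "a \<in> block ds l" for a
    using vl that by (intro right_eigenvector_unique[OF lk]) auto
  have "(\<Sum>a<ds l. ul $ a * vf l (off ds l + a)) = ul \<bullet> vl"
    using vl by (auto simp: scalar_prod_def v_eq block_def lessThan_atLeast0)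
  then have u_eq: "uf l (s - 1) = ul $ (s - 1 - off ds l)"
    using ul sb by (intro left_eigenvector_unique[OF lk]) auto
  have "(\<lambda>n. cond_occupation Q R \<pi> d n (Suc (s - 1))) \<longlonglongrightarrow>
     uf l (s - 1) * vf l (s - 1) * (1 / real (hplus_max Q ds k)) *
     ((\<Sum>\<theta>\<in>{\<theta> \<in> Pmax Q ds k. l \<in> set \<theta>}. path_weight Q ds k \<pi> v \<theta>) /
      (\<Sum>\<theta>\<in>Pmax Q ds k. path_weight Q ds k \<pi> v \<theta>))"
    using pi_dist A2 lk l_max sb by (intro cond_occupation_tendsto) auto
  then show ?thesis unfolding s1(1)[symmetric] s1(2) u_eq v_eq[OF sb] .
qed

end
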